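(* Let $\alpha>0$ and $(\Sigma_n)_n\in\mathrm{CovMat}(\alpha)$ be arbitrary, and let $(a_n)_n$ be a Gaussian triangular scheme constructed with respect to $\alpha$ and $(\Sigma_n)_n$ (as defined in the context). Let $b=(b_n)_n$ be a sequence of $n$-bandwidths with $b_n\to\infty$ and let $(X_n)_n$ be the periodic random band matrices based on $(a_n)_n$ with bandwidth $b$. Then: i) If $\alpha\ge\frac12$, then the semicircle law holds in probability for $(X_n)_n$. ii) If $\alpha>\frac12$ and $\big(\frac1{b_n^2}\big)_n$ is summable, then the semicircle law holds almost surely for $(X_n)_n$. (In particular this applies to full matrices, $b_n=n$.)
   Context: $\mathbb N=\{1,2,\dots\}$, $[n]=\{1,\dots,n\}$, $\square_n=[n]\times[n]$, $\Delta_n=n(n+1)/2$. All random variables are defined on a common probability space. For $\alpha>0$, $\mathrm{CovMat}(\alpha)$ is the set of all sequences $(\Sigma_n)_n$ where each $\Sigma_n$ is a real symmetric positive definite $n\times n$ matrix with $\Sigma_n(i,i)=1$ for all $i\in[n]$ and $|\Sigma_n(i,j)|\le n^{-\alpha}$ for all $i\ne j$ in $[n]$. Gaussian triangular scheme constructed with respect to $\alpha$ and $(\Sigma_n)_n\in\mathrm{CovMat}(\alpha)$: for each $n$ let $(Y^{(n)}_1,\dots,Y^{(n)}_{\Delta_n})\sim\mathcal N(0,\Sigma_{\Delta_n})$, fix a map $\varphi_n:\square_n\to[\Delta_n]$ whose restriction to $\{(i,j)\in\square_n:i\le j\}$ is a bijection and which satisfies $\varphi_n(i,j)=\varphi_n(j,i)$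 for all $(i,j)\in\square_n$ with $j<i$, and let $a_n$ be the symmetric $n\times n$ random matrix with $a_n(i,j)=Y^{(n)}_{\varphi_n(i,j)}$ for all $(i,j)\in\square_n$. For $n\in\mathbb N$, an ($n$-)bandwidth is a number $b_n\in\{b\in\mathbb N: b<n,\ b\text{ odd}\}\cup\{n\}$. If $b_n=n$, all index pairs $(i,j)\in\square_n$ are $b_n$-relevant; if $b_n<n$, the pair $(i,j)$ is $b_n$-relevant iff $|i-j|\le\frac{b_n-1}{2}$ or $|i-j|\ge n-\frac{b_n-1}{2}$. The periodic random band matrices based on $(a_n)_n$ with bandwidth $b=(b_n)_n$ are the $n\times n$ matrices $X_n$ with $X_n(i,j)=b_n^{-1/2}a_n(i,j)$ if $(i,j)$ is $b_n$-relevant and $X_n(i,j)=0$ otherwise. The empirical spectral distribution of $X_n$ is $\sigma_n=\frac1n\sum_{i=1}^n\delta_{\lambda_i}$, with $\lambda_1\le\dots\le\lambda_n$ the eigenvalues of $X_n$. The semicircle distribution $\sigma$ has Lebesgue density $\frac1{2\pi}\sqrt{4-x^2}\,\mathbf 1_{[-2,2]}(x)$. The semicircle law holds for $(X_n)_n$ in probability (resp. almost surely) if for every bounded continuous $f:\mathbb R\to\mathbb R$ one has $\int f\,d\sigma_n\to\int f\,d\sigma$ in probability (resp. almost surely) as $n\to\infty$. *)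

theory Defs
  imports "HOL-Probability.Probability" "Jordan_Normal_Form.Char_Poly"
begin

(* Conventions: matrices and vectors are those of Jordan_Normal_Form, so the index set
   [n] = {1..n} is rendered as {..<n}. Sequences indexed by the positive integers are functions
   on nat about whose value at 0 nothing is assumed. *)

definition sym_pos_def :: "nat \<Rightarrow> real mat \<Rightarrow> bool" where
  "sym_pos_def n A \<longleftrightarrow>
     A \<in> carrier_mat n n \<and> transpose_mat A = A \<and>
     (\<forall>v \<in> carrier_vec n. v \<noteq> 0\<^sub>v n \<longrightarrow> scalar_prod v (A *\<^sub>v v) > 0)"

definition CovMat :: "real \<Rightarrow> (nat \<Rightarrow> real mat) set" where
  "CovMat \<alpha> = {S. \<forall>n\<ge>1. sym_pos_def n (S n) \<and>
     (\<forall>i<n. S n $$ (i, i) = 1) \<and>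
     (\<forall>i<n. \<forall>j<n. i \<noteq> j \<longrightarrow> \<bar>S n $$ (i, j)\<bar> \<le> real n powr (-\<alpha>))}"

(* Dirac distributions count as (degenerate) Gaussians: otherwise the zero linear combination
   would have to be excluded in gaussian_vector below. *)
definition gaussian_rv :: "'w measure \<Rightarrow> ('w \<Rightarrow> real) \<Rightarrow> bool" where
  "gaussian_rv M X \<longleftrightarrow> X \<in> borel_measurable M \<and>
     ((\<exists>\<mu>. AE \<omega> in M. X \<omega> = \<mu>) \<or>
      (\<exists>\<mu> \<sigma>. \<sigma> > 0 \<and> distributed M lborel X (normal_density \<mu> \<sigma>)))"

(* (Y 0, ..., Y (m-1)) is distributed according to N(0, C): it is jointly Gaussian (all linear
   combinations are Gaussian), centred, and has covariance matrix C. *)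
definition gaussian_vector :: "'w measure \<Rightarrow> nat \<Rightarrow> real mat \<Rightarrow> (nat \<Rightarrow> 'w \<Rightarrow> real) \<Rightarrow> bool" where
  "gaussian_vector M m C Y \<longleftrightarrow>
     (\<forall>c. gaussian_rv M (\<lambda>\<omega>. \<Sum>k<m. c k * Y k \<omega>)) \<and>
     (\<forall>k<m. (LINT \<omega>|M. Y k \<omega>) = 0) \<and>
     (\<forall>k<m. \<forall>l<m. (LINT \<omega>|M. Y k \<omega> * Y l \<omega>) = C $$ (k, l))"

definition triangular :: "nat \<Rightarrow> nat" where
  "triangular n = n * (n + 1) div 2"

definition index_map :: "nat \<Rightarrow> (nat \<times> nat \<Rightarrow> nat) \<Rightarrow> bool" where
  "index_map n \<phi> \<longleftrightarrow>
     \<phi> ` ({..<n} \<times> {..<n}) \<subseteq> {..<triangular n} \<and>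
     bij_betw \<phi> {(i, j). i < n \<and> j < n \<and> i \<le> j} {..<triangular n} \<and>
     (\<forall>i<n. \<forall>j<i. \<phi> (i, j) = \<phi> (j, i))"

definition gaussian_scheme ::
    "'w measure \<Rightarrow> real \<Rightarrow> (nat \<Rightarrow> real mat) \<Rightarrow> (nat \<Rightarrow> 'w \<Rightarrow> real mat) \<Rightarrow> bool" where
  "gaussian_scheme M \<alpha> S a \<longleftrightarrow> \<alpha> > 0 \<and> S \<in> CovMat \<alpha> \<and>
     (\<forall>n\<ge>1. \<exists>Y \<phi>. gaussian_vector M (triangular n) (S (triangular n)) Y \<and> index_map n \<phi> \<and>
        (\<forall>\<omega>\<in>space M. a n \<omega> = Matrix.mat n n (\<lambda>(i, j). Y (\<phi> (i, j)) \<omega>)))"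

definition bandwidth :: "nat \<Rightarrow> nat \<Rightarrow> bool" where
  "bandwidth n b \<longleftrightarrow> (1 \<le> b \<and> b < n \<and> odd b) \<or> b = n"

definition relevant :: "nat \<Rightarrow> nat \<Rightarrow> nat \<Rightarrow> nat \<Rightarrow> bool" where
  "relevant n b i j \<longleftrightarrow> b = n \<or>
     \<bar>real i - real j\<bar> \<le> (real b - 1) / 2 \<or> \<bar>real i - real j\<bar> \<ge> real n - (real b - 1) / 2"

definition periodic_band :: "nat \<Rightarrow> nat \<Rightarrow> real mat \<Rightarrow> real mat" where
  "periodic_band n b A =
     Matrix.mat n n (\<lambda>(i, j). if relevant n b i j then real b powr (-1/2) * A $$ (i, j) else 0)"

(* The eigenvalues in increasing order, with multiplicity. For a real symmetric matrix all roots
   of the characteristic polynomial are real, so that the list has length n. *)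
definition eigenvalue_list :: "real mat \<Rightarrow> real list" where
  "eigenvalue_list A = sorted_list_of_multiset (proots (char_poly A))"

(* The image of the uniform distribution on the n indices under i \<mapsto> \<lambda>_i, that is,
   (1/n) times the sum of the point masses at the eigenvalues. *)
definition esd :: "real mat \<Rightarrow> real measure" where
  "esd A = distr (uniform_count_measure {..<dim_row A}) borel (\<lambda>i. eigenvalue_list A ! i)"

definition semicircle :: "real measure" where
  "semicircle =
     density lborel (\<lambda>x. ennreal (1 / (2 * pi) * sqrt (4 - x\<^sup>2) * indicator {-2..2} x))"

definition tendsto_in_probability :: "'w measure \<Rightarrow> (nat \<Rightarrow> 'w \<Rightarrow> real) \<Rightarrow> real \<Rightarrow> bool" where
  "tendsto_in_probability M Z c \<longleftrightarrow>
     (\<forall>n\<ge>1. Z n \<in> borel_measurable M) \<and>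
     (\<forall>\<epsilon>>0. (\<lambda>n. measure M {\<omega> \<in> space M. \<bar>Z n \<omega> - c\<bar> > \<epsilon>}) \<longlonglongrightarrow> 0)"

definition semicircle_law_in_probability :: "'w measure \<Rightarrow> (nat \<Rightarrow> 'w \<Rightarrow> real mat) \<Rightarrow> bool" where
  "semicircle_law_in_probability M X \<longleftrightarrow>
     (\<forall>f :: real \<Rightarrow> real. continuous_on UNIV f \<and> bounded (range f) \<longrightarrow>
        tendsto_in_probability M (\<lambda>n \<omega>. LINT x|esd (X n \<omega>). f x) (LINT x|semicircle. f x))"

definition semicircle_law_almost_surely :: "'w measure \<Rightarrow> (nat \<Rightarrow> 'w \<Rightarrow> real mat) \<Rightarrow> bool" where
  "semicircle_law_almost_surely M X \<longleftrightarrow>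
     (\<forall>f :: real \<Rightarrow> real. continuous_on UNIV f \<and> bounded (range f) \<longrightarrow>
        (AE \<omega> in M. (\<lambda>n. LINT x|esd (X n \<omega>). f x) \<longlonglongrightarrow> (LINT x|semicircle. f x)))"

end

theory Submission
  imports Defs "Jordan_Normal_Form.Schur_Decomposition"
begin

text \<open>The moments of the empirical spectral distribution are normalised traces of powers, that is, sums
  over closed walks. By Wick's formula a walk contributes at most \<open>O(b\<^sup>-\<^sup>e\<^sup>/\<^sup>2)\<close> when \<open>e\<close> of its edges are
  traversed only once, because \<open>\<alpha> \<ge> 1/2\<close> makes the covariance of distinct entries
  \<open>O(1/n) = O(1/b)\<close>. Since an edge traversed once lies on a cycle of a closed walk, counting vertices
  shows that only the depth-first traversals of trees survive in the limit. Counting them according to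
  the height of the stack gives the recursion satisfied by the integrals of \<open>x\<^sup>k U\<^sub>h(x/2)\<close> against
  the semicircle distribution, where \<open>U\<^sub>h\<close> is the Chebyshev polynomial of the second kind.

  The fluctuations are controlled by Gaussian concentration: rotating an independent copy of the
  Gaussian vector into the original one bounds every even central moment of a normalised trace by a
  moment of its gradient, hence by powers of \<open>n\<^sup>1\<^sup>-\<^sup>2\<^sup>\<alpha> / b\<close> (for \<open>\<alpha> \<le> 1\<close>). The second moment gives
  convergence in probability, and a sufficiently high one is summable when \<open>\<alpha> > 1/2\<close>.\<close>

section \<open>Closed walks and tree traversals\<close>

text \<open>The n-th covariance matrix has size about n^2 / 2, so a bound by its size to the power
  -\<alpha> is of order n^(-2 \<alpha>). With \<beta> = min \<alpha> 1, distinct matrix entries have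
  covariance at most \<delta> = 4 n^(-2 \<beta>), and \<alpha> = 1/2 is where this reaches the order
  1/n. The rate n^(1 - 2 \<beta>) / b is a product of two bounds. Row sums bound the covariance
  operator by 2 + n^2 \<delta>, which is O(n^(2 - 2 \<beta>)); capping \<alpha> at 1 lets the second
  term dominate the 2. The squared norm of the gradient of a normalised trace is at most k^2 / (b n)
  times another spectral moment. For \<beta> > 1/2 a high power of the rate beats n^(-2). This
  matters because nothing is known about the joint law for different n, so almost sure convergence
  must come from Borel-Cantelli. Of Gaussianity, only mean zero and the recursion for the moments of
  linear combinations are used. Hence all derivatives are of polynomials in a parameter, or of
  finite sums of products q(t) R(x), and pass through expectations by linearity.\<close>

fun path_edges :: "'a list \<Rightarrow> 'a set list" where
  "path_edges (x # y # w) = {x, y} # path_edges (y # w)"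
| "path_edges _ = []"

definition singles :: "'a list \<Rightarrow> nat" where
  "singles es = card {e \<in> set es. count_list es e = 1}"

lemma length_path_edges [simp]: "length (path_edges w) = length w - 1"
  by (induction w rule: path_edges.induct) auto

lemma path_edges_subset: "e \<in> set (path_edges w) \<Longrightarrow> e \<subseteq> set w"
  by (induction w rule: path_edges.induct) auto

lemma path_edges_Cons: "w \<noteq> [] \<Longrightarrow> path_edges (y # w) = {y, hd w} # path_edges w"
  by (cases w) auto

lemma path_edges_append:
  assumes "us \<noteq> []" "vs \<noteq> []"
  shows "path_edges (us @ vs) = path_edges us @ {last us, hd vs} # path_edges vs"
  using assms
proof (induction us)
  case (Cons u us)
  then show ?case
    by (cases "us = []") (auto simp: path_edges_Cons)
qed simp

lemma path_edges_split:
  assumes "e \<in> set (path_edges w)"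
  obtains us vs where "w = us @ vs" "us \<noteq> []" "vs \<noteq> []" "e = {last us, hd vs}"
  using assms
proof (induction w arbitrary: thesis rule: path_edges.induct)
  case (1 x y w)
  show ?case
  proof (cases "e = {x, y}")
    case True
    show ?thesis using 1(2)[of "[x]" "y # w"] True by simp
  next
    case False
    then have "e \<in> set (path_edges (y # w))" using 1(3) by simp
    then obtain us vs where *: "y # w = us @ vs" "us \<noteq> []" "vs \<noteq> []" "e = {last us, hd vs}"
      using 1(1) by blast
    show ?thesis using 1(2)[of "x # us" vs] * by simp
  qed
qed auto

text \<open>When the walk is built from its right end, a vertex seen for the first time arrives
  together with an edge not seen before; only the starting vertex comes without one.\<close>

lemma card_vertices_le:
  "w \<noteq> [] \<Longrightarrow> card (set w) \<le> Suc (card (set (path_edges w)))"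
proof (induction w)
  case (Cons y w)
  show ?case
  proof (cases "w = []")
    case False
    have *: "card (set w) \<le> Suc (card (set (path_edges w)))" using Cons False by simp
    show ?thesis
    proof (cases "y \<in> set w")
      case True
      have "card (set (path_edges w)) \<le> card (set (path_edges (y # w)))"
        by (rule card_mono) (auto simp: path_edges_Cons False)
      then show ?thesis using * True by (simp add: insert_absorb)
    next
      case new: False
      then have "{y, hd w} \<notin> set (path_edges w)"
        using path_edges_subset[of "{y, hd w}" w] by auto
      then show ?thesis using * new by (simp add: path_edges_Cons False)
    qed
  qed simp
qed simp

text \<open>Rotating a closed walk so that an edge traversed only once comes last and dropping that edge
  leaves a walk through the same vertices.\<close>
lemma card_vertices_le_single:
  assumes closed: "hd w = last w" and single: "count_list (path_edges w) e = 1"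
  shows "card (set w) \<le> card (set (path_edges w))"
proof -
  have "e \<in> set (path_edges w)"
    using single count_notin by fastforce
  then obtain us vs where w: "w = us @ vs" "us \<noteq> []" "vs \<noteq> []" "e = {last us, hd vs}"
    by (rule path_edges_split)
  have pw: "path_edges w = path_edges us @ e # path_edges vs"
    using path_edges_append w by metis
  have "count_list (path_edges us) e = 0" "count_list (path_edges vs) e = 0"
    using single unfolding pw by auto
  then have e: "e \<notin> set (path_edges us)" "e \<notin> set (path_edges vs)"
    by (simp_all add: count_list_0_iff)
  have hl: "hd us = last vs" using closed w by simp
  define w' where "w' = vs @ tl us"
  have "set (path_edges w') = set (path_edges us) \<union> set (path_edges vs)"
  proof (cases "tl us = []")
    case True
    then have "path_edges us = []" using w(2) by (cases us) auto
    then show ?thesis using True by (simp add: w'_def)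
  next
    case False
    have "path_edges w' = path_edges vs @ {hd us, hd (tl us)} # path_edges (tl us)"
      using path_edges_append[OF w(3) False] hl w'_def by simp
    also have "{hd us, hd (tl us)} # path_edges (tl us) = path_edges us"
      using path_edges_Cons[OF False, of "hd us"] w(2) by simp
    finally show ?thesis by auto
  qed
  then have "set (path_edges w) = insert e (set (path_edges w'))" "e \<notin> set (path_edges w')"
    using pw e by auto
  then have ce: "card (set (path_edges w)) = Suc (card (set (path_edges w')))" by simp
  have "set us = insert (hd us) (set (tl us))" using w(2) by (cases us) auto
  then have "set w = set w'" using w hl last_in_set[of vs] unfolding w'_def by auto
  moreover have "w' \<noteq> []" using w by (simp add: w'_def)
  ultimately show ?thesis using card_vertices_le[of w'] ce by simp
qed

text \<open>Depth-first traversals of trees, read from right to left; the second argument is the stack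
  leading from the current vertex back to the root.\<close>
inductive tree_walk :: "'a list \<Rightarrow> 'a list \<Rightarrow> bool" where
  root: "tree_walk [x] [x]"
| up: "tree_walk w (x # st) \<Longrightarrow> y \<notin> set w \<Longrightarrow> tree_walk (y # w) (y # x # st)"
| down: "tree_walk w (x # p # st) \<Longrightarrow> tree_walk (p # w) (p # st)"

lemma tree_walk_basic:
  assumes "tree_walk w st"
  shows "w \<noteq> []" "st \<noteq> []" "hd st = hd w" "last st = last w" "distinct st" "set st \<subseteq> set w"
  using assms by (induction) auto

lemma tree_walk_count:
  assumes "tree_walk w st"
  shows "count_list (path_edges w) e =
    (if e \<in> set (path_edges st) then 1 else if e \<in> set (path_edges w) then 2 else 0)"
  using assms
proof (induction arbitrary: e)
  case (root x)
  then show ?case by simp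
next
  case (up w x st y)
  note b = tree_walk_basic[OF up(1)]
  have p: "path_edges (y # w) = {y, x} # path_edges w" "path_edges (y # x # st) = {y, x} # path_edges (x # st)"
    using b by (auto simp: path_edges_Cons)
  have n: "{y, x} \<notin> set (path_edges w)" using up(2) path_edges_subset by fastforce
  have n': "{y, x} \<notin> set (path_edges (x # st))"
    using up(2) b path_edges_subset[of "{y,x}" "x # st"] by auto
  show ?case
    using up.IH[of e] up.IH[of "{y,x}"] n n' unfolding p
    by (auto simp: count_list_0_iff)
next
  case (down w x p st)
  note b = tree_walk_basic[OF down(1)]
  have p: "path_edges (p # w) = {p, x} # path_edges w" "path_edges (x # p # st) = {p, x} # path_edges (p # st)"
    using b by (auto simp: path_edges_Cons)
  have n: "{p, x} \<notin> set (path_edges (p # st))"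
    using b path_edges_subset[of "{p,x}" "p # st"] by auto
  show ?case
    using down.IH[of e] n unfolding p by auto
qed

text \<open>While the traversal lasts, a step goes to a new vertex (\<open>up\<close>), to the
  parent (\<open>down\<close>), or elsewhere. In the last case its edge either has been used twice
  already and now a third time, or is new between old vertices and closes a cycle, so that there are
  at least as many edges as vertices. Both defects survive further steps.\<close>

lemma tree_walk_or_defect:
  assumes "w \<noteq> []"
  shows "(\<exists>st. tree_walk w st) \<or> card (set w) \<le> card (set (path_edges w)) \<or>
    (\<exists>e. count_list (path_edges w) e \<ge> 3)"
  using assms
proof (induction w)
  case (Cons y w)
  show ?case
  proof (cases "w = []")
    case True
    then show ?thesis using tree_walk.root[of y] by blast
  next
    case False
    have p: "path_edges (y # w) = {y, hd w} # path_edges w" using False by (rule path_edges_Cons)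
    from Cons(1)[OF False] consider st where "tree_walk w st"
      | "card (set w) \<le> card (set (path_edges w))" | e where "count_list (path_edges w) e \<ge> 3"
      by blast
    then show ?thesis
    proof cases
      case 1
      note b = tree_walk_basic[OF 1]
      obtain x st' where st: "st = x # st'" using b(2) by (cases st) auto
      have x: "hd w = x" using b(3) st by simp
      show ?thesis
      proof (cases "y \<in> set w")
        case False
        then show ?thesis using tree_walk.up[of w x st' y] 1 st by blast
      next
        case old: True
        show ?thesis
        proof (cases "\<exists>r. st' = y # r")
          case True
          then obtain r where "st' = y # r" by blast
          then show ?thesis using tree_walk.down[of w x y r] 1 st by blast
        next
          case nd: False
          \<comment> \<open>The only stack edge at the top vertex \<open>x\<close> leads to its
            parent, which \<open>y\<close> is not. Off the stack, an edge has multiplicity 0 or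
            2.\<close>
          have "{y, x} \<notin> set (path_edges st)"
          proof
            assume *: "{y, x} \<in> set (path_edges st)"
            then obtain p st'' where st': "st' = p # st''" unfolding st by (cases st') auto
            have "{y, x} \<notin> set (path_edges (p # st''))"
              using b(5) path_edges_subset[of "{y, x}" "p # st''"] st st' by auto
            then have "{y, x} = {x, p}" using * st st' by simp
            then have "y = p" using b(5) st st' by (auto simp: doubleton_eq_iff)
            then show False using nd st' by simp
          qed
          then have c: "count_list (path_edges w) {y, x} = (if {y, x} \<in> set (path_edges w) then 2 else 0)"
            using tree_walk_count[OF 1, of "{y, x}"] by simp
          show ?thesis
          proof (cases "{y, x} \<in> set (path_edges w)")
            case True
            then have "count_list (path_edges (y # w)) {y, x} = 3" using c p x by simp
            then show ?thesis by (metis order_refl)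
          next
            case new: False
            have "card (set (path_edges (y # w))) = Suc (card (set (path_edges w)))"
              using new p x by simp
            moreover have "card (set (y # w)) = card (set w)" using old by (simp add: insert_absorb)
            ultimately show ?thesis using card_vertices_le[OF False] by simp
          qed
        qed
      qed
    next
      case 2
      show ?thesis
      proof (cases "y \<in> set w")
        case True
        have "card (set (path_edges w)) \<le> card (set (path_edges (y # w)))"
          by (rule card_mono) (auto simp: p)
        then show ?thesis using 2 True by (simp add: insert_absorb)
      next
        case new: False
        then have "{y, hd w} \<notin> set (path_edges w)"
          using path_edges_subset[of "{y, hd w}" w] by auto
        then show ?thesis using 2 new by (simp add: p)
      qed
    next
      case (3 e)
      then have "count_list (path_edges (y # w)) e \<ge> 3" using p by simp
      then show ?thesis by blast
    qed
  qed
qed simp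

text \<open>The stack has distinct entries and runs from the head to the last entry of the walk;
  when these agree, it is a single vertex and no edge is left open.\<close>

lemma closed_tree_walk_count:
  assumes "tree_walk w st" "hd w = last w"
  shows "length st = 1" "e \<in> set (path_edges w) \<Longrightarrow> count_list (path_edges w) e = 2"
proof -
  note b = tree_walk_basic[OF assms(1)]
  obtain x st' where st: "st = x # st'" using b(2) by (cases st) auto
  have "st' = []"
  proof (rule ccontr)
    assume "st' \<noteq> []"
    then have "last st' = x" using b(3,4) assms(2) st by simp
    then show False using b(5) st \<open>st' \<noteq> []\<close> last_in_set[of st'] by auto
  qed
  then show "length st = 1" using st by simp
  show "e \<in> set (path_edges w) \<Longrightarrow> count_list (path_edges w) e = 2"
    using tree_walk_count[OF assms(1), of e] st \<open>st' = []\<close> by simp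
qed

lemma tree_walk_height1_closed:
  assumes "tree_walk w st" "length st = 1"
  shows "hd w = last w"
proof -
  obtain x where "st = [x]" using assms(2) by (auto simp: length_Suc_conv)
  then show ?thesis using tree_walk_basic(3,4)[OF assms(1)] by simp
qed

text \<open>In the length as a sum of multiplicities, each element of multiplicity one is completed
  to two by its own unit in \<open>singles\<close>. Without singles, one multiplicity of at least
  three makes the inequality strict.\<close>

lemma length_ge_count:
  fixes es :: "'a list"
  shows "2 * card (set es) \<le> length es + singles es"
    and "singles es = 0 \<Longrightarrow> count_list es e \<ge> 3 \<Longrightarrow> 2 * card (set es) < length es"
proof -
  have len: "length es = (\<Sum>e\<in>set es. count_list es e)"
    by (rule sum_count_set[symmetric]) auto
  have s: "singles es = (\<Sum>e\<in>set es. if count_list es e = 1 then 1 else 0)"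
    unfolding singles_def by (subst sum.If_cases) (auto intro: arg_cong[where f=card])
  have pos: "count_list es e \<ge> 1" if "e \<in> set es" for e
    using that count_list_0_iff[of es e] by (cases "count_list es e") auto
  have "(\<Sum>e\<in>set es. 2) \<le> (\<Sum>e\<in>set es. count_list es e + (if count_list es e = 1 then 1 else 0))"
  proof (rule sum_mono)
    fix e assume "e \<in> set es"
    then show "2 \<le> count_list es e + (if count_list es e = 1 then 1 else 0)"
      using pos[of e] by auto
  qed
  then show "2 * card (set es) \<le> length es + singles es"
    by (simp add: len s sum.distrib)
  assume z: "singles es = 0" and c: "count_list es e \<ge> 3"
  have no: "count_list es f \<noteq> 1" if "f \<in> set es" for f
    using z that unfolding singles_def by auto
  have "e \<in> set es" using c count_list_0_iff[of es e] by auto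
  have "(\<Sum>e\<in>set es. 2) < (\<Sum>e\<in>set es. count_list es e)"
  proof (rule sum_strict_mono_ex1)
    show "\<forall>x\<in>set es. 2 \<le> count_list es x"
    proof
      fix x assume "x \<in> set es"
      then show "2 \<le> count_list es x" using pos[of x] no[of x] by simp
    qed
    show "\<exists>a\<in>set es. 2 < count_list es a" using \<open>e \<in> set es\<close> c by force
  qed simp
  then show "2 * card (set es) < length es" by (simp add: len)
qed

text \<open>About n b^(v-1) walks visit v vertices, and a walk contributes O(b^(-(k + s)/2) / n),
  where s counts its single edges. The bound 2 v \<le> k + 1 + s leaves a total of O(b^(-1/2)). A
  single edge saves a vertex through its cycle; without singles, a cycle or a triple edge
  does.\<close>

lemma card_vertices_bad_walk:
  assumes "length w = Suc k" "hd w = last w" "\<nexists>st. tree_walk w st"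
  shows "2 * card (set w) \<le> k + 1 + singles (path_edges w)"
proof -
  have ne: "w \<noteq> []" using assms(1) by auto
  have len: "length (path_edges w) = k" using assms(1) by simp
  note l = length_ge_count[of "path_edges w", unfolded len]
  show ?thesis
  proof (cases "singles (path_edges w) = 0")
    case False
    then obtain e where "count_list (path_edges w) e = 1"
      unfolding singles_def by (metis (mono_tags, lifting) card.empty empty_Collect_eq)
    then show ?thesis using card_vertices_le_single[OF assms(2)] l(1) by fastforce
  next
    case True
    from tree_walk_or_defect[OF ne] assms(3)
    consider "card (set w) \<le> card (set (path_edges w))" | e where "count_list (path_edges w) e \<ge> 3"
      by blast
    then show ?thesis
    proof cases
      case 1
      then show ?thesis using l(1) by simp
    next
      case 2
      then show ?thesis using l(2)[OF True 2] card_vertices_le[OF ne] by simp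
    qed
  qed
qed

text \<open>The last rule is determined by the walk: \<open>up\<close> arrives at a new vertex,
  \<open>down\<close> at one already visited. The stack is therefore a function of the walk, which
  justifies the later \<open>THE st\<close>.\<close>

lemma tree_walk_unique:
  assumes "tree_walk w st" "tree_walk w st'"
  shows "st = st'"
  using assms
proof (induction arbitrary: st')
  case (root x)
  from root show ?case
    by cases (auto dest: tree_walk_basic(1))
next
  case (up w x st y)
  note b = tree_walk_basic[OF up(1)]
  from up(4) show ?case
  proof cases
    case root
    then show ?thesis using b by simp
  next
    case (up x' st'')
    then show ?thesis using \<open>\<And>st'. tree_walk w st' \<Longrightarrow> x # st = st'\<close>[of "x' # st''"] by simp
  next
    case (down x' st'')
    then show ?thesis
      using tree_walk_basic(6)[OF down(2)] \<open>y \<notin> set w\<close> by auto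
  qed
next
  case (down w x p st)
  note b = tree_walk_basic[OF down(1)]
  from down(3) show ?case
  proof cases
    case root
    then show ?thesis using b by simp
  next
    case (up x' st'')
    then show ?thesis
      using b by auto
  next
    case (down x' st'')
    then show ?thesis using \<open>\<And>st'. tree_walk w st' \<Longrightarrow> x # p # st = st'\<close>[of "x' # p # st''"] by simp
  qed
qed

section \<open>Counting walks and traversals in a regular graph\<close>

definition walks :: "nat \<Rightarrow> (nat \<Rightarrow> nat \<Rightarrow> bool) \<Rightarrow> nat \<Rightarrow> nat list set" where
  "walks n R k = {w. length w = Suc k \<and> set w \<subseteq> {..<n} \<and> successively R w}"

lemma finite_walks [simp]: "finite (walks n R k)"
  by (rule finite_subset[OF _ finite_lists_length_eq[of "{..<n}" "Suc k"]]) (auto simp: walks_def)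

lemma walks_0: "walks n R 0 = (\<lambda>x. [x]) ` {..<n}"
  by (auto simp: walks_def length_Suc_conv)

lemma walks_Suc:
  "walks n R (Suc k) = (\<lambda>(w, y). y # w) ` (SIGMA w:walks n R k. {y. y < n \<and> R y (hd w)})"
proof (intro equalityI subsetI)
  fix v assume v: "v \<in> walks n R (Suc k)"
  then obtain y x w where "v = y # x # w" by (auto simp: walks_def length_Suc_conv)
  then show "v \<in> (\<lambda>(w, y). y # w) ` (SIGMA w:walks n R k. {y. y < n \<and> R y (hd w)})"
    using v by (auto simp: walks_def image_iff intro!: bexI[of _ "(x # w, y)"])
next
  fix v assume "v \<in> (\<lambda>(w, y). y # w) ` (SIGMA w:walks n R k. {y. y < n \<and> R y (hd w)})"
  then obtain w y where v: "v = y # w" "w \<in> walks n R k" "y < n" "R y (hd w)" by auto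
  then obtain x w' where "w = x # w'" by (auto simp: walks_def length_Suc_conv)
  then show "v \<in> walks n R (Suc k)" using v by (auto simp: walks_def)
qed

lemma sum_walks_Suc:
  "(\<Sum>w\<in>walks n R (Suc k). f w) = (\<Sum>w\<in>walks n R k. \<Sum>y | y < n \<and> R y (hd w). f (y # w))"
  unfolding walks_Suc
  by (subst sum.reindex) (auto simp: inj_on_def case_prod_unfold sum.Sigma)

lemma hd_walk: "w \<in> walks n R k \<Longrightarrow> w \<noteq> [] \<and> hd w < n"
  by (cases w) (auto simp: walks_def)

text \<open>Prepending a vertex keeps the weight for at most k + 1 old vertices and divides it by b
  for at most b new ones, so each step multiplies the sum by at most k + 2. The weight turns a bound
  on the number of vertices into a bound on a sum over walks, without classifying the walks.\<close>

lemma card_le_sum_walks: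
  assumes deg: "\<And>x. x < n \<Longrightarrow> card {y. y < n \<and> R y x} = b" and "b \<ge> 1"
  shows "(\<Sum>w\<in>walks n R k. (1 / real b) ^ card (set w)) \<le> fact (Suc k) * real n / real b"
proof (induction k)
  case 0
  show ?case unfolding walks_0 by (subst sum.reindex) (auto simp: inj_on_def)
next
  case (Suc k)
  have "(\<Sum>y | y < n \<and> R y (hd w). (1 / real b) ^ card (set (y # w)))
      \<le> real (Suc (Suc k)) * (1 / real b) ^ card (set w)" if w: "w \<in> walks n R k" for w
  proof -
    let ?N = "{y. y < n \<and> R y (hd w)}"
    have fin: "finite ?N" by simp
    have cs: "card (set w) \<le> Suc k" using w card_length[of w] by (simp add: walks_def)
    have "(\<Sum>y\<in>?N. (1 / real b) ^ card (set (y # w)))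
        = (\<Sum>y\<in>?N. if y \<in> set w then (1 / real b) ^ card (set w) else (1 / real b) ^ Suc (card (set w)))"
      by (rule sum.cong) (auto simp: insert_absorb)
    also have "\<dots> \<le> (\<Sum>y\<in>?N. (if y \<in> set w then (1 / real b) ^ card (set w) else 0) + (1 / real b) ^ Suc (card (set w)))"
      by (rule sum_mono) auto
    also have "\<dots> = real (card (?N \<inter> set w)) * (1 / real b) ^ card (set w)
        + real (card ?N) * (1 / real b) ^ Suc (card (set w))"
      by (simp only: sum.distrib sum.inter_filter[symmetric] fin sum_constant sum.If_cases) (simp add: Int_def)
    also have "card ?N = b" using deg hd_walk[OF w] by simp
    also have "real (card (?N \<inter> set w)) * (1 / real b) ^ card (set w) \<le> real (Suc k) * (1 / real b) ^ card (set w)"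
    proof (rule mult_right_mono)
      have "card (?N \<inter> set w) \<le> card (set w)" by (rule card_mono) auto
      then show "real (card (?N \<inter> set w)) \<le> real (Suc k)" using cs by simp
    qed simp
    also have "real b * (1 / real b) ^ Suc (card (set w)) = (1 / real b) ^ card (set w)"
      using assms(2) by simp
    finally show ?thesis by (simp add: algebra_simps)
  qed
  then have "(\<Sum>w\<in>walks n R (Suc k). (1 / real b) ^ card (set w))
      \<le> (\<Sum>w\<in>walks n R k. real (Suc (Suc k)) * (1 / real b) ^ card (set w))"
    unfolding sum_walks_Suc by (rule sum_mono)
  also have "\<dots> = real (Suc (Suc k)) * (\<Sum>w\<in>walks n R k. (1 / real b) ^ card (set w))"
    by (simp add: sum_distrib_left)
  also have "\<dots> \<le> real (Suc (Suc k)) * (fact (Suc k) * real n / real b)"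
    using Suc by (rule mult_left_mono) simp
  also have "\<dots> = fact (Suc (Suc k)) * real n / real b" by (simp only: fact_Suc) simp
  finally show ?case .
qed

text \<open>Here \<open>h\<close> is the depth of the current vertex, one less than the length of
  the stack. Closed walks have depth 0, but the recursion in \<open>k\<close> passes through other
  depths.\<close>

definition tree_walks :: "nat \<Rightarrow> (nat \<Rightarrow> nat \<Rightarrow> bool) \<Rightarrow> nat \<Rightarrow> nat \<Rightarrow> nat list set" where
  "tree_walks n R k h = {w \<in> walks n R k. \<exists>st. tree_walk w st \<and> length st = Suc h}"

lemma finite_tree_walks [simp]: "finite (tree_walks n R k h)"
  unfolding tree_walks_def by simp

lemma tree_walks_0: "card (tree_walks n R 0 h) = (if h = 0 then n else 0)"
proof -
  have "tree_walks n R 0 h = (if h = 0 then (\<lambda>x. [x]) ` {..<n} else {})"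
  proof -
    have "tree_walk [x] st \<longleftrightarrow> st = [x]" for x :: nat and st
      using tree_walk_unique[OF tree_walk.root[of x]] tree_walk.root[of x] by metis
    then show ?thesis unfolding tree_walks_def walks_0 by auto
  qed
  then show ?thesis by (simp add: card_image inj_on_def)
qed

lemma tree_walk_successively:
  assumes "tree_walk w st" "successively R w" "symp R"
  shows "successively R st"
  using assms
proof induction
  case (up w x st y)
  note b = tree_walk_basic[OF up(1)]
  have "R y x" "successively R w" using up.prems b by (cases w; auto)+
  then show ?case using up by simp
next
  case (down w x p st)
  note b = tree_walk_basic[OF down(1)]
  have "successively R w" using down.prems b by (cases w) auto
  then show ?case using down by simp
qed simp

text \<open>The last step either went up from depth \<open>h - 1\<close>, which needs
  \<open>h\<close> positive, or down from depth \<open>h + 1\<close>. A downward step offers no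
  choice: it leads to the second stack entry, which the walk without that step determines.\<close>

lemma tree_walks_Suc:
  assumes R: "symp R"
  shows "tree_walks n R (Suc k) h =
    (\<lambda>(w, y). y # w) ` (SIGMA w:(if h = 0 then {} else tree_walks n R k (h - 1)). {y. y < n \<and> R y (hd w)} - set w) \<union>
    (\<lambda>w. (THE st. tree_walk w st) ! 1 # w) ` tree_walks n R k (Suc h)" (is "_ = ?A \<union> ?B")
proof (intro equalityI subsetI)
  have the: "(THE st. tree_walk w st) = st" if "tree_walk w st" for w st :: "nat list"
    using that tree_walk_unique by blast
  {
    fix v assume "v \<in> tree_walks n R (Suc k) h"
    then obtain st where v: "v \<in> walks n R (Suc k)" "tree_walk v st" "length st = Suc h"
      by (auto simp: tree_walks_def)
    from v(1) obtain w y where w: "v = y # w" "w \<in> walks n R k" "y < n" "R y (hd w)"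
      unfolding walks_Suc by auto
    from v(2) show "v \<in> ?A \<union> ?B"
    proof cases
      case (root x)
      then show ?thesis using w by (auto simp: walks_def)
    next
      case (up w' x st' y')
      then have "w' = w" "y' = y" using w by auto
      then have "w \<in> tree_walks n R k (h - 1)" "h \<noteq> 0" "y \<notin> set w"
        using up w v by (auto simp: tree_walks_def)
      then show ?thesis using w by (auto simp: image_iff intro!: bexI[of _ "(w, y)"])
    next
      case (down w' x p st')
      then have e: "w' = w" "p = y" using w by auto
      then have "w \<in> tree_walks n R k (Suc h)"
        using down w v by (auto simp: tree_walks_def intro!: exI[of _ "x # p # st'"])
      moreover have "(THE st. tree_walk w st) ! 1 = y" using the down e by simp
      ultimately show ?thesis using w by (auto simp: image_iff intro!: bexI[of _ w])
    qed
  }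
  fix v assume "v \<in> ?A \<union> ?B"
  then show "v \<in> tree_walks n R (Suc k) h"
  proof
    assume "v \<in> ?A"
    then obtain w y where *: "v = y # w" "h \<noteq> 0" "w \<in> tree_walks n R k (h - 1)" "y < n" "R y (hd w)" "y \<notin> set w"
      by (auto split: if_splits)
    then obtain st where st: "tree_walk w st" "length st = h" "w \<in> walks n R k" by (auto simp: tree_walks_def)
    then obtain x st' where "st = x # st'" using tree_walk_basic(2) by (cases st) auto
    then have "tree_walk v (y # st)" using tree_walk.up st * by simp
    moreover have "v \<in> walks n R (Suc k)" unfolding walks_Suc using * st by auto
    ultimately show ?thesis using st by (auto simp: tree_walks_def)
  next
    assume "v \<in> ?B"
    then obtain w where *: "v = (THE st. tree_walk w st) ! 1 # w" "w \<in> tree_walks n R k (Suc h)" by auto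
    then obtain st where st: "tree_walk w st" "length st = Suc (Suc h)" "w \<in> walks n R k"
      by (auto simp: tree_walks_def)
    then obtain x p st' where s: "st = x # p # st'" by (auto simp: length_Suc_conv)
    have v: "v = p # w" using * the[OF st(1)] s by simp
    have tw: "tree_walk v (p # st')" using tree_walk.down st s v by simp
    note b = tree_walk_basic[OF st(1)]
    have "successively R st" using tree_walk_successively[OF st(1) _ R] st(3) by (simp add: walks_def)
    then have "R p (hd w)" using s b(3) R by (auto dest: sympD)
    moreover have "p < n" using b(6) s st(3) by (auto simp: walks_def)
    ultimately have "v \<in> walks n R (Suc k)" unfolding walks_Suc using v st by auto
    then show ?thesis using tw st s by (auto simp: tree_walks_def)
  qed
qed

text \<open>Upward steps go to neighbours outside the at most k + 1 visited vertices, so their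
  number lies between b - (k + 1) and b. The two kinds of last step give disjoint sets, since one
  arrives at a new vertex and the other at an old one.\<close>

lemma card_tree_walks_Suc:
  assumes R: "symp R" and deg: "\<And>x. x < n \<Longrightarrow> card {y. y < n \<and> R y x} = b"
  defines "q k h \<equiv> real (card (tree_walks n R k h))"
  shows "\<bar>q (Suc k) h - q k (Suc h) - (if h = 0 then 0 else real b * q k (h - 1))\<bar>
    \<le> (if h = 0 then 0 else real (Suc k) * q k (h - 1))"
proof -
  let ?T = "if h = 0 then {} else tree_walks n R k (h - 1)"
  let ?N = "\<lambda>w. {y. y < n \<and> R y (hd w)}"
  let ?A = "(\<lambda>(w, y). y # w) ` (SIGMA w:?T. ?N w - set w)"
  let ?B = "(\<lambda>w. (THE st. tree_walk w st) ! 1 # w) ` tree_walks n R k (Suc h)"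
  have the: "(THE st. tree_walk w st) = st" if "tree_walk w st" for w st :: "nat list"
    using that tree_walk_unique by blast
  have fT: "finite ?T" by simp
  have "?A \<inter> ?B = {}"
  proof -
    have "False" if v: "v \<in> ?A" "v \<in> ?B" for v
    proof -
      obtain w where *: "v = (THE st. tree_walk w st) ! 1 # w" "w \<in> tree_walks n R k (Suc h)"
        using v(2) by auto
      then obtain st where st: "tree_walk w st" "length st = Suc (Suc h)"
        by (auto simp: tree_walks_def)
      have "st ! 1 \<in> set st" using st(2) by simp
      then have "hd v \<in> set (tl v)" using * the[OF st(1)] tree_walk_basic(6)[OF st(1)] by auto
      then show False using v(1) by auto
    qed
    then show ?thesis by blast
  qed
  moreover have "finite ?A" "finite ?B" by (auto simp del: Sigma_empty1)
  ultimately have "card (tree_walks n R (Suc k) h) = card ?A + card ?B"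
    unfolding tree_walks_Suc[OF R] by (rule card_Un_disjoint[rotated 2])
  moreover have "card ?B = card (tree_walks n R k (Suc h))"
    by (rule card_image) (auto simp: inj_on_def)
  moreover have "card ?A = (\<Sum>w\<in>?T. card (?N w - set w))"
    by (subst card_image) (auto simp: inj_on_def)
  ultimately have eq: "q (Suc k) h - q k (Suc h) = (\<Sum>w\<in>?T. real (card (?N w - set w)))"
    unfolding q_def by simp
  have bd: "\<bar>real (card (?N w - set w)) - real b\<bar> \<le> real (Suc k)" if "w \<in> ?T" for w
  proof -
    have w: "w \<in> walks n R k" using that by (auto simp: tree_walks_def split: if_splits)
    have cN: "card (?N w) = b" using deg hd_walk[OF w] by simp
    have "card (?N w - set w) \<le> b" using cN by (metis (no_types, lifting) card_Diff_subset_Int diff_le_self finite_Int finite_set)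
    moreover have "b - card (set w) \<le> card (?N w - set w)"
      using diff_card_le_card_Diff[of "set w" "?N w"] cN by simp
    moreover have "card (set w) \<le> Suc k" using w card_length[of w] by (simp add: walks_def)
    ultimately show ?thesis by linarith
  qed
  have "\<bar>(\<Sum>w\<in>?T. real (card (?N w - set w))) - (\<Sum>w\<in>?T. real b)\<bar> \<le> (\<Sum>w\<in>?T. real (Suc k))"
    unfolding sum_subtractf[symmetric] by (rule order_trans[OF sum_abs]) (rule sum_mono, rule bd)
  then show ?thesis unfolding eq by (auto simp: q_def algebra_simps)
qed

section \<open>Gaussian spaces and the Wick formula\<close>

text \<open>A class closed under sums and products, so that integrability of a polynomial expression
  follows from that of its factors.\<close>

definition (in prob_space) all_moments :: "('a \<Rightarrow> real) \<Rightarrow> bool" where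
  "all_moments f \<longleftrightarrow> f \<in> borel_measurable M \<and> (\<forall>k::nat. integrable M (\<lambda>x. f x ^ k))"

context prob_space
begin

lemma all_moments_measurable [measurable_dest]: "all_moments f \<Longrightarrow> f \<in> borel_measurable M"
  by (simp add: all_moments_def)

lemma all_moments_integrable: "all_moments f \<Longrightarrow> integrable M f"
  unfolding all_moments_def by (metis (no_types, lifting) Bochner_Integration.integrable_cong power_one_right)

lemma all_moments_const [simp]: "all_moments (\<lambda>x. c)"
  by (simp add: all_moments_def)

lemma all_moments_mult:
  assumes "all_moments f" "all_moments g"
  shows "all_moments (\<lambda>x. f x * g x)"
  unfolding all_moments_def
proof (intro conjI allI)
  note [measurable] = all_moments_measurable[OF assms(1)] all_moments_measurable[OF assms(2)]
  show "(\<lambda>x. f x * g x) \<in> borel_measurable M" by measurable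
  fix k :: nat
  have "integrable M (\<lambda>x. f x ^ (2 * k) + g x ^ (2 * k))"
    using assms by (auto simp: all_moments_def)
  then show "integrable M (\<lambda>x. (f x * g x) ^ k)"
  proof (rule Bochner_Integration.integrable_bound)
    have "\<bar>a * b\<bar> \<le> a\<^sup>2 + b\<^sup>2" for a b :: real
    proof -
      have "2 * (\<bar>a\<bar> * \<bar>b\<bar>) \<le> a\<^sup>2 + b\<^sup>2" "0 \<le> \<bar>a\<bar> * \<bar>b\<bar>"
        using sum_squares_bound[of "\<bar>a\<bar>" "\<bar>b\<bar>"] by simp_all
      then show ?thesis unfolding abs_mult by linarith
    qed
    from this[of "f _ ^ k" "g _ ^ k"]
    show "AE x in M. norm ((f x * g x) ^ k) \<le> norm (f x ^ (2 * k) + g x ^ (2 * k))"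
      by (intro AE_I2) (simp add: power_mult_distrib power_even_eq)
  qed measurable
qed

lemma all_moments_add:
  assumes "all_moments f" "all_moments g"
  shows "all_moments (\<lambda>x. f x + g x)"
  unfolding all_moments_def
proof (intro conjI allI)
  note [measurable] = all_moments_measurable[OF assms(1)] all_moments_measurable[OF assms(2)]
  show "(\<lambda>x. f x + g x) \<in> borel_measurable M" by measurable
  fix k :: nat
  have "integrable M (\<lambda>x. 2 ^ k * (\<bar>f x ^ k\<bar> + \<bar>g x ^ k\<bar>))"
    using assms by (intro integrable_mult_right Bochner_Integration.integrable_add integrable_abs)
      (auto simp: all_moments_def)
  then show "integrable M (\<lambda>x. (f x + g x) ^ k)"
  proof (rule Bochner_Integration.integrable_bound)
    have "\<bar>(a + b) ^ k\<bar> \<le> 2 ^ k * (\<bar>a ^ k\<bar> + \<bar>b ^ k\<bar>)" for a b :: real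
    proof -
      have "\<bar>(a + b) ^ k\<bar> \<le> (2 * max \<bar>a\<bar> \<bar>b\<bar>) ^ k"
        unfolding power_abs by (rule power_mono) auto
      also have "\<dots> \<le> 2 ^ k * (\<bar>a\<bar> ^ k + \<bar>b\<bar> ^ k)"
        by (auto simp: power_mult_distrib max_def)
      finally show ?thesis by (simp add: power_abs)
    qed
    then show "AE x in M. norm ((f x + g x) ^ k) \<le> norm (2 ^ k * (\<bar>f x ^ k\<bar> + \<bar>g x ^ k\<bar>))"
      by (intro AE_I2) (auto intro: order_trans)
  qed measurable
qed

lemma all_moments_sum: "(\<And>i. i \<in> I \<Longrightarrow> all_moments (f i)) \<Longrightarrow> all_moments (\<lambda>x. \<Sum>i\<in>I. f i x)"
  by (induction I rule: infinite_finite_induct) (auto intro: all_moments_add)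

lemma all_moments_prod_list: "(\<And>G. G \<in> set Gs \<Longrightarrow> all_moments G) \<Longrightarrow> all_moments (\<lambda>x. \<Prod>G\<leftarrow>Gs. G x)"
  by (induction Gs) (auto intro: all_moments_mult)

lemma all_moments_power: "all_moments f \<Longrightarrow> all_moments (\<lambda>x. f x ^ k)"
  by (induction k) (auto intro: all_moments_mult)

lemma all_moments_uminus: "all_moments f \<Longrightarrow> all_moments (\<lambda>x. - f x)"
  using all_moments_mult[of "\<lambda>_. -1" f] by simp

lemma all_moments_diff: "all_moments f \<Longrightarrow> all_moments g \<Longrightarrow> all_moments (\<lambda>x. f x - g x)"
  using all_moments_add[OF _ all_moments_uminus, of f g] by simp

text \<open>By the binomial formula the expectation is a polynomial in \<open>s\<close>, and the
  derivative at 0 is its linear coefficient. The Wick formula needs no other exchange of derivative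
  and expectation.\<close>

lemma has_derivative_expectation_power:
  assumes A: "all_moments A" and G: "all_moments G" and K: "all_moments K"
  shows "((\<lambda>s. expectation (\<lambda>x. A x * (G x + s * K x) ^ n)) has_real_derivative
    real n * expectation (\<lambda>x. A x * G x ^ (n - 1) * K x)) (at 0)"
proof -
  define c where "c i = real (n choose i) * expectation (\<lambda>x. A x * K x ^ i * G x ^ (n - i))" for i
  have int: "integrable M (\<lambda>x. A x * K x ^ i * G x ^ j)" for i j
    by (intro all_moments_integrable all_moments_mult all_moments_power assms)
  have eq: "expectation (\<lambda>x. A x * (G x + s * K x) ^ n) = (\<Sum>i\<le>n. c i * s ^ i)" for s
  proof -
    have "expectation (\<lambda>x. A x * (G x + s * K x) ^ n)
        = expectation (\<lambda>x. \<Sum>i\<le>n. (real (n choose i) * s ^ i) * (A x * K x ^ i * G x ^ (n - i)))"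
    proof (rule Bochner_Integration.integral_cong)
      fix x
      have "(G x + s * K x) ^ n = (\<Sum>i\<le>n. real (n choose i) * (s * K x) ^ i * G x ^ (n - i))"
        using binomial_ring[of "s * K x" "G x" n] by (simp add: add.commute)
      then show "A x * (G x + s * K x) ^ n
          = (\<Sum>i\<le>n. (real (n choose i) * s ^ i) * (A x * K x ^ i * G x ^ (n - i)))"
        by (simp add: power_mult_distrib sum_distrib_left mult_ac)
    qed simp
    also have "\<dots> = (\<Sum>i\<le>n. (real (n choose i) * s ^ i) * expectation (\<lambda>x. A x * K x ^ i * G x ^ (n - i)))"
      by (subst Bochner_Integration.integral_sum) (auto intro: int)
    finally show ?thesis by (simp add: c_def ac_simps)
  qed
  have "((\<lambda>s. \<Sum>i\<le>n. c i * s ^ i) has_real_derivative (\<Sum>i\<le>n. c i * (real i * 0 ^ (i - 1)))) (at 0)"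
    by (intro DERIV_sum DERIV_cmult) (auto intro!: derivative_eq_intros)
  also have "(\<Sum>i\<le>n. c i * (real i * 0 ^ (i - 1))) = (\<Sum>i\<le>n. if i = 1 then c 1 else 0)"
    by (intro sum.cong) (auto simp: power_0_left)
  also have "\<dots> = real n * expectation (\<lambda>x. A x * G x ^ (n - 1) * K x)"
    by (cases n) (auto simp: c_def ac_simps)
  finally show ?thesis unfolding eq .
qed

end

text \<open>Gaussianity is recorded through moments: a linear family of centred variables with the
  moment recursion of a normal law. The recursion also holds for the zero variable, so degenerate
  linear combinations are included. Linearity is what polarisation uses.\<close>

locale gaussian_space = prob_space M for M :: "'w measure" +
  fixes L :: "('w \<Rightarrow> real) set"
  assumes space_moments: "G \<in> L \<Longrightarrow> all_moments G"
    and space_add: "G \<in> L \<Longrightarrow> H \<in> L \<Longrightarrow> (\<lambda>x. G x + H x) \<in> L"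
    and space_scale: "G \<in> L \<Longrightarrow> (\<lambda>x. c * G x) \<in> L"
    and space_mean: "G \<in> L \<Longrightarrow> expectation G = 0"
    and space_recursion: "G \<in> L \<Longrightarrow> expectation (\<lambda>x. G x ^ (k + 2)) =
      real (k + 1) * expectation (\<lambda>x. G x ^ 2) * expectation (\<lambda>x. G x ^ k)"
begin

text \<open>Gaussian integration by parts for monomials. It is the derivative at s = 0 of the moment
  recursion for G + s H, combined with the induction hypothesis.\<close>

lemma expectation_mult_power:
  assumes H: "H \<in> L" and G: "G \<in> L"
  shows "expectation (\<lambda>x. H x * G x ^ n) =
    real n * expectation (\<lambda>x. H x * G x) * expectation (\<lambda>x. G x ^ (n - 1))"
proof (induction n rule: less_induct)
  case (less n)
  note mom = space_moments[OF H] space_moments[OF G]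
  have one: "expectation (\<lambda>x. 1 :: real) = 1" by (simp add: prob_space)
  consider "n = 0" | "n = 1" | k where "n = k + 2"
    by (metis One_nat_def add_2_eq_Suc' not0_implies_Suc)
  then show ?case
  proof cases
    case 1
    then show ?thesis using space_mean[OF H] by simp
  next
    case 2
    then show ?thesis using one by simp
  next
    case (3 j)
    \<comment> \<open>The recursion is differentiated one exponent above \<open>n\<close>, at k + 2
      = n + 1, so that the derivative contains H G^n.\<close>
    define k where "k = j + 1"
    have n: "n = k + 1" using 3 by (simp add: k_def)
    let ?E = "\<lambda>s. expectation (\<lambda>x. 1 * (G x + s * H x) ^ (k + 2))"
    let ?F = "\<lambda>s. real (k + 1) * (expectation (\<lambda>x. 1 * (G x + s * H x) ^ 2) * expectation (\<lambda>x. 1 * (G x + s * H x) ^ k))"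
    have EF: "?E = ?F"
    proof
      fix s show "?E s = ?F s"
        using space_recursion[OF space_add[OF G space_scale[OF H, of s]], of k] by simp
    qed
    have dE: "(?E has_real_derivative real (k + 2) * expectation (\<lambda>x. 1 * G x ^ (k + 2 - 1) * H x)) (at 0)"
      by (rule has_derivative_expectation_power) (use mom in auto)
    have dF: "(?E has_real_derivative real (k + 1) *
        ((real 2 * expectation (\<lambda>x. 1 * G x ^ (2 - 1) * H x)) * expectation (\<lambda>x. 1 * (G x + 0 * H x) ^ k)
        + (real k * expectation (\<lambda>x. 1 * G x ^ (k - 1) * H x)) * expectation (\<lambda>x. 1 * (G x + 0 * H x) ^ 2))) (at 0)"
      unfolding EF by (intro DERIV_cmult DERIV_mult has_derivative_expectation_power) (use mom in auto)
    have eq: "real (k + 2) * expectation (\<lambda>x. H x * G x ^ n) =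
        real (k + 1) * (2 * expectation (\<lambda>x. H x * G x) * expectation (\<lambda>x. G x ^ k)
        + real k * expectation (\<lambda>x. H x * G x ^ j) * expectation (\<lambda>x. G x ^ 2))"
      using DERIV_unique[OF dE dF] by (simp add: n k_def mult.commute)
    \<comment> \<open>Differentiating the factor with exponent k gives E(H G^j) E(G^2). The
      induction hypothesis and the recursion rewrite it as E(H G) E(G^k), so that both terms combine
      with total weight (k + 1)(k + 2).\<close>
    have red: "real k * expectation (\<lambda>x. H x * G x ^ j) * expectation (\<lambda>x. G x ^ 2)
        = real k * expectation (\<lambda>x. H x * G x) * expectation (\<lambda>x. G x ^ k)"
    proof (cases j)
      case 0
      then show ?thesis using space_mean[OF H] space_mean[OF G] by (simp add: k_def)
    next
      case (Suc i)
      have "expectation (\<lambda>x. H x * G x ^ j) = real j * expectation (\<lambda>x. H x * G x) * expectation (\<lambda>x. G x ^ i)"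
        using less[of j] 3 Suc by simp
      moreover have "expectation (\<lambda>x. G x ^ k) = real j * expectation (\<lambda>x. G x ^ 2) * expectation (\<lambda>x. G x ^ i)"
        using space_recursion[OF G, of i] Suc by (simp add: k_def)
      ultimately show ?thesis by simp
    qed
    have "real (k + 2) * expectation (\<lambda>x. H x * G x ^ n) =
        real (k + 2) * (real n * expectation (\<lambda>x. H x * G x) * expectation (\<lambda>x. G x ^ (n - 1)))"
      unfolding eq red using n by (simp add: algebra_simps)
    then show ?thesis by simp
  qed
qed

text \<open>Polarisation: the case of one more factor \<open>K\<close> is the derivative at \<open>s = 0\<close> of the previous
  case, taken with \<open>G + s K\<close> in place of \<open>G\<close>.\<close>
lemma wick_power:
  assumes H: "H \<in> L" and "G \<in> L" and "set Gs \<subseteq> L"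
  shows "expectation (\<lambda>x. H x * (\<Prod>F\<leftarrow>Gs. F x) * G x ^ k) =
    (\<Sum>j<length Gs. expectation (\<lambda>x. H x * (Gs ! j) x) *
       expectation (\<lambda>x. (\<Prod>F\<leftarrow>take j Gs @ drop (Suc j) Gs. F x) * G x ^ k)) +
    real k * expectation (\<lambda>x. H x * G x) * expectation (\<lambda>x. (\<Prod>F\<leftarrow>Gs. F x) * G x ^ (k - 1))"
  using assms(2,3)
proof (induction Gs arbitrary: G k)
  case Nil
  then show ?case using expectation_mult_power[OF H] by simp
next
  case (Cons K Gs)
  then have G: "G \<in> L" and K: "K \<in> L" and Gs: "set Gs \<subseteq> L" by auto
  define P where "P x = (\<Prod>F\<leftarrow>Gs. F x)" for x
  define P' where "P' j x = (\<Prod>F\<leftarrow>take j Gs @ drop (Suc j) Gs. F x)" for j x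
  have sub: "set (take j Gs @ drop (Suc j) Gs) \<subseteq> L" for j
    using Gs set_take_subset[of j Gs] set_drop_subset[of "Suc j" Gs] by auto
  have mP: "all_moments P" unfolding P_def
    by (rule all_moments_prod_list) (use Gs space_moments in auto)
  have mP': "all_moments (P' j)" for j unfolding P'_def
    by (rule all_moments_prod_list) (use sub space_moments in blast)
  note mom = space_moments[OF H] space_moments[OF G] space_moments[OF K] mP mP'
  \<comment> \<open>Exponent k + 1 rather than k: differentiating once leaves G^k K, the product
    with one more factor.\<close>
  let ?E = "\<lambda>s. expectation (\<lambda>x. (H x * P x) * (G x + s * K x) ^ (k + 1))"
  let ?F = "\<lambda>s. (\<Sum>j<length Gs. expectation (\<lambda>x. H x * (Gs ! j) x) * expectation (\<lambda>x. P' j x * (G x + s * K x) ^ (k + 1)))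
    + real (k + 1) * (expectation (\<lambda>x. H x * (G x + s * K x) ^ 1) * expectation (\<lambda>x. P x * (G x + s * K x) ^ k))"
  have EF: "?E = ?F"
  proof
    fix s
    show "?E s = ?F s"
      using Cons.IH[OF space_add[OF G space_scale[OF K, of s]] Gs, of "k + 1"]
      by (simp add: P_def P'_def)
  qed
  have dE: "(?E has_real_derivative real (k + 1) * expectation (\<lambda>x. (H x * P x) * G x ^ (k + 1 - 1) * K x)) (at 0)"
    by (rule has_derivative_expectation_power) (use mom in \<open>auto intro: all_moments_mult\<close>)
  have dF: "(?E has_real_derivative
      (\<Sum>j<length Gs. expectation (\<lambda>x. H x * (Gs ! j) x) * (real (k + 1) * expectation (\<lambda>x. P' j x * G x ^ (k + 1 - 1) * K x)))
    + real (k + 1) * ((real 1 * expectation (\<lambda>x. H x * G x ^ (1 - 1) * K x)) * expectation (\<lambda>x. P x * (G x + 0 * K x) ^ k)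
      + (real k * expectation (\<lambda>x. P x * G x ^ (k - 1) * K x)) * expectation (\<lambda>x. H x * (G x + 0 * K x) ^ 1))) (at 0)"
    unfolding EF by (intro DERIV_add DERIV_sum DERIV_cmult DERIV_mult has_derivative_expectation_power) (use mom in auto)
  have "real (k + 1) * expectation (\<lambda>x. (H x * P x) * G x ^ k * K x) =
      (\<Sum>j<length Gs. expectation (\<lambda>x. H x * (Gs ! j) x) * (real (k + 1) * expectation (\<lambda>x. P' j x * G x ^ k * K x)))
    + real (k + 1) * (expectation (\<lambda>x. H x * K x) * expectation (\<lambda>x. P x * G x ^ k)
      + real k * expectation (\<lambda>x. P x * G x ^ (k - 1) * K x) * expectation (\<lambda>x. H x * G x))"
    using DERIV_unique[OF dE dF] by simp
  also have "\<dots> = real (k + 1) * ((\<Sum>j<length Gs. expectation (\<lambda>x. H x * (Gs ! j) x) * expectation (\<lambda>x. P' j x * G x ^ k * K x))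
    + expectation (\<lambda>x. H x * K x) * expectation (\<lambda>x. P x * G x ^ k)
      + real k * expectation (\<lambda>x. P x * G x ^ (k - 1) * K x) * expectation (\<lambda>x. H x * G x))"
    by (simp only: sum_distrib_left distrib_left ac_simps)
  finally have *: "expectation (\<lambda>x. (H x * P x) * G x ^ k * K x) =
      (\<Sum>j<length Gs. expectation (\<lambda>x. H x * (Gs ! j) x) * expectation (\<lambda>x. P' j x * G x ^ k * K x))
    + expectation (\<lambda>x. H x * K x) * expectation (\<lambda>x. P x * G x ^ k)
      + real k * expectation (\<lambda>x. P x * G x ^ (k - 1) * K x) * expectation (\<lambda>x. H x * G x)"
    by (subst (asm) mult_left_cancel) simp_all
  show ?case
    using *[unfolded P_def P'_def]
    by (simp add: sum.lessThan_Suc_shift ac_simps del: sum.lessThan_Suc)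
qed

lemma wick:
  assumes "H \<in> L" and "set Gs \<subseteq> L"
  shows "expectation (\<lambda>x. H x * (\<Prod>F\<leftarrow>Gs. F x)) =
    (\<Sum>j<length Gs. expectation (\<lambda>x. H x * (Gs ! j) x) *
       expectation (\<lambda>x. \<Prod>F\<leftarrow>take j Gs @ drop (Suc j) Gs. F x))"
  using wick_power[OF assms(1,1,2), of 0] by simp

end

section \<open>Moments of products with repeated labels\<close>

lemma count_list_remove_nth:
  "j < length xs \<Longrightarrow> count_list xs e =
    count_list (take j xs @ drop (Suc j) xs) e + (if xs ! j = e then 1 else 0)"
  using arg_cong[OF id_take_nth_drop[of j xs], of "\<lambda>l. count_list l e"] by simp

lemma singles_eq: "singles es = card {e. count_list es e = 1}" "finite {e. count_list es e = 1}"
proof -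
  have *: "e \<in> set es" if "count_list es e = 1" for e
    using that count_notin[of e es] by fastforce
  then have "{e \<in> set es. count_list es e = 1} = {e. count_list es e = 1}" by blast
  then show "singles es = card {e. count_list es e = 1}" by (simp add: singles_def)
  have "{e. count_list es e = 1} \<subseteq> set es" using * by blast
  then show "finite {e. count_list es e = 1}" by (rule finite_subset) simp
qed

text \<open>Labels other than the two removed keep their multiplicity. If the two agree, that label
  occurs at least twice and is no single; if they differ, at most these two singles are
  lost.\<close>

lemma singles_remove:
  assumes "j < length xs"
  defines "rest \<equiv> take j xs @ drop (Suc j) xs"
  shows "singles (x # xs) \<le> singles rest + (if x = xs ! j then 0 else 2)"
proof -
  have *: "count_list (x # xs) e = count_list rest e + (if xs ! j = e then 1 else 0) + (if x = e then 1 else 0)" for e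
    using count_list_remove_nth[OF assms(1), of e] by (simp add: rest_def)
  show ?thesis
  proof (cases "x = xs ! j")
    case True
    have "{e. count_list (x # xs) e = 1} \<subseteq> {e. count_list rest e = 1}"
      unfolding * using True by auto
    then have "singles (x # xs) \<le> singles rest"
      unfolding singles_eq(1) by (rule card_mono[OF singles_eq(2)])
    then show ?thesis by simp
  next
    case False
    have "{e. count_list (x # xs) e = 1} \<subseteq> {e. count_list rest e = 1} \<union> {x, xs ! j}"
      unfolding * by auto
    then have "card {e. count_list (x # xs) e = 1} \<le> card ({e. count_list rest e = 1} \<union> {x, xs ! j})"
      by (rule card_mono[rotated]) (use singles_eq(2) in blast)
    also have "\<dots> \<le> card {e. count_list rest e = 1} + card {x, xs ! j}" by (rule card_Un_le)
    also have "card {x, xs ! j} \<le> 2" by (simp add: card_insert_if)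
    finally show ?thesis unfolding singles_eq(1) using False by simp
  qed
qed

context gaussian_space
begin

lemma wick_labels:
  assumes "Z x \<in> L" "\<And>e. e \<in> set xs \<Longrightarrow> Z e \<in> L"
  shows "expectation (\<lambda>\<omega>. \<Prod>e\<leftarrow>x # xs. Z e \<omega>) =
    (\<Sum>j<length xs. expectation (\<lambda>\<omega>. Z x \<omega> * Z (xs ! j) \<omega>) *
       expectation (\<lambda>\<omega>. \<Prod>e\<leftarrow>take j xs @ drop (Suc j) xs. Z e \<omega>))"
proof -
  have "expectation (\<lambda>\<omega>. Z x \<omega> * (\<Prod>F\<leftarrow>map Z xs. F \<omega>)) =
    (\<Sum>j<length (map Z xs). expectation (\<lambda>\<omega>. Z x \<omega> * (map Z xs ! j) \<omega>) *
       expectation (\<lambda>\<omega>. \<Prod>F\<leftarrow>take j (map Z xs) @ drop (Suc j) (map Z xs). F \<omega>))"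
    by (rule wick) (use assms in auto)
  then show ?thesis
    by (simp add: comp_def take_map[symmetric] drop_map[symmetric])
qed

text \<open>Writing the covariance bound as \<kappa> \<eta>^2 lets one pair of distinct labels pay
  for the two singles it may remove, one factor \<eta> each. In the application \<eta>^2 is
  1/b.\<close>

context
  fixes Z :: "'e \<Rightarrow> 'w \<Rightarrow> real" and I :: "'e set" and \<kappa> \<eta> :: real
  assumes ZL: "\<And>e. e \<in> I \<Longrightarrow> Z e \<in> L"
    and var: "\<And>e. e \<in> I \<Longrightarrow> expectation (\<lambda>\<omega>. Z e \<omega> * Z e \<omega>) = 1"
    and cov: "\<And>e f. e \<in> I \<Longrightarrow> f \<in> I \<Longrightarrow> e \<noteq> f \<Longrightarrow> \<bar>expectation (\<lambda>\<omega>. Z e \<omega> * Z f \<omega>)\<bar> \<le> \<kappa> * \<eta>\<^sup>2"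
    and \<kappa>: "\<kappa> \<ge> 1" and \<eta>: "0 \<le> \<eta>" "\<eta> \<le> 1"
begin

text \<open>In the Wick expansion along the first label, an equal partner costs at most \<kappa> and
  removes no single, a different one costs \<kappa> \<eta>^2 and removes at most two. The factorial
  is a generous count of the pairings.\<close>

lemma prod_expectation_le:
  assumes "set es \<subseteq> I"
  shows "\<bar>expectation (\<lambda>\<omega>. \<Prod>e\<leftarrow>es. Z e \<omega>)\<bar> \<le> fact (length es) * \<kappa> ^ length es * \<eta> ^ singles es"
  using assms
proof (induction es rule: length_induct)
  case (1 es)
  show ?case
  proof (cases es)
    case Nil
    then show ?thesis by (simp add: prob_space singles_def)
  next
    case (Cons x xs)
    let ?r = "\<lambda>j. take j xs @ drop (Suc j) xs"
    define n where "n = length xs"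
    have x: "x \<in> I" "set xs \<subseteq> I" using 1 Cons by auto
    have t: "\<bar>expectation (\<lambda>\<omega>. Z x \<omega> * Z (xs ! j) \<omega>) * expectation (\<lambda>\<omega>. \<Prod>e\<leftarrow>?r j. Z e \<omega>)\<bar>
        \<le> fact (n - 1) * \<kappa> ^ n * \<eta> ^ singles es" if j: "j < n" for j
    proof -
      have sub: "set (?r j) \<subseteq> I"
        using x(2) set_take_subset[of j xs] set_drop_subset[of "Suc j" xs] by auto
      have len: "length (?r j) = n - 1" using j by (simp add: n_def)
      have IH: "\<bar>expectation (\<lambda>\<omega>. \<Prod>e\<leftarrow>?r j. Z e \<omega>)\<bar> \<le> fact (n - 1) * \<kappa> ^ (n - 1) * \<eta> ^ singles (?r j)"
        using 1(1)[rule_format, of "?r j"] sub Cons len by (simp add: n_def)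
      have xj: "xs ! j \<in> I" using x(2) j by (auto simp: n_def)
      define d :: nat where "d = (if x = xs ! j then 0 else 2)"
      have c: "\<bar>expectation (\<lambda>\<omega>. Z x \<omega> * Z (xs ! j) \<omega>)\<bar> \<le> \<kappa> * \<eta> ^ d"
        using var[OF x(1)] cov[OF x(1) xj] \<kappa> by (auto simp: d_def)
      have k0: "0 \<le> \<kappa>" using \<kappa> by simp
      have "\<bar>expectation (\<lambda>\<omega>. Z x \<omega> * Z (xs ! j) \<omega>) * expectation (\<lambda>\<omega>. \<Prod>e\<leftarrow>?r j. Z e \<omega>)\<bar>
          \<le> (\<kappa> * \<eta> ^ d) * (fact (n - 1) * \<kappa> ^ (n - 1) * \<eta> ^ singles (?r j))"
        unfolding abs_mult by (intro mult_mono c IH) (use k0 \<eta> in auto)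
      also have "\<dots> = fact (n - 1) * \<kappa> ^ n * \<eta> ^ (singles (?r j) + d)"
        using j by (cases n) (simp_all add: power_add)
      also have "\<dots> \<le> fact (n - 1) * \<kappa> ^ n * \<eta> ^ singles es"
      proof (rule mult_left_mono)
        show "\<eta> ^ (singles (?r j) + d) \<le> \<eta> ^ singles es"
          using singles_remove[of j xs x] j \<eta> Cons
          by (intro power_decreasing) (auto simp: n_def d_def)
      qed (use k0 in auto)
      finally show ?thesis .
    qed
    have "\<bar>expectation (\<lambda>\<omega>. \<Prod>e\<leftarrow>es. Z e \<omega>)\<bar> \<le> (\<Sum>j<n. fact (n - 1) * \<kappa> ^ n * \<eta> ^ singles es)"
    proof -
      have "expectation (\<lambda>\<omega>. \<Prod>e\<leftarrow>es. Z e \<omega>) =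
          (\<Sum>j<n. expectation (\<lambda>\<omega>. Z x \<omega> * Z (xs ! j) \<omega>) * expectation (\<lambda>\<omega>. \<Prod>e\<leftarrow>?r j. Z e \<omega>))"
        unfolding Cons n_def by (rule wick_labels) (use x ZL in auto)
      also have "\<bar>\<dots>\<bar> \<le> (\<Sum>j<n. fact (n - 1) * \<kappa> ^ n * \<eta> ^ singles es)"
        by (rule order_trans[OF sum_abs]) (rule sum_mono, use t in blast)
      finally show ?thesis .
    qed
    also have "\<dots> = real n * fact (n - 1) * \<kappa> ^ n * \<eta> ^ singles es" by simp
    also have "\<dots> \<le> fact (Suc n) * \<kappa> ^ Suc n * \<eta> ^ singles es"
    proof (intro mult_right_mono mult_mono)
      have "real n * fact (n - 1) \<le> fact n" by (cases n) simp_all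
      also have "\<dots> \<le> fact (Suc n)" by (rule fact_mono) simp
      finally show "real n * fact (n - 1) \<le> fact (Suc n)" .
      show "\<kappa> ^ n \<le> \<kappa> ^ Suc n" using \<kappa> by (intro power_increasing) auto
    qed (use \<kappa> \<eta> in auto)
    finally show ?thesis using Cons by (simp add: n_def)
  qed
qed

text \<open>Only the pairing of every label with its twin contributes 1. Any other partner costs
  \<eta>^2, and after the removal of a twin pair all remaining labels are still double, so the
  induction continues.\<close>

lemma prod_expectation_double:
  assumes "set es \<subseteq> I" and "\<And>e. e \<in> set es \<Longrightarrow> count_list es e = 2"
  shows "\<bar>expectation (\<lambda>\<omega>. \<Prod>e\<leftarrow>es. Z e \<omega>) - 1\<bar> \<le> fact (length es) * \<kappa> ^ length es * \<eta>\<^sup>2"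
  using assms
proof (induction es rule: length_induct)
  case (1 es)
  show ?case
  proof (cases es)
    case Nil
    then show ?thesis by (simp add: prob_space)
  next
    case (Cons x xs)
    let ?r = "\<lambda>j. take j xs @ drop (Suc j) xs"
    define n where "n = length xs"
    have x: "x \<in> I" "set xs \<subseteq> I" using 1 Cons by auto
    have k0: "0 \<le> \<kappa>" using \<kappa> by simp
    have cx: "count_list xs x = 1" using 1(3)[of x] Cons by simp
    then have "x \<in> set xs" using count_notin by fastforce
    then obtain i where i: "i < n" "xs ! i = x" by (auto simp: in_set_conv_nth n_def)
    have uniq: "xs ! j \<noteq> x" if "j < n" "j \<noteq> i" for j
    proof
      assume e: "xs ! j = x"
      have "x \<notin> set (?r i)"
        using count_list_remove_nth[of i xs x] cx i by (simp add: n_def count_list_0_iff)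
      moreover have "xs ! j \<in> set (?r i)"
      proof (cases "j < i")
        case True
        then have "take i xs ! j \<in> set (take i xs)" using that by (intro nth_mem) (simp add: n_def)
        then show ?thesis using True by simp
      next
        case False
        then have "drop (Suc i) xs ! (j - Suc i) \<in> set (drop (Suc i) xs)"
          using that by (intro nth_mem) (auto simp: n_def)
        then show ?thesis using False that by (simp add: n_def)
      qed
      ultimately show False using e by simp
    qed
    have sub: "set (?r j) \<subseteq> I" for j
      using x(2) set_take_subset[of j xs] set_drop_subset[of "Suc j" xs] by auto
    have len: "length (?r j) = n - 1" if "j < n" for j using that by (simp add: n_def)
    define t where "t j = expectation (\<lambda>\<omega>. Z x \<omega> * Z (xs ! j) \<omega>) * expectation (\<lambda>\<omega>. \<Prod>e\<leftarrow>?r j. Z e \<omega>)" for j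
    have off: "\<bar>t j\<bar> \<le> fact (n - 1) * \<kappa> ^ n * \<eta>\<^sup>2" if j: "j < n" "j \<noteq> i" for j
    proof -
      have "xs ! j \<in> I" using x(2) j by (auto simp: n_def)
      then have c: "\<bar>expectation (\<lambda>\<omega>. Z x \<omega> * Z (xs ! j) \<omega>)\<bar> \<le> \<kappa> * \<eta>\<^sup>2"
        using cov[OF x(1)] uniq[OF j] by auto
      have "\<bar>expectation (\<lambda>\<omega>. \<Prod>e\<leftarrow>?r j. Z e \<omega>)\<bar> \<le> fact (n - 1) * \<kappa> ^ (n - 1) * \<eta> ^ singles (?r j)"
        using prod_expectation_le[OF sub, of j] len[OF j(1)] by simp
      also have "\<dots> \<le> fact (n - 1) * \<kappa> ^ (n - 1) * 1"
        by (intro mult_left_mono power_le_one) (use k0 \<eta> in auto)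
      finally have "\<bar>t j\<bar> \<le> (\<kappa> * \<eta>\<^sup>2) * (fact (n - 1) * \<kappa> ^ (n - 1) * 1)"
        unfolding t_def abs_mult using c k0 by (intro mult_mono) auto
      also have "\<dots> = fact (n - 1) * \<kappa> ^ n * \<eta>\<^sup>2" using j by (cases n) simp_all
      finally show ?thesis .
    qed
    have "\<bar>t i - 1\<bar> \<le> fact (n - 1) * \<kappa> ^ (n - 1) * \<eta>\<^sup>2"
    proof -
      have "count_list (?r i) e = 2" if e: "e \<in> set (?r i)" for e
      proof -
        have "e \<in> set xs" using e set_take_subset[of i xs] set_drop_subset[of "Suc i" xs] by auto
        then have "count_list (x # xs) e = 2" using 1(3)[of e] Cons by simp
        moreover have "e \<noteq> x" using e count_list_remove_nth[of i xs x] cx i by (auto simp: n_def count_list_0_iff)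
        ultimately show ?thesis using count_list_remove_nth[of i xs e] i by (simp add: n_def)
      qed
      then have "\<bar>expectation (\<lambda>\<omega>. \<Prod>e\<leftarrow>?r i. Z e \<omega>) - 1\<bar> \<le> fact (n - 1) * \<kappa> ^ (n - 1) * \<eta>\<^sup>2"
        using 1(1)[rule_format, of "?r i"] sub Cons len[OF i(1)] by (simp add: n_def)
      then show ?thesis using var[OF x(1)] i by (simp add: t_def)
    qed
    also have "\<dots> \<le> fact (n - 1) * \<kappa> ^ n * \<eta>\<^sup>2"
      by (intro mult_right_mono mult_left_mono power_increasing) (use \<kappa> in auto)
    finally have on: "\<bar>t i - 1\<bar> \<le> fact (n - 1) * \<kappa> ^ n * \<eta>\<^sup>2" .
    have "expectation (\<lambda>\<omega>. \<Prod>e\<leftarrow>es. Z e \<omega>) - 1 = (\<Sum>j<n. t j) - (\<Sum>j<n. if j = i then 1 else 0)"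
      unfolding Cons using x ZL i(1) by (subst wick_labels) (auto simp: n_def t_def)
    also have "\<bar>\<dots>\<bar> \<le> (\<Sum>j<n. fact (n - 1) * \<kappa> ^ n * \<eta>\<^sup>2)"
      unfolding sum_subtractf[symmetric]
      by (rule order_trans[OF sum_abs]) (rule sum_mono, use on off in auto)
    also have "\<dots> = real n * fact (n - 1) * \<kappa> ^ n * \<eta>\<^sup>2" by simp
    also have "\<dots> \<le> fact (Suc n) * \<kappa> ^ Suc n * \<eta>\<^sup>2"
    proof (intro mult_right_mono mult_mono)
      have "real n * fact (n - 1) \<le> fact n" by (cases n) simp_all
      also have "\<dots> \<le> fact (Suc n)" by (rule fact_mono) simp
      finally show "real n * fact (n - 1) \<le> fact (Suc n)" .
      show "\<kappa> ^ n \<le> \<kappa> ^ Suc n" using \<kappa> by (intro power_increasing) auto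
    qed (use \<kappa> \<eta> in auto)
    finally show ?thesis using Cons by (simp add: n_def)
  qed
qed

end

end

section \<open>Gaussian vectors span Gaussian spaces\<close>

lemma (in prob_space) gaussian_rv_moments:
  assumes G: "gaussian_rv M X" and m: "expectation X = 0"
  shows "all_moments X"
    and "expectation (\<lambda>x. X x ^ (k + 2)) = real (k + 1) * expectation (\<lambda>x. X x ^ 2) * expectation (\<lambda>x. X x ^ k)"
proof -
  have X [measurable]: "X \<in> borel_measurable M" using G by (simp add: gaussian_rv_def)
  from G consider \<mu> where "AE \<omega> in M. X \<omega> = \<mu>"
    | \<mu> \<sigma> where "\<sigma> > 0" "distributed M lborel X (normal_density \<mu> \<sigma>)"
    by (auto simp: gaussian_rv_def)
  then have "all_moments X \<and> expectation (\<lambda>x. X x ^ (k + 2)) = real (k + 1) * expectation (\<lambda>x. X x ^ 2) * expectation (\<lambda>x. X x ^ k)"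
  proof cases
    \<comment> \<open>Mean zero turns the degenerate law into the point mass at 0, and both
      \<open>\<mu> ^ (k + 2)\<close> and \<open>\<mu> ^ 2\<close> vanish for every \<open>k\<close>,
      including k = 0.\<close>
    case (1 \<mu>)
    have ae: "AE x in M. X x ^ j = \<mu> ^ j" for j using 1 by auto
    have "expectation X = expectation (\<lambda>_. \<mu>)" by (rule integral_cong_AE) (use 1 in auto)
    then have \<mu>: "\<mu> = 0" using m by (simp add: prob_space)
    have e: "expectation (\<lambda>x. X x ^ j) = \<mu> ^ j" for j
    proof -
      have "expectation (\<lambda>x. X x ^ j) = expectation (\<lambda>_. \<mu> ^ j)" by (rule integral_cong_AE) (use ae in auto)
      then show ?thesis by (simp add: prob_space)
    qed
    have "integrable M (\<lambda>x. X x ^ j)" for j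
      by (subst integrable_cong_AE[OF _ _ ae]) auto
    then show ?thesis unfolding all_moments_def e \<mu> by simp
  next
    case (2 \<mu> \<sigma>)
    have "expectation X = (\<integral>x. normal_density \<mu> \<sigma> x * x \<partial>lborel)"
      using distributed_integral[OF 2(2), of "\<lambda>x. x"] by simp
    then have \<mu>: "\<mu> = 0" using m integral_normal_moment_nz_1[OF 2(1)] by simp
    have int: "integrable M (\<lambda>x. X x ^ j)" for j
      using distributed_integrable[OF 2(2), of "\<lambda>x. x ^ j"] integrable_normal_moment[OF 2(1), of \<mu> j] \<mu>
      by simp
    have e: "expectation (\<lambda>x. X x ^ j) = (\<integral>x. normal_density 0 \<sigma> x * (x - 0) ^ j \<partial>lborel)" for j
      using distributed_integral[OF 2(2), of "\<lambda>x. x ^ j"] \<mu> by simp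
    have "expectation (\<lambda>x. X x ^ (k + 2)) = real (k + 1) * expectation (\<lambda>x. X x ^ 2) * expectation (\<lambda>x. X x ^ k)"
    proof (cases "even k")
      case True
      then obtain j where k: "k = 2 * j" by blast
      have ev: "expectation (\<lambda>x. X x ^ (2 * i)) = fact (2 * i) / ((2 / \<sigma>\<^sup>2) ^ i * fact i)" for i
        unfolding e by (rule integral_normal_moment_even[OF 2(1)])
      have "expectation (\<lambda>x. X x ^ (k + 2)) = expectation (\<lambda>x. X x ^ (2 * Suc j))"
        using k by simp
      also have "\<dots> = real (k + 1) * expectation (\<lambda>x. X x ^ (2 * 1)) * expectation (\<lambda>x. X x ^ (2 * j))"
      proof -
        \<comment> \<open>Abstract form of the quotient of consecutive even moments (2 j)! / ((2 /
          \<sigma>^2)^j j!): here q is j + 1 and t is 2 j + 1, and 2 q t is what the factorial in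
          the numerator gains.\<close>
        have "2 * q * t * D / ((2 / s) * c * (q * F)) = t * (2 / (2 / s)) * (D / (c * F))"
          if "q \<noteq> 0" "s \<noteq> 0" "c \<noteq> 0" "F \<noteq> 0" for q t D s c F :: real
          using that by (simp add: field_simps)
        from this[of "real (Suc j)" "\<sigma>\<^sup>2" "(2 / \<sigma>\<^sup>2) ^ j" "fact j" "real (2 * j + 1)" "fact (2 * j)"]
        have "2 * real (Suc j) * real (2 * j + 1) * fact (2 * j) / ((2 / \<sigma>\<^sup>2) ^ Suc j * (real (Suc j) * fact j))
            = real (2 * j + 1) * (2 / (2 / \<sigma>\<^sup>2)) * (fact (2 * j) / ((2 / \<sigma>\<^sup>2) ^ j * fact j))"
          using 2(1) by simp
        moreover have "fact (2 * Suc j) = 2 * real (Suc j) * real (2 * j + 1) * fact (2 * j)"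
          by (simp add: algebra_simps)
        moreover have "fact (Suc j) = real (Suc j) * fact j" by (rule fact_Suc)
        ultimately show ?thesis unfolding ev k by (simp add: mult.assoc)
      qed
      finally show ?thesis using k by simp
    next
      case False
      then obtain j where k: "k = 2 * j + 1" by (elim oddE)
      have od: "expectation (\<lambda>x. X x ^ (2 * i + 1)) = 0" for i
        unfolding e by (rule integral_normal_moment_odd[OF 2(1)])
      have "expectation (\<lambda>x. X x ^ (k + 2)) = expectation (\<lambda>x. X x ^ (2 * Suc j + 1))"
        using k by simp
      then show ?thesis unfolding od using od[of j] k by simp
    qed
    then show ?thesis using int by (simp add: all_moments_def)
  qed
  then show "all_moments X"
    "expectation (\<lambda>x. X x ^ (k + 2)) = real (k + 1) * expectation (\<lambda>x. X x ^ 2) * expectation (\<lambda>x. X x ^ k)"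
    by auto
qed

definition linear_span :: "nat \<Rightarrow> (nat \<Rightarrow> 'w \<Rightarrow> real) \<Rightarrow> ('w \<Rightarrow> real) set" where
  "linear_span m Y = range (\<lambda>c \<omega>. \<Sum>k<m. c k * Y k \<omega>)"

lemma linear_span_base: "k < m \<Longrightarrow> Y k \<in> linear_span m Y"
  unfolding linear_span_def
  by (rule range_eqI[of _ _ "\<lambda>i. if i = k then 1 else 0"]) (auto simp: if_distrib[of "\<lambda>c. c * _"] cong: if_cong)

lemma gaussian_vector_space:
  assumes "prob_space M" and Y: "gaussian_vector M m C Y"
  shows "gaussian_space M (linear_span m Y)"
proof -
  interpret prob_space M by fact
  have g: "gaussian_rv M (\<lambda>\<omega>. \<Sum>k<m. c k * Y k \<omega>)" for c using Y by (simp add: gaussian_vector_def)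
  have gY: "gaussian_rv M (Y k)" if "k < m" for k
    using linear_span_base[OF that, of Y] g by (auto simp: linear_span_def)
  have mY: "expectation (Y k) = 0" if "k < m" for k using Y that by (simp add: gaussian_vector_def)
  have "expectation (\<lambda>\<omega>. \<Sum>k<m. c k * Y k \<omega>) = 0" for c
    using gaussian_rv_moments(1)[OF gY mY] mY
    by (subst Bochner_Integration.integral_sum) (auto intro: all_moments_integrable)
  note m = gaussian_rv_moments[OF g this]
  show ?thesis
  proof
    fix G assume "G \<in> linear_span m Y"
    then obtain c where G: "G = (\<lambda>\<omega>. \<Sum>k<m. c k * Y k \<omega>)" by (auto simp: linear_span_def)
    show "all_moments G" "expectation G = 0" unfolding G by fact+
    show "expectation (\<lambda>x. G x ^ (k + 2)) = real (k + 1) * expectation (\<lambda>x. G x ^ 2) * expectation (\<lambda>x. G x ^ k)" for k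
      unfolding G by fact
    show "(\<lambda>x. r * G x) \<in> linear_span m Y" for r
      unfolding G linear_span_def by (rule range_eqI[of _ _ "\<lambda>i. r * c i"]) (simp add: sum_distrib_left mult.assoc)
    fix H assume "H \<in> linear_span m Y"
    then obtain d where H: "H = (\<lambda>\<omega>. \<Sum>k<m. d k * Y k \<omega>)" by (auto simp: linear_span_def)
    show "(\<lambda>x. G x + H x) \<in> linear_span m Y"
      unfolding G H linear_span_def
      by (rule range_eqI[of _ _ "\<lambda>i. c i + d i"]) (simp add: sum.distrib distrib_right)
  qed
qed

section \<open>Moments of the semicircle distribution\<close>

fun scaled_chebyshev :: "nat \<Rightarrow> real \<Rightarrow> real" where
  "scaled_chebyshev 0 x = 1"
| "scaled_chebyshev (Suc 0) x = x"
| "scaled_chebyshev (Suc (Suc h)) x = x * scaled_chebyshev (Suc h) x - scaled_chebyshev h x"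

text \<open>Counts the paths of \<open>k\<close> steps +1 or -1 from 0 to \<open>h\<close> that
  never go below 0; for h = 0 and even k these are the Catalan numbers. It is the common recursion
  of traversals by depth and of semicircle integrals.\<close>

fun path_count :: "nat \<Rightarrow> nat \<Rightarrow> real" where
  "path_count 0 h = (if h = 0 then 1 else 0)"
| "path_count (Suc k) h = path_count k (Suc h) + (if h = 0 then 0 else path_count k (h - 1))"

lemma continuous_scaled_chebyshev [continuous_intros]: "continuous_on A (scaled_chebyshev h)"
  by (induction h rule: induct_nat_012) (auto intro!: continuous_intros)

text \<open>The trigonometric form of U_h, by which integrals against the semicircle density become
  integrals of products of sines.\<close>

lemma sin_scaled_chebyshev: "sin t * scaled_chebyshev h (2 * cos t) = sin (real (Suc h) * t)"
proof (induction h rule: induct_nat_012)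
  case (ge2 n)
  have "sin (real (n + 3) * t) + sin (real (n + 1) * t) = 2 * cos t * sin (real (n + 2) * t)"
  proof -
    have "real (n + 3) * t = real (n + 2) * t + t" "real (n + 1) * t = real (n + 2) * t - t"
      by (simp_all add: algebra_simps)
    then show ?thesis by (simp only: sin_add sin_diff) (simp add: mult_ac)
  qed
  moreover have "sin t * scaled_chebyshev (Suc (Suc n)) (2 * cos t)
      = 2 * cos t * (sin t * scaled_chebyshev (Suc n) (2 * cos t)) - sin t * scaled_chebyshev n (2 * cos t)"
    by (simp add: algebra_simps)
  ultimately show ?case using ge2 by (simp add: algebra_simps)
qed (auto simp: sin_double)

definition semi_density :: "real \<Rightarrow> real" where
  "semi_density x = 1 / (2 * pi) * sqrt (4 - x\<^sup>2) * indicator {-2..2} x"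

lemma semi_density_nonneg: "0 \<le> semi_density x"
proof (cases "x \<in> {-2..2}")
  case True
  then have "x\<^sup>2 \<le> 2\<^sup>2" by (intro abs_le_square_iff[THEN iffD1]) auto
  then show ?thesis by (simp add: semi_density_def)
qed (simp add: semi_density_def)

lemma semi_density_measurable [measurable]: "semi_density \<in> borel_measurable borel"
  unfolding semi_density_def by measurable

lemma semicircle_eq: "semicircle = density lborel (\<lambda>x. ennreal (semi_density x))"
  by (simp add: semicircle_def semi_density_def)

lemma sets_semicircle [simp, measurable_cong]: "sets semicircle = sets borel"
  by (simp add: semicircle_def)

text \<open>Passes to the gauge integral, to which the fundamental theorem of calculus
  applies.\<close>

lemma integral_semicircle:
  assumes f: "continuous_on UNIV f"
  shows "integrable semicircle f"
    and "(\<integral>x. f x \<partial>semicircle) = integral {-2..2} (\<lambda>x. f x * sqrt (4 - x\<^sup>2)) / (2 * pi)"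
proof -
  have [measurable]: "f \<in> borel_measurable borel" using f by (rule borel_measurable_continuous_onI)
  have c: "continuous_on {-2..2} (\<lambda>x. f x * sqrt (4 - x\<^sup>2))"
    by (intro continuous_intros continuous_on_subset[OF f]) auto
  have i: "set_integrable lborel {-2..2} (\<lambda>x. f x * sqrt (4 - x\<^sup>2))"
    using borel_integrable_atLeastAtMost'[OF c] .
  have eq: "semi_density x * f x = 1 / (2 * pi) * (indicator {-2..2} x * (f x * sqrt (4 - x\<^sup>2)))" for x
    by (auto simp: semi_density_def indicator_def)
  show "integrable semicircle f"
    unfolding semicircle_eq
    by (subst integrable_real_density)
      (use i in \<open>simp_all add: eq semi_density_nonneg set_integrable_def\<close>)
  have "(\<integral>x. f x \<partial>semicircle) = (LBINT x. semi_density x * f x)"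
    unfolding semicircle_eq by (rule integral_real_density) (simp_all add: semi_density_nonneg)
  also have "\<dots> = (LBINT x:{-2..2}. f x * sqrt (4 - x\<^sup>2)) / (2 * pi)"
    unfolding eq set_lebesgue_integral_def by (subst integral_mult_right_zero) simp
  also have "(LBINT x:{-2..2}. f x * sqrt (4 - x\<^sup>2)) = integral {-2..2} (\<lambda>x. f x * sqrt (4 - x\<^sup>2))"
    by (rule set_borel_integral_eq_integral(2)[OF i])
  finally show "(\<integral>x. f x \<partial>semicircle) = integral {-2..2} (\<lambda>x. f x * sqrt (4 - x\<^sup>2)) / (2 * pi)" .
qed

text \<open>Under x = 2 cos t the integral becomes that of 4 sin ((h + 1) t) sin t over [0, pi], up
  to the factor 1 / (2 pi), and the sines are orthogonal there.\<close>

lemma integral_scaled_chebyshev: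
  "(\<integral>x. scaled_chebyshev h x \<partial>semicircle) = (if h = 0 then 1 else 0)"
proof -
  \<comment> \<open>An antiderivative of 4 sin ((h + 1) t) sin t = 2 (cos (h t) - cos ((h + 2) t));
    for h = 0 the first cosine is the constant 1.\<close>
  define \<Phi> where "\<Phi> t = (if h = 0 then 2 * t - sin (2 * t)
    else 2 * (sin (real h * t) / real h - sin (real (h + 2) * t) / real (h + 2)))" for t :: real
  have d\<Phi>: "(\<Phi> has_real_derivative 4 * sin (real (Suc h) * t) * sin t) (at t)" for t
  proof -
    have "4 * sin (real (Suc h) * t) * sin t = 2 * (cos (real h * t) - cos (real (h + 2) * t))"
      using sin_times_sin[of "real (Suc h) * t" t] by (simp add: algebra_simps)
    moreover have "(\<Phi> has_real_derivative 2 * (cos (real h * t) - cos (real (h + 2) * t))) (at t)"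
    proof (cases "h = 0")
      case True
      have "((\<lambda>t. 2 * t - sin (2 * t)) has_real_derivative 2 - 2 * cos (2 * t)) (at t)"
        by (auto intro!: derivative_eq_intros)
      then show ?thesis using True by (simp add: \<Phi>_def[abs_def])
    next
      case False
      have "((\<lambda>t. 2 * (sin (real h * t) / real h - sin (real (h + 2) * t) / real (h + 2))) has_real_derivative
          2 * (cos (real h * t) * real h / real h - cos (real (h + 2) * t) * real (h + 2) / real (h + 2))) (at t)"
        by (intro DERIV_cmult DERIV_diff DERIV_cdivide DERIV_chain2[OF DERIV_sin] DERIV_cmult_Id)
      then show ?thesis using False by (simp add: \<Phi>_def[abs_def])
    qed
    ultimately show ?thesis by simp
  qed
  have "((\<lambda>x. scaled_chebyshev h x * sqrt (4 - x\<^sup>2)) has_integral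
      (- \<Phi> (arccos (2 / 2)) - - \<Phi> (arccos (-2 / 2)))) {-2..2}"
  \<comment> \<open>\<open>arccos\<close> is continuous but not differentiable at the end points, so
    the derivative is asked for in the interior only.\<close>
  proof (rule fundamental_theorem_of_calculus_interior)
    show "continuous_on {-2..2} (\<lambda>x. - \<Phi> (arccos (x / 2)))"
    proof (rule continuous_on_minus, rule continuous_on_compose2[of UNIV \<Phi>])
      show "continuous_on UNIV \<Phi>"
        by (rule DERIV_continuous_on) (rule has_field_derivative_at_within[OF d\<Phi>])
      show "continuous_on {-2..2} (\<lambda>x :: real. arccos (x / 2))"
        by (rule continuous_on_arccos) (auto intro!: continuous_on_divide)
    qed simp
    fix x :: real assume x: "x \<in> {-2<..<2}"
    define t where "t = arccos (x / 2)"
    have ct: "cos t = x / 2" using x unfolding t_def by (intro cos_arccos) auto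
    have t: "0 < t" "t < pi" using arccos_lt_bounded[of "x / 2"] x by (auto simp: t_def)
    have st: "sin t > 0" using t by (rule sin_gt_zero)
    have x2: "x = 2 * cos t" using ct by simp
    have s: "sqrt (4 - x\<^sup>2) = 2 * sin t"
    proof -
      have "4 - x\<^sup>2 = (2 * sin t)\<^sup>2"
        unfolding x2 by (simp add: power_mult_distrib sin_squared_eq)
      then show ?thesis using st by (intro real_sqrt_unique) auto
    qed
    have s': "sqrt (1 - (x / 2)\<^sup>2) = sin t"
    proof -
      have "1 - (x / 2)\<^sup>2 = (sin t)\<^sup>2" unfolding x2 by (simp add: sin_squared_eq)
      then show ?thesis using st by (intro real_sqrt_unique) auto
    qed
    have "((\<lambda>x. - \<Phi> (arccos (x / 2))) has_real_derivative
        - (4 * sin (real (Suc h) * t) * sin t * (inverse (- sqrt (1 - (x / 2)\<^sup>2)) * (1 / 2)))) (at x)"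
      unfolding t_def
    proof (rule DERIV_minus, rule DERIV_chain2[OF d\<Phi>], rule DERIV_chain2[OF DERIV_arccos])
      show "((\<lambda>x. x / 2) has_real_derivative 1 / 2) (at x)" by (auto intro!: derivative_eq_intros)
    qed (use x in auto)
    also have "- (4 * sin (real (Suc h) * t) * sin t * (inverse (- sqrt (1 - (x / 2)\<^sup>2)) * (1 / 2))) = 2 * sin (real (Suc h) * t)"
      unfolding s' using st by (simp add: field_simps)
    also have "\<dots> = scaled_chebyshev h x * sqrt (4 - x\<^sup>2)"
      unfolding s using sin_scaled_chebyshev[of t h] x2 by (simp add: mult.commute)
    finally show "((\<lambda>x. - \<Phi> (arccos (x / 2))) has_vector_derivative scaled_chebyshev h x * sqrt (4 - x\<^sup>2)) (at x)"
      by (simp add: has_real_derivative_iff_has_vector_derivative)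
  qed simp
  also have "- \<Phi> (arccos (2 / 2)) - - \<Phi> (arccos (-2 / 2)) = (if h = 0 then 2 * pi else 0)"
    using sin_npi[of "h + 2"] by (simp add: \<Phi>_def)
  finally show ?thesis
    by (simp add: integral_semicircle(2)[OF continuous_scaled_chebyshev] integral_unique)
qed

lemma prob_space_semicircle: "prob_space semicircle"
proof
  have "integrable semicircle (\<lambda>x. 1 :: real)" by (rule integral_semicircle) simp
  then have "(\<integral>\<^sup>+x. ennreal 1 \<partial>semicircle) = ennreal (\<integral>x. 1 \<partial>semicircle)"
    by (rule nn_integral_eq_integral) simp
  also have "(\<integral>x. 1 \<partial>semicircle) = (1 :: real)"
    using integral_scaled_chebyshev[of 0] by (simp del: lebesgue_integral_const)
  finally show "emeasure semicircle (space semicircle) = 1" by simp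
qed

text \<open>Multiplication by x sends U_h(x/2) to U_(h+1)(x/2) + U_(h-1)(x/2), without the second
  term for h = 0. This is the recursion of \<open>path_count\<close>, and orthogonality to the
  constants is its start.\<close>

lemma semicircle_moment_chebyshev:
  "(\<integral>x. x ^ k * scaled_chebyshev h x \<partial>semicircle) = path_count k h"
proof (induction k arbitrary: h)
  case 0
  then show ?case using integral_scaled_chebyshev by simp
next
  case (Suc k)
  have int: "integrable semicircle (\<lambda>x. x ^ k * scaled_chebyshev h x)" for h
    by (intro integral_semicircle continuous_intros)
  have pt: "x ^ Suc k * scaled_chebyshev h x = x ^ k * scaled_chebyshev (Suc h) x +
      (if h = 0 then 0 else x ^ k * scaled_chebyshev (h - 1) x)" for x
    by (cases h) (auto simp: algebra_simps)
  have "(\<integral>x. x ^ Suc k * scaled_chebyshev h x \<partial>semicircle)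
     = (\<integral>x. x ^ k * scaled_chebyshev (Suc h) x + (if h = 0 then 0 else x ^ k * scaled_chebyshev (h - 1) x) \<partial>semicircle)"
    unfolding pt ..
  also have "\<dots> = path_count (Suc k) h"
    using Suc int by (cases "h = 0") (simp_all del: scaled_chebyshev.simps)
  finally show ?case .
qed

lemma semicircle_moment: "(\<integral>x. x ^ k \<partial>semicircle) = path_count k 0"
  using semicircle_moment_chebyshev[of k 0] by simp

text \<open>Moments of order 2 r stay below 4^r, so the tail weight (x/4)^(2 r) has semicircle
  integral at most 4^(-r).\<close>

lemma path_count_le: "path_count k h \<le> 2 ^ k"
proof (induction k arbitrary: h)
  case (Suc k)
  have "path_count k (Suc h) + (if h = 0 then 0 else path_count k (h - 1)) \<le> 2 ^ k + 2 ^ k"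
    by (intro add_mono Suc) (simp add: Suc)
  then show ?case by simp
qed simp

section \<open>Spectral moments and weak convergence\<close>

definition mat_trace :: "real mat \<Rightarrow> real" where
  "mat_trace A = (\<Sum>i<dim_row A. A $$ (i, i))"

text \<open>The characteristic polynomial splits over the complex numbers. For a root with
  eigenvector v, moving the real symmetric matrix across the product of v with its conjugate shows
  that the root equals its conjugate.\<close>

lemma real_symmetric_char_poly:
  fixes A :: "real mat"
  assumes A: "A \<in> carrier_mat n n" and sym: "transpose_mat A = A"
  shows "\<exists>es. char_poly A = (\<Prod>e\<leftarrow>es. [:- e, 1:]) \<and> length es = n"
proof -
  define B where "B = map_mat complex_of_real A"
  have B: "B \<in> carrier_mat n n" using A by (simp add: B_def)
  have symB: "transpose_mat B = B" using sym by (metis B_def map_mat_transpose)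
  obtain as where as: "char_poly B = (\<Prod>a\<leftarrow>as. [:- a, 1:])" "length as = n"
    using char_poly_factorized[OF B] by blast
  have real: "a \<in> \<real>" if "a \<in> set as" for a
  proof -
    have "poly (char_poly B) a = 0"
      unfolding as(1) poly_prod_list using that by (auto simp: prod_list_zero_iff)
    then obtain v where v: "v \<in> carrier_vec n" "v \<noteq> 0\<^sub>v n" "B *\<^sub>v v = a \<cdot>\<^sub>v v"
      using eigenvalue_root_char_poly[OF B, of a] B by (auto simp: eigenvalue_def eigenvector_def)
    have cv: "conjugate v \<in> carrier_vec n" using v by simp
    have cB: "B *\<^sub>v conjugate v = conjugate (B *\<^sub>v v)"
    proof (rule eq_vecI)
      fix i assume "i < dim_vec (conjugate (B *\<^sub>v v))"
      then have i: "i < n" using B by simp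
      have "(B *\<^sub>v conjugate v) $ i = (\<Sum>j\<in>{0..<n}. complex_of_real (A $$ (i, j)) * cnj (v $ j))"
        using i B A v(1) by (auto simp: scalar_prod_def B_def intro!: sum.cong)
      also have "\<dots> = cnj (\<Sum>j\<in>{0..<n}. complex_of_real (A $$ (i, j)) * v $ j)"
        by simp
      also have "(\<Sum>j\<in>{0..<n}. complex_of_real (A $$ (i, j)) * v $ j) = (B *\<^sub>v v) $ i"
        using i B A v(1) by (auto simp: scalar_prod_def B_def intro!: sum.cong)
      finally show "(B *\<^sub>v conjugate v) $ i = conjugate (B *\<^sub>v v) $ i"
        using i B by simp
    qed (use B in auto)
    have "a * (v \<bullet>c v) = (B *\<^sub>v v) \<bullet>c v" using v cv by simp
    also have "\<dots> = v \<bullet> (B *\<^sub>v conjugate v)"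
      using transpose_vec_mult_scalar[OF B cv v(1)] symB by simp
    also have "\<dots> = v \<bullet> (cnj a \<cdot>\<^sub>v conjugate v)"
      unfolding cB v(3) by (simp add: conjugate_smult_vec)
    also have "\<dots> = cnj a * (v \<bullet>c v)" using v cv by simp
    finally have "a = cnj a" using conjugate_square_eq_0_vec[OF v(1)] v(2) by simp
    then show ?thesis by (metis Reals_cnj_iff)
  qed
  define es where "es = map Re as"
  have "map (\<lambda>x. complex_of_real (Re x)) as = map id as"
    by (rule map_cong) (use real in \<open>auto simp: of_real_Re\<close>)
  then have as': "as = map complex_of_real es" by (simp add: es_def comp_def)
  interpret mh: map_poly_inj_idom_hom complex_of_real ..
  \<comment> \<open>All roots being real, the complex factorisation is the image of a real one, and
    the embedding of polynomials is injective.\<close>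
  have "map_poly complex_of_real (char_poly A) = char_poly B"
    unfolding B_def by (rule of_real_hom.char_poly_hom[OF A, symmetric])
  also have "\<dots> = map_poly complex_of_real (\<Prod>e\<leftarrow>es. [:- e, 1:])"
    unfolding as(1) as' by (induction es) (auto simp: mh.hom_mult simp del: mult_pCons_left mult_pCons_right)
  finally have "char_poly A = (\<Prod>e\<leftarrow>es. [:- e, 1:])"
    by (simp only: mh.eq_iff)
  then show ?thesis using as(2) by (intro exI[of _ es]) (simp add: es_def)
qed

lemma upper_triangular_mult:
  fixes U V :: "real mat"
  assumes U: "U \<in> carrier_mat n n" "upper_triangular U" and V: "V \<in> carrier_mat n n" "upper_triangular V"
  shows "upper_triangular (U * V)" and "i < n \<Longrightarrow> (U * V) $$ (i, i) = U $$ (i, i) * V $$ (i, i)"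
proof -
  have z: "U $$ (i, j) = 0" "V $$ (i, j) = 0" if "j < i" "i < n" for i j
    using that U V by (auto simp: upper_triangular_def)
  have e: "(U * V) $$ (i, j) = (\<Sum>l\<in>{0..<n}. U $$ (i, l) * V $$ (l, j))" if "i < n" "j < n" for i j
    using that U V by (auto simp: scalar_prod_def)
  show "upper_triangular (U * V)"
  proof
    fix i j assume ij: "j < i" "i < dim_row (U * V)"
    then have i: "i < n" "j < n" using U by auto
    show "(U * V) $$ (i, j) = 0"
      unfolding e[OF i]
    proof (rule sum.neutral, intro ballI)
      fix l assume "l \<in> {0..<n}"
      then show "U $$ (i, l) * V $$ (l, j) = 0"
        using z(1)[of l i] z(2)[of j l] ij i by (cases "l < i") auto
    qed
  qed
  assume i: "i < n"
  have "U $$ (i, l) * V $$ (l, i) = (if l = i then U $$ (i, i) * V $$ (i, i) else 0)" if "l \<in> {0..<n}" for l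
    using z(1)[of l i] z(2)[of i l] that i by (cases "l < i"; cases "i < l") auto
  then have "(\<Sum>l\<in>{0..<n}. U $$ (i, l) * V $$ (l, i)) = (\<Sum>l\<in>{0..<n}. if l = i then U $$ (i, i) * V $$ (i, i) else 0)"
    by (rule sum.cong[OF refl])
  then show "(U * V) $$ (i, i) = U $$ (i, i) * V $$ (i, i)"
    unfolding e[OF i i] using i by (simp only: sum.delta) simp
qed

lemma trace_mult_commute:
  fixes A B :: "real mat"
  assumes "A \<in> carrier_mat n m" "B \<in> carrier_mat m n"
  shows "mat_trace (A * B) = mat_trace (B * A)"
proof -
  have "mat_trace (A * B) = (\<Sum>i<n. \<Sum>j<m. A $$ (i, j) * B $$ (j, i))"
    using assms by (auto simp: mat_trace_def scalar_prod_def lessThan_atLeast0 intro!: sum.cong)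
  also have "\<dots> = (\<Sum>j<m. \<Sum>i<n. B $$ (j, i) * A $$ (i, j))"
    by (subst sum.swap) (simp add: mult.commute)
  also have "\<dots> = mat_trace (B * A)"
    using assms by (auto simp: mat_trace_def scalar_prod_def lessThan_atLeast0 intro!: sum.cong)
  finally show ?thesis .
qed

text \<open>Triangularise: the diagonal of \<open>B\<close> consists of the eigenvalues, that of the
  k-th power of \<open>B\<close> of their k-th powers, and cyclicity of the trace removes the
  similarity.\<close>

lemma eigenvalue_list_moments:
  assumes A: "A \<in> carrier_mat n n" and sym: "transpose_mat A = A"
  shows "length (eigenvalue_list A) = n"
    and "(\<Sum>x\<leftarrow>eigenvalue_list A. x ^ k) = mat_trace (A ^\<^sub>m k)"
proof -
  obtain es where es: "char_poly A = (\<Prod>e\<leftarrow>es. [:- e, 1:])" "length es = n"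
    using real_symmetric_char_poly[OF A sym] by blast
  obtain B where B: "B \<in> carrier_mat n n" "upper_triangular B" "similar_mat A B"
    using schur_decomposition_exists[OF A es(1)] by blast
  have cp: "char_poly A = (\<Prod>e\<leftarrow>diag_mat B. [:- e, 1:])"
    using char_poly_similar[OF B(3)] char_poly_upper_triangular[OF B(1,2)] by simp
  have pr: "proots (\<Prod>e\<leftarrow>ds. [:- e, 1:]) = mset ds" for ds :: "real list"
  proof (induction ds)
    case (Cons d ds)
    have "(\<Prod>e\<leftarrow>ds. [:- e, 1:]) \<noteq> 0" by (auto simp: prod_list_zero_iff)
    then have "proots ([:- d, 1:] * (\<Prod>e\<leftarrow>ds. [:- e, 1:])) = proots [:- d, 1:] + mset ds"
      using Cons by (subst proots_mult) auto
    then show ?case by (simp only: list.map prod_list.Cons proots_linear_factor) simp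
  qed simp
  \<comment> \<open>Sorting changes only the order, and sums of powers depend on the multiset
    alone.\<close>
  have ms: "mset (eigenvalue_list A) = mset (diag_mat B)"
    unfolding eigenvalue_list_def cp pr by simp
  have "length (diag_mat B) = n" using B by (simp add: diag_mat_def)
  then show "length (eigenvalue_list A) = n" using ms by (metis size_mset)
  have up: "upper_triangular (B ^\<^sub>m k) \<and> (\<forall>i<n. (B ^\<^sub>m k) $$ (i, i) = (B $$ (i, i)) ^ k)" for k
  proof (induction k)
    case 0
    then show ?case using B by auto
  next
    case (Suc k)
    then show ?case
      using upper_triangular_mult[of "B ^\<^sub>m k" n B] B by (auto simp: mult.commute)
  qed
  obtain P Q where wit: "similar_mat_wit A B P Q" using B(3) by (auto simp: similar_mat_def)
  note w = similar_mat_witD2[OF A wit]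
  have "A ^\<^sub>m k = P * (B ^\<^sub>m k * Q)"
    using similar_mat_wit_pow_id[OF wit, of k] w pow_carrier_mat[OF B(1), of k] by (simp add: assoc_mult_mat)
  moreover have "B ^\<^sub>m k * Q \<in> carrier_mat n n"
    using w pow_carrier_mat[OF B(1), of k] by (intro mult_carrier_mat[of _ n n]) auto
  ultimately have "mat_trace (A ^\<^sub>m k) = mat_trace ((B ^\<^sub>m k * Q) * P)"
    using w trace_mult_commute[of P n n "B ^\<^sub>m k * Q"] by metis
  also have "(B ^\<^sub>m k * Q) * P = B ^\<^sub>m k"
    using w pow_carrier_mat[OF B(1), of k] by (simp add: assoc_mult_mat[of _ n n])
  also have "mat_trace (B ^\<^sub>m k) = (\<Sum>i<n. (B $$ (i, i)) ^ k)"
    using up[of k] B by (auto simp: mat_trace_def intro!: sum.cong)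
  also have "\<dots> = (\<Sum>x\<leftarrow>diag_mat B. x ^ k)"
    using B by (simp add: diag_mat_def comp_def interv_sum_list_conv_sum_set_nat atLeast0LessThan)
  also have "\<dots> = (\<Sum>x\<leftarrow>eigenvalue_list A. x ^ k)"
  proof -
    have "sum_list (map f xs) = sum_mset (image_mset f (mset xs))" for f :: "real \<Rightarrow> real" and xs
      by (simp flip: sum_mset_sum_list)
    then show ?thesis using ms by simp
  qed
  finally show "(\<Sum>x\<leftarrow>eigenvalue_list A. x ^ k) = mat_trace (A ^\<^sub>m k)" ..
qed

section \<open>From moments to weak convergence\<close>

definition average :: "(real \<Rightarrow> real) \<Rightarrow> real list \<Rightarrow> real" where
  "average f xs = (\<Sum>x\<leftarrow>xs. f x) / real (length xs)"

lemma integral_esd: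
  assumes A: "A \<in> carrier_mat n n" "transpose_mat A = A" and n: "n \<ge> 1"
    and [measurable]: "f \<in> borel_measurable borel"
  shows "(LINT x|esd A. f x) = average f (eigenvalue_list A)"
proof -
  have len: "length (eigenvalue_list A) = n" by (rule eigenvalue_list_moments[OF A])
  have [measurable]: "(\<lambda>i. eigenvalue_list A ! i) \<in> measurable (uniform_count_measure {..<n}) borel"
    by (subst measurable_cong_sets[OF sets_uniform_count_measure_count_space refl]) simp
  have "(LINT x|esd A. f x) = (LINT i|uniform_count_measure {..<n}. f (eigenvalue_list A ! i))"
    unfolding esd_def using A by (subst integral_distr) auto
  also have "\<dots> = (\<Sum>i<n. f (eigenvalue_list A ! i)) / real n"
    by (simp add: integral_uniform_count_measure)
  also have "(\<Sum>i<n. f (eigenvalue_list A ! i)) = (\<Sum>x\<leftarrow>eigenvalue_list A. f x)"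
    by (simp add: sum_list_sum_nth len atLeast0LessThan)
  finally show ?thesis by (simp add: average_def len)
qed

lemma average_add: "average (\<lambda>x. f x + g x) xs = average f xs + average g xs"
  by (simp add: average_def sum_list_addf add_divide_distrib)

lemma average_cmult: "average (\<lambda>x. c * f x) xs = c * average f xs"
  by (simp add: average_def sum_list_const_mult)

lemma average_const: "xs \<noteq> [] \<Longrightarrow> average (\<lambda>x. c) xs = c"
  by (simp add: average_def sum_list_triv)

lemma average_mono: "(\<And>x. x \<in> set xs \<Longrightarrow> f x \<le> g x) \<Longrightarrow> average f xs \<le> average g xs"
  unfolding average_def by (intro divide_right_mono sum_list_mono) auto

lemma average_sum: "average (\<lambda>x. \<Sum>i\<in>I. f i x) xs = (\<Sum>i\<in>I. average (f i) xs)"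
  by (induction I rule: infinite_finite_induct) (auto simp: average_add, auto simp: average_def)

lemma average_diff_le:
  assumes "\<And>x. x \<in> set xs \<Longrightarrow> \<bar>f x - g x\<bar> \<le> h x"
  shows "\<bar>average f xs - average g xs\<bar> \<le> average h xs"
proof -
  have "average f xs \<le> average (\<lambda>x. g x + h x) xs"
    by (rule average_mono) (use assms in fastforce)
  moreover have "average g xs \<le> average (\<lambda>x. f x + h x) xs"
    by (rule average_mono) (use assms in fastforce)
  ultimately show ?thesis by (simp add: average_add)
qed

text \<open>Eigenvalues lie in no fixed interval, so Weierstrass on [-4, 4] is supplemented by a
  bound outside: there |x| / 4 \<ge> 1, and an even power of exponent at least n dominates both f
  and the polynomial. The constant \<open>C\<close> does not depend on \<open>r\<close>, which can
  therefore still be chosen large.\<close>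

lemma polynomial_approximation_tail:
  fixes f :: "real \<Rightarrow> real"
  assumes f: "continuous_on UNIV f" "bounded (range f)" and "\<eta> > 0"
  obtains a :: "nat \<Rightarrow> real" and n C where "C \<ge> 0"
    "\<And>r x. 2 * r \<ge> n \<Longrightarrow> \<bar>f x - (\<Sum>i\<le>n. a i * x ^ i)\<bar> \<le> \<eta> + C * (x / 4) ^ (2 * r)"
proof -
  obtain g where g: "real_polynomial_function g" "\<And>x. x \<in> {-4..4} \<Longrightarrow> \<bar>f x - g x\<bar> < \<eta>"
    using Stone_Weierstrass_real_polynomial_function[of "{-4..4}" f \<eta>] f(1) \<open>\<eta> > 0\<close>
    by (metis compact_Icc continuous_on_subset subset_UNIV)
  obtain a n where an: "g = (\<lambda>x. \<Sum>i\<le>n. a i * x ^ i)"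
    using g(1) unfolding real_polynomial_function_iff_sum by blast
  obtain K where K: "\<And>x. \<bar>f x\<bar> \<le> K" using f(2) by (auto simp: bounded_iff)
  have K0: "K \<ge> 0" using K[of 0] by simp
  define P where "P = (\<Sum>i\<le>n. \<bar>a i\<bar>)"
  have P0: "P \<ge> 0" by (simp add: P_def sum_nonneg)
  \<comment> \<open>With y = |x| / 4 \<ge> 1 outside the interval, K + P |x|^n is at most (K + P)
    |x|^n = (K + P) 4^n y^n.\<close>
  define C where "C = (K + P) * 4 ^ n"
  have "\<bar>f x - (\<Sum>i\<le>n. a i * x ^ i)\<bar> \<le> \<eta> + C * (x / 4) ^ (2 * r)" if r: "2 * r \<ge> n" for r x
  proof (cases "x \<in> {-4..4}")
    case True
    have "0 \<le> C * (x / 4) ^ (2 * r)" using K0 P0 by (auto simp: C_def power_mult)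
    then show ?thesis using g(2)[OF True] by (simp add: an)
  next
    case False
    define y where "y = \<bar>x\<bar> / 4"
    have y: "y \<ge> 1" "\<bar>x\<bar> = 4 * y" using False by (auto simp: y_def)
    have "\<bar>\<Sum>i\<le>n. a i * x ^ i\<bar> \<le> (\<Sum>i\<le>n. \<bar>a i\<bar> * \<bar>x\<bar> ^ n)"
    proof (rule order_trans[OF sum_abs], rule sum_mono)
      fix i assume "i \<in> {..n}"
      then have "\<bar>x\<bar> ^ i \<le> \<bar>x\<bar> ^ n" using y by (intro power_increasing) auto
      then show "\<bar>a i * x ^ i\<bar> \<le> \<bar>a i\<bar> * \<bar>x\<bar> ^ n"
        by (simp add: abs_mult power_abs mult_left_mono)
    qed
    then have "\<bar>f x - (\<Sum>i\<le>n. a i * x ^ i)\<bar> \<le> K + P * \<bar>x\<bar> ^ n"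
      using K[of x] by (simp add: P_def sum_distrib_right)
    also have "K \<le> K * \<bar>x\<bar> ^ n" 
    proof -
      have "1 \<le> \<bar>x\<bar> ^ n" using y by (intro one_le_power) auto
      then show ?thesis using K0 mult_left_mono[of 1 "\<bar>x\<bar> ^ n" K] by simp
    qed
    also have "K * \<bar>x\<bar> ^ n + P * \<bar>x\<bar> ^ n = C * y ^ n"
      by (simp add: C_def y(2) power_mult_distrib algebra_simps)
    also have "\<dots> \<le> C * y ^ (2 * r)"
      using y r K0 P0 by (intro mult_left_mono power_increasing) (auto simp: C_def)
    also have "y ^ (2 * r) = (x / 4) ^ (2 * r)" by (simp add: y_def power_mult power_divide)
    finally show ?thesis using \<open>\<eta> > 0\<close> by simp
  qed
  moreover have "C \<ge> 0" using K0 P0 by (simp add: C_def)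
  ultimately show ?thesis using that by blast
qed

lemma integrable_power_semicircle [simp]: "integrable semicircle (\<lambda>x. x ^ k)"
  by (intro integral_semicircle continuous_intros)

text \<open>The interval has twice the radius of the support of the limit, so the tail term has
  integral of order 4^(-r) against the semicircle and, since the moment of order 2 r is close,
  against the average too. Stated for a single list, finitely many moments and a tolerance, it
  serves both modes of convergence.\<close>

lemma moments_imp_weak:
  fixes f :: "real \<Rightarrow> real"
  assumes f: "continuous_on UNIV f" "bounded (range f)" and "\<epsilon> > 0"
  obtains N \<delta> where "\<delta> > 0"
    "\<And>xs. xs \<noteq> [] \<Longrightarrow> (\<And>k. k \<le> N \<Longrightarrow> \<bar>average (\<lambda>x. x ^ k) xs - path_count k 0\<bar> \<le> \<delta>) \<Longrightarrow>
      \<bar>average f xs - (LINT x|semicircle. f x)\<bar> \<le> \<epsilon>"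
proof -
  interpret S: prob_space semicircle by (rule prob_space_semicircle)
  \<comment> \<open>Five portions: two for replacing f by the polynomial under the semicircle, two
    for doing so under the average, and one for the difference of the polynomial's
    integrals.\<close>
  define \<eta> where "\<eta> = \<epsilon> / 5"
  have \<eta>: "\<eta> > 0" using \<open>\<epsilon> > 0\<close> by (simp add: \<eta>_def)
  obtain a :: "nat \<Rightarrow> real" and n C where C: "C \<ge> 0"
    and ap: "\<And>r x. 2 * r \<ge> n \<Longrightarrow> \<bar>f x - (\<Sum>i\<le>n. a i * x ^ i)\<bar> \<le> \<eta> + C * (x / 4) ^ (2 * r)"
    using polynomial_approximation_tail[OF f \<eta>] by metis
  have "(\<lambda>r. C * 2 * (1 / 4) ^ r) \<longlonglongrightarrow> C * 2 * 0"
    by (intro tendsto_mult LIMSEQ_realpow_zero tendsto_const) auto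
  then have "eventually (\<lambda>r. C * 2 * (1 / 4) ^ r < \<eta>) sequentially"
    using \<eta> by (intro order_tendstoD(2)[of _ 0]) auto
  then obtain r0 where r0: "\<And>r. r \<ge> r0 \<Longrightarrow> C * 2 * (1 / 4) ^ r < \<eta>"
    by (auto simp: eventually_sequentially)
  define r where "r = max r0 n"
  have r: "2 * r \<ge> n" "C * 2 * (1 / 4) ^ r < \<eta>" using r0 by (auto simp: r_def)
  define P where "P = (\<Sum>i\<le>n. \<bar>a i\<bar>)"
  have P0: "P \<ge> 0" by (simp add: P_def sum_nonneg)
  define p where "p x = (\<Sum>i\<le>n. a i * x ^ i)" for x
  define h where "h x = \<eta> + C * (1 / 4) ^ (2 * r) * x ^ (2 * r)" for x
  have fp: "\<bar>f x - p x\<bar> \<le> h x" for x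
    using ap[OF r(1), of x] by (simp add: p_def h_def power_divide)
  \<comment> \<open>The bound 1 keeps the moment of order 2 r below 4^r + 1; the other bound
    controls the moment errors weighted by the coefficients, and P + 1 avoids division by 0.\<close>
  define \<delta> where "\<delta> = min 1 (\<eta> / (P + 1))"
  have \<delta>: "\<delta> > 0" "\<delta> \<le> 1" using \<eta> P0 by (auto simp: \<delta>_def)
  have P\<delta>: "P * \<delta> \<le> \<eta>"
  proof -
    have "P * \<delta> \<le> (P + 1) * (\<eta> / (P + 1))" using P0 \<eta> by (intro mult_mono) (auto simp: \<delta>_def)
    then show ?thesis using P0 by simp
  qed
  have hb: "\<eta> + C * (1 / 4) ^ (2 * r) * m \<le> 2 * \<eta>" if "m \<le> 4 ^ r + 1" for m
  proof -
    have "m \<le> 2 * 4 ^ r" using that one_le_power[of "4::real" r] by linarith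
    then have "C * (1 / 4) ^ (2 * r) * m \<le> C * (1 / 4) ^ (2 * r) * (2 * 4 ^ r)"
      using C by (intro mult_left_mono) auto
    also have "\<dots> = C * 2 * (1 / 4) ^ r"
    proof -
      define u v :: real where "u = (1 / 4) ^ r" and "v = 4 ^ r"
      have uv: "u * v = 1" by (simp add: u_def v_def power_one_over)
      have "(1 / 4) ^ (2 * r) = u * u" by (simp only: mult_2 power_add u_def)
      then have "C * (1 / 4) ^ (2 * r) * (2 * 4 ^ r) = C * 2 * u * (u * v)" by (simp add: v_def)
      then show ?thesis unfolding uv by (simp add: u_def)
    qed
    finally show ?thesis using r(2) by simp
  qed
  have pc: "path_count (2 * r) 0 \<le> 4 ^ r" using path_count_le[of "2 * r" 0] by (simp add: power_mult)
  have intf: "integrable semicircle f" using f(1) by (rule integral_semicircle)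
  have intp: "integrable semicircle p" unfolding p_def by (intro integral_semicircle continuous_intros)
  have inth: "integrable semicircle h" unfolding h_def by (intro integral_semicircle continuous_intros)
  have ip: "(LINT x|semicircle. p x) = (\<Sum>i\<le>n. a i * path_count i 0)"
    unfolding p_def by (subst Bochner_Integration.integral_sum) (auto simp: semicircle_moment)
  have "\<bar>(LINT x|semicircle. f x) - (LINT x|semicircle. p x)\<bar> \<le> (LINT x|semicircle. h x)"
  proof -
    have "\<bar>(LINT x|semicircle. f x - p x)\<bar> \<le> (LINT x|semicircle. h x)"
      by (rule order_trans[OF integral_abs_bound]) (intro integral_mono fp integrable_abs Bochner_Integration.integrable_diff intf intp inth)
    then show ?thesis using intf intp by simp
  qed
  also have "(LINT x|semicircle. h x) = \<eta> + C * (1 / 4) ^ (2 * r) * path_count (2 * r) 0"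
    unfolding h_def by (simp add: semicircle_moment S.prob_space)
  also have "\<dots> \<le> 2 * \<eta>" by (rule hb) (use pc in simp)
  finally have A: "\<bar>(LINT x|semicircle. f x) - (LINT x|semicircle. p x)\<bar> \<le> 2 * \<eta>" .
  have "\<bar>average f xs - (LINT x|semicircle. f x)\<bar> \<le> \<epsilon>"
    if xs: "xs \<noteq> []" and mom: "\<And>k. k \<le> max n (2 * r) \<Longrightarrow> \<bar>average (\<lambda>x. x ^ k) xs - path_count k 0\<bar> \<le> \<delta>" for xs
  proof -
    have "\<bar>average f xs - average p xs\<bar> \<le> average h xs" by (rule average_diff_le) (rule fp)
    also have "average h xs = \<eta> + C * (1 / 4) ^ (2 * r) * average (\<lambda>x. x ^ (2 * r)) xs"
      unfolding h_def average_add average_cmult average_const[OF xs] ..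
    also have "\<dots> \<le> 2 * \<eta>" by (rule hb) (use mom[of "2 * r"] pc \<delta> in auto)
    finally have B: "\<bar>average f xs - average p xs\<bar> \<le> 2 * \<eta>" .
    have "average p xs - (LINT x|semicircle. p x) = (\<Sum>i\<le>n. a i * (average (\<lambda>x. x ^ i) xs - path_count i 0))"
      unfolding ip p_def average_sum average_cmult by (simp add: sum_subtractf algebra_simps semicircle_moment)
    also have "\<bar>\<dots>\<bar> \<le> (\<Sum>i\<le>n. \<bar>a i\<bar> * \<delta>)"
      by (rule order_trans[OF sum_abs]) (intro sum_mono, simp add: abs_mult mom mult_left_mono)
    also have "\<dots> = P * \<delta>" by (simp add: P_def sum_distrib_right)
    finally have "\<bar>average p xs - (LINT x|semicircle. p x)\<bar> \<le> \<eta>" using P\<delta> by simp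
    then show ?thesis using A B \<eta>_def by linarith
  qed
  then show ?thesis using that[OF \<delta>(1)] by blast
qed

text \<open>A walk grows at its head while the power grows by a factor on the right, so the row
  index is the last vertex and the column index the head. Symmetry of \<open>R\<close> lets the new
  step be read in either direction.\<close>

lemma pow_mat_walks:
  fixes g :: "nat set \<Rightarrow> real" and c :: real and n :: nat
  assumes "j < n" "i < n" and "symp R"
  defines "A \<equiv> Matrix.mat n n (\<lambda>(i, j). if R i j then c * g {i, j} else 0)"
  shows "(A ^\<^sub>m k) $$ (i, j) =
    (\<Sum>w\<in>walks n R k. if last w = i \<and> hd w = j then c ^ k * (\<Prod>e\<leftarrow>path_edges w. g e) else 0)"
  using \<open>j < n\<close>
proof (induction k arbitrary: j)
  case 0
  have "(\<Sum>w\<in>walks n R 0. if last w = i \<and> hd w = j then c ^ 0 * (\<Prod>e\<leftarrow>path_edges w. g e) else 0)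
     = (\<Sum>x<n. if x = i \<and> x = j then 1 else 0)"
    unfolding walks_0 by (subst sum.reindex) (auto simp: inj_on_def intro!: sum.cong)
  also have "\<dots> = (\<Sum>x<n. if x = i then if i = j then 1 else 0 else 0)"
    by (intro sum.cong) auto
  finally show ?case using assms(2) 0 by (simp add: A_def)
next
  case (Suc k)
  have A: "A \<in> carrier_mat n n" by (simp add: A_def)
  define T where "T w = c ^ k * (\<Prod>e\<leftarrow>path_edges w. g e)" for w :: "nat list"
  have "(A ^\<^sub>m Suc k) $$ (i, j) = (\<Sum>l<n. (A ^\<^sub>m k) $$ (i, l) * A $$ (l, j))"
    using A pow_carrier_mat[OF A, of k] assms(2) Suc.prems by (simp add: scalar_prod_def lessThan_atLeast0)
  also have "\<dots> = (\<Sum>l<n. \<Sum>w\<in>walks n R k. if hd w = l then (if last w = i then T w * A $$ (l, j) else 0) else 0)"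
    by (intro sum.cong) (auto simp: Suc.IH T_def sum_distrib_right intro!: sum.cong)
  also have "\<dots> = (\<Sum>w\<in>walks n R k. if last w = i then T w * A $$ (hd w, j) else 0)"
    by (subst sum.swap) (auto intro!: sum.cong dest: hd_walk)
  also have "\<dots> = (\<Sum>w\<in>walks n R k. if last w = i \<and> R j (hd w) then T w * (c * g {j, hd w}) else 0)"
    using assms(3) Suc.prems by (intro sum.cong) (auto simp: A_def hd_walk insert_commute dest: sympD)
  also have "\<dots> = (\<Sum>w\<in>walks n R k. \<Sum>y | y < n \<and> R y (hd w). if y = j then (if last w = i then T w * (c * g {j, hd w}) else 0) else 0)"
    using Suc.prems by (intro sum.cong) auto
  also have "\<dots> = (\<Sum>w\<in>walks n R (Suc k). if last w = i \<and> hd w = j then c ^ Suc k * (\<Prod>e\<leftarrow>path_edges w. g e) else 0)"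
    unfolding sum_walks_Suc by (intro sum.cong) (auto simp: T_def path_edges_Cons hd_walk)
  finally show ?case .
qed

lemma trace_pow_walks:
  fixes g :: "nat set \<Rightarrow> real" and c :: real and n :: nat
  assumes "symp R"
  defines "A \<equiv> Matrix.mat n n (\<lambda>(i, j). if R i j then c * g {i, j} else 0)"
  shows "mat_trace (A ^\<^sub>m k) =
    c ^ k * (\<Sum>w | w \<in> walks n R k \<and> hd w = last w. \<Prod>e\<leftarrow>path_edges w. g e)"
proof -
  have "mat_trace (A ^\<^sub>m k) = (\<Sum>i<n. (A ^\<^sub>m k) $$ (i, i))"
    by (simp add: mat_trace_def A_def)
  also have "\<dots> = (\<Sum>i<n. \<Sum>w\<in>walks n R k. if hd w = i then (if last w = hd w then c ^ k * (\<Prod>e\<leftarrow>path_edges w. g e) else 0) else 0)"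
    unfolding A_def by (intro sum.cong refl, subst pow_mat_walks) (auto simp: assms(1) intro!: sum.cong)
  also have "\<dots> = (\<Sum>w\<in>walks n R k. if last w = hd w then c ^ k * (\<Prod>e\<leftarrow>path_edges w. g e) else 0)"
    by (subst sum.swap) (auto intro!: sum.cong dest: hd_walk)
  also have "\<dots> = c ^ k * (\<Sum>w | w \<in> walks n R k \<and> hd w = last w. \<Prod>e\<leftarrow>path_edges w. g e)"
    unfolding sum_distrib_left by (subst sum.inter_filter[symmetric]) (auto intro!: sum.cong)
  finally show ?thesis .
qed

section \<open>Expected moments of band matrices\<close>

lemma bandwidth_bounds: "n \<ge> 1 \<Longrightarrow> bandwidth n b \<Longrightarrow> 1 \<le> b \<and> b \<le> n"
  by (auto simp: bandwidth_def)

lemma symp_relevant: "symp (relevant n b)"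
  by (rule sympI) (auto simp: relevant_def abs_minus_commute)

text \<open>For b = 2 m + 1 < n the relevant indices are the residues from x - m to x + m modulo n.
  Periodicity makes the relation regular: every vertex has the same degree b.\<close>

lemma card_relevant:
  assumes "bandwidth n b" "x < n"
  shows "card {y. y < n \<and> relevant n b y x} = b"
proof (cases "b = n")
  case True
  then have "{y. y < n \<and> relevant n b y x} = {..<n}" by (auto simp: relevant_def)
  then show ?thesis using True by simp
next
  case False
  then have "odd b" "b < n" using assms(1) by (auto simp: bandwidth_def)
  then obtain m where b: "b = 2 * m + 1" "2 * m + 1 < n" by (elim oddE) auto
  have rel: "relevant n b y x \<longleftrightarrow> (y \<le> x + m \<and> x \<le> y + m) \<or> n + x \<le> y + m \<or> n + y \<le> x + m" for y
    using False b by (auto simp: relevant_def abs_if)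
  \<comment> \<open>The summand \<open>n\<close> keeps the subtraction of \<open>m\<close> within
    the natural numbers.\<close>
  define s where "s d = (x + n - m + d) mod n" for d
  have "{y. y < n \<and> relevant n b y x} = s ` {..<b}"
  proof (intro equalityI subsetI)
    fix y assume "y \<in> {y. y < n \<and> relevant n b y x}"
    then have y: "y < n" and "(y \<le> x + m \<and> x \<le> y + m) \<or> n + x \<le> y + m \<or> n + y \<le> x + m"
      using rel by auto
    \<comment> \<open>\<open>y\<close> lies in the window directly, after wrapping below 0, or after
      wrapping beyond n - 1; the value before reduction is y + n, y or y + 2 n.\<close>
    then consider "y \<le> x + m" "x \<le> y + m" | "n + x \<le> y + m" | "n + y \<le> x + m" by blast
    then show "y \<in> s ` {..<b}"
    proof cases
      case 1
      then have "x + n - m + (y + m - x) = y + n" using b by simp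
      then have "s (y + m - x) = y" using y by (simp add: s_def)
      moreover have "y + m - x < b" using 1 b by simp
      ultimately show ?thesis by force
    next
      case 2
      then have "x + n - m + (y + m - x - n) = y" using b by simp
      then have "s (y + m - x - n) = y" using y by (simp add: s_def)
      moreover have "y + m - x - n < b" using y b by simp
      ultimately show ?thesis by force
    next
      case 3
      then have "x + n - m + (y + m + n - x) = y + 2 * n" using b assms(2) by simp
      then have "s (y + m + n - x) = y" using y by (simp add: s_def)
      moreover have "y + m + n - x < b" using 3 b by simp
      ultimately show ?thesis by force
    qed
  next
    fix y assume "y \<in> s ` {..<b}"
    then obtain d where d: "d < b" "y = s d" by auto
    have yn: "y < n" using d assms(2) by (simp add: s_def)
    let ?u = "x + n - m + d"
    consider "?u < n" | "n \<le> ?u" "?u < 2 * n" | "2 * n \<le> ?u" "?u < 3 * n"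
      using d b assms(2) by linarith
    then have "relevant n b y x"
    proof cases
      case 1
      then have "y = ?u" using d by (simp add: s_def)
      then show ?thesis using rel b by simp
    next
      case 2
      then have "y = ?u - n" using d by (simp add: s_def le_mod_geq)
      then show ?thesis using rel b d 2 by auto
    next
      case 3
      then have "y = ?u - n - n" using d by (simp add: s_def le_mod_geq)
      then show ?thesis using rel b d 3 by auto
    qed
    then show "y \<in> {y. y < n \<and> relevant n b y x}" using yn by simp
  qed
  moreover have "inj_on s {..<b}"
  proof (rule inj_onI)
    have le: "d = e" if "d \<le> e" "e < n" "s d = s e" for d e
    proof -
      have "n dvd (x + n - m + e) - (x + n - m + d)"
        using that mod_eq_dvd_iff_nat[of "x + n - m + d" "x + n - m + e" n] by (simp add: s_def)
      then have "n dvd e - d" by simp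
      then show ?thesis using that by (auto dest: dvd_imp_le)
    qed
    fix d e assume "d \<in> {..<b}" "e \<in> {..<b}" and "s d = s e"
    then show "d = e" using le[of d e] le[of e d] b by (cases "d \<le> e") auto
  qed
  ultimately show ?thesis by (simp add: card_image)
qed

text \<open>A traversal of k steps ending at depth h has (k + h) / 2 upward steps with about b
  choices each, whence the normalisation n b^((k + h) / 2). In the normalised recursion both shifts
  of h get coefficient 1, and the error is O(1/b).\<close>

lemma tree_walks_limit:
  fixes b :: "nat \<Rightarrow> nat" and R :: "nat \<Rightarrow> nat \<Rightarrow> nat \<Rightarrow> bool"
  assumes b: "filterlim b at_top sequentially" and sym: "\<And>n. symp (R n)"
    and deg: "\<And>n x. n \<ge> 1 \<Longrightarrow> x < n \<Longrightarrow> card {y. y < n \<and> R n y x} = b n"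
  shows "(\<lambda>n. real (card (tree_walks n (R n) k h)) / (real n * sqrt (real (b n)) ^ (k + h)))
    \<longlonglongrightarrow> path_count k h"
proof (induction k arbitrary: h)
  case 0
  have "eventually (\<lambda>n. (if h = 0 then 1 else 0) =
      real (card (tree_walks n (R n) 0 h)) / (real n * sqrt (real (b n)) ^ (0 + h))) sequentially"
    using eventually_ge_at_top[of 1] by eventually_elim (auto simp: tree_walks_0)
  then show ?case by (intro Lim_transform_eventually[OF tendsto_const]) simp
next
  case (Suc k)
  define q where "q k h n = real (card (tree_walks n (R n) k h))" for k h n
  define a where "a k h n = q k h n / (real n * sqrt (real (b n)) ^ (k + h))" for k h n
  have IH: "a k h \<longlonglongrightarrow> path_count k h" for h using Suc by (simp add: a_def[abs_def] q_def)
  define p where "p n = (if h = 0 then 0 else a k (h - 1) n)" for n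
  have p: "p \<longlonglongrightarrow> (if h = 0 then 0 else path_count k (h - 1))"
    unfolding p_def[abs_def] by (cases "h = 0") (auto simp: IH)
  have b': "filterlim (\<lambda>n. real (b n)) at_top sequentially"
    using b filterlim_compose filterlim_real_sequentially by blast
  have e: "eventually (\<lambda>n. norm (a (Suc k) h n - a k (Suc h) n - p n) \<le> real (Suc k) * p n / real (b n)) sequentially"
    using eventually_ge_at_top[of 1] filterlim_at_top[THEN iffD1, OF b, rule_format, of 1]
  proof eventually_elim
    case (elim n)
    define s where "s = sqrt (real (b n))"
    have s: "s > 0" "s * s = real (b n)" using elim by (auto simp: s_def)
    have n: "real n > 0" using elim by simp
    define D where "D = real n * s ^ (Suc k + h)"
    have D: "D > 0" using s n by (simp add: D_def)
    have e1: "a (Suc k) h n = q (Suc k) h n / D" "a k (Suc h) n = q k (Suc h) n / D"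
      by (simp_all add: a_def D_def s_def)
    have e2: "p n = (if h = 0 then 0 else real (b n) * q k (h - 1) n) / D"
    proof (cases h)
      case (Suc h')
      then show ?thesis using s n by (simp add: p_def a_def D_def s_def[symmetric] s(2)[symmetric])
    qed (simp add: p_def)
    have "\<bar>q (Suc k) h n - q k (Suc h) n - (if h = 0 then 0 else real (b n) * q k (h - 1) n)\<bar>
        \<le> (if h = 0 then 0 else real (Suc k) * q k (h - 1) n)"
      unfolding q_def using card_tree_walks_Suc[OF sym deg] elim(1) by blast
    then have "\<bar>q (Suc k) h n - q k (Suc h) n - (if h = 0 then 0 else real (b n) * q k (h - 1) n)\<bar> / D
        \<le> (if h = 0 then 0 else real (Suc k) * q k (h - 1) n) / D"
      using D by (intro divide_right_mono) auto
    also have "(if h = 0 then 0 else real (Suc k) * q k (h - 1) n) / D = real (Suc k) * p n / real (b n)"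
      unfolding e2 using elim by auto
    finally show ?case unfolding e1 e2 using D by (simp add: diff_divide_distrib[symmetric] abs_divide)
  qed
  have "(\<lambda>n. real (Suc k) * p n / real (b n)) \<longlonglongrightarrow> 0"
    by (rule tendsto_divide_0[OF tendsto_mult[OF tendsto_const p]])
      (rule filterlim_at_top_imp_at_infinity[OF b'])
  from Lim_null_comparison[OF e this]
  have "(\<lambda>n. a (Suc k) h n - a k (Suc h) n - p n) \<longlonglongrightarrow> 0" .
  from tendsto_add[OF tendsto_add[OF this IH[of "Suc h"]] p]
  have "a (Suc k) h \<longlonglongrightarrow> path_count (Suc k) h" by (simp cong: if_cong)
  then show ?case by (simp add: a_def[abs_def] q_def)
qed

text \<open>Unordered pairs, because a symmetric matrix has one value for both orientations; i = j
  gives the singletons that label the diagonal entries.\<close>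

definition edges :: "nat \<Rightarrow> nat set set" where
  "edges n = {{i, j} | i j. i < n \<and> j < n}"

lemma path_edges_in_edges: "w \<in> walks n R k \<Longrightarrow> set (path_edges w) \<subseteq> edges n"
proof -
  have "set w \<subseteq> {..<n} \<Longrightarrow> set (path_edges w) \<subseteq> edges n"
    by (induction w rule: path_edges.induct) (auto simp: edges_def)
  then show "w \<in> walks n R k \<Longrightarrow> set (path_edges w) \<subseteq> edges n" by (auto simp: walks_def)
qed

text \<open>A function of a field on edges, so that symmetry is automatic and rotated fields can be
  substituted for the original one.\<close>

definition band :: "nat \<Rightarrow> nat \<Rightarrow> (nat set \<Rightarrow> real) \<Rightarrow> real mat" where
  "band n b z = Matrix.mat n n (\<lambda>(i, j). if relevant n b i j then 1 / sqrt (real b) * z {i, j} else 0)"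

definition band_moment :: "nat \<Rightarrow> nat \<Rightarrow> nat \<Rightarrow> (nat set \<Rightarrow> real) \<Rightarrow> real" where
  "band_moment n b k z = mat_trace (band n b z ^\<^sub>m k) / real n"

lemma band_carrier [simp]: "band n b z \<in> carrier_mat n n"
  by (simp add: band_def)

lemma band_symmetric: "transpose_mat (band n b z) = band n b z"
  using symp_relevant[of n b] by (intro eq_matI) (auto simp: band_def insert_commute dest: sympD)

lemma band_moment_walks:
  "band_moment n b k z = (1 / sqrt (real b)) ^ k / real n *
    (\<Sum>w | w \<in> walks n (relevant n b) k \<and> hd w = last w. \<Prod>e\<leftarrow>path_edges w. z e)"
  unfolding band_moment_def band_def by (subst trace_pow_walks[OF symp_relevant]) simp

text \<open>The data for one n, with the covariance bound \<delta> left open: the expected moments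
  compare it with 1/b, the concentration estimate with 1/n^2.\<close>

locale correlated_field = gaussian_space M L
  for M :: "'w measure" and L +
  fixes n b :: nat and Z :: "nat set \<Rightarrow> 'w \<Rightarrow> real" and \<delta> :: real
  assumes n: "n \<ge> 1" and bw: "bandwidth n b" and \<delta>: "\<delta> \<ge> 0"
    and Z: "e \<in> edges n \<Longrightarrow> Z e \<in> L"
    and var: "e \<in> edges n \<Longrightarrow> expectation (\<lambda>\<omega>. Z e \<omega> * Z e \<omega>) = 1"
    and cov: "e \<in> edges n \<Longrightarrow> f \<in> edges n \<Longrightarrow> e \<noteq> f \<Longrightarrow> \<bar>expectation (\<lambda>\<omega>. Z e \<omega> * Z f \<omega>)\<bar> \<le> \<delta>"
begin

abbreviation mom :: "nat \<Rightarrow> 'w \<Rightarrow> real" where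
  "mom k \<omega> \<equiv> band_moment n b k (\<lambda>e. Z e \<omega>)"

lemma all_moments_walk: "w \<in> walks n R k \<Longrightarrow> all_moments (\<lambda>\<omega>. \<Prod>e\<leftarrow>path_edges w. Z e \<omega>)"
  using all_moments_prod_list[of "map Z (path_edges w)"] path_edges_in_edges[of w n R k] Z space_moments
  by (auto simp: comp_def)

lemma all_moments_mom: "all_moments (mom k)"
  unfolding band_moment_walks
  by (intro all_moments_mult all_moments_const all_moments_sum) (auto intro: all_moments_walk)

text \<open>With s = sqrt b, a closed walk on v vertices that is no traversal contributes at most F
  s^(k + 1) b^(-v), and the weights b^(-v) sum to at most (k + 1)! n / b. Dividing by n s^k leaves
  O(1/s). Traversals have expectation 1 up to O(1/b), and their number is kept as the main
  term.\<close>

lemma expectation_mom: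
  assumes \<kappa>: "\<kappa> \<ge> 1" and d: "\<delta> \<le> \<kappa> / real b"
  shows "\<bar>expectation (mom k) - real (card (tree_walks n (relevant n b) k 0)) / (real n * sqrt (real b) ^ k)\<bar>
    \<le> 2 * (fact k * \<kappa> ^ k * fact (Suc k)) / sqrt (real b)"
proof -
  let ?W = "walks n (relevant n b) k"
  define C where "C = {w \<in> ?W. hd w = last w}"
  define T where "T = tree_walks n (relevant n b) k 0"
  define E where "E w = expectation (\<lambda>\<omega>. \<Prod>e\<leftarrow>path_edges w. Z e \<omega>)" for w
  define s where "s = sqrt (real b)"
  define F where "F = fact k * \<kappa> ^ k"
  have b: "b \<ge> 1" "b \<le> n" using bandwidth_bounds[OF n bw] by auto
  have s: "s \<ge> 1" "s * s = real b" using b by (auto simp: s_def)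
  have F: "F \<ge> 0" using \<kappa> by (simp add: F_def)
  have n0: "real n > 0" using n by simp
  have TC: "T \<subseteq> C"
    using tree_walk_height1_closed by (auto simp: T_def C_def tree_walks_def)
  have cov': "\<bar>expectation (\<lambda>\<omega>. Z e \<omega> * Z f \<omega>)\<bar> \<le> \<kappa> * (1 / s)\<^sup>2"
    if "e \<in> edges n" "f \<in> edges n" "e \<noteq> f" for e f
    using cov[OF that] d s by (simp add: power2_eq_square)
  have s1: "0 \<le> 1 / s" "1 / s \<le> 1" using s by auto
  have bound: "\<bar>expectation (\<lambda>\<omega>. \<Prod>e\<leftarrow>es. Z e \<omega>)\<bar> \<le> fact (length es) * \<kappa> ^ length es * (1 / s) ^ singles es"
    if "set es \<subseteq> edges n" for es
    by (rule prod_expectation_le[of "edges n" Z \<kappa> "1 / s"]) (use Z var cov' \<kappa> s1 that in auto)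
  have double: "\<bar>expectation (\<lambda>\<omega>. \<Prod>e\<leftarrow>es. Z e \<omega>) - 1\<bar> \<le> fact (length es) * \<kappa> ^ length es * (1 / s)\<^sup>2"
    if "set es \<subseteq> edges n" "\<And>e. e \<in> set es \<Longrightarrow> count_list es e = 2" for es
    by (rule prod_expectation_double[of "edges n" Z \<kappa> "1 / s"]) (use Z var cov' \<kappa> s1 that in auto)
  have sum_le: "(\<Sum>w\<in>A. (1 / real b) ^ card (set w)) \<le> fact (Suc k) * real n / real b" if "A \<subseteq> ?W" for A
    by (rule order_trans[OF sum_mono2 card_le_sum_walks]) (use that b bw card_relevant in auto)
  \<comment> \<open>As b = s^2, this turns an inequality between numbers of vertices and edges into
    one between weights.\<close>
  have wt: "s ^ j * (1 / real b) ^ c \<ge> 1" if "2 * c \<le> j" for c j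
  proof -
    have "s ^ (2 * c) \<le> s ^ j" using s that by (intro power_increasing) auto
    moreover have "s ^ (2 * c) = real b ^ c" using s(2) by (simp add: power_mult power2_eq_square)
    ultimately show ?thesis using b by (simp add: power_one_over field_simps)
  qed
  have bad: "\<bar>E w\<bar> \<le> F * s ^ Suc k * (1 / real b) ^ card (set w)" if w: "w \<in> C - T" for w
  proof -
    have wW: "w \<in> ?W" "hd w = last w" using w by (auto simp: C_def)
    have len: "length w = Suc k" using wW by (simp add: walks_def)
    have "\<nexists>st. tree_walk w st"
      using w wW closed_tree_walk_count(1)[of w] by (auto simp: T_def tree_walks_def)
    from card_vertices_bad_walk[OF len wW(2) this]
    have c: "2 * card (set w) \<le> Suc k + singles (path_edges w)" by simp
    have "\<bar>E w\<bar> \<le> F * (1 / s) ^ singles (path_edges w)"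
      using bound[OF path_edges_in_edges[OF wW(1)]] len by (simp add: E_def F_def)
    also have "(1 / s) ^ singles (path_edges w) \<le> s ^ Suc k * (1 / real b) ^ card (set w)"
      using wt[OF c] s by (simp add: power_add power_one_over field_simps)
    finally show ?thesis using F by (simp add: mult_left_mono mult.assoc)
  qed
  have good: "\<bar>E w - 1\<bar> \<le> F * s ^ k * (1 / real b) ^ card (set w)" if w: "w \<in> T" for w
  proof -
    obtain st where st: "tree_walk w st" and wW: "w \<in> ?W" "hd w = last w"
      using w TC by (auto simp: T_def C_def tree_walks_def)
    have len: "length (path_edges w) = k" using wW by (simp add: walks_def)
    have cnt: "count_list (path_edges w) e = 2" if "e \<in> set (path_edges w)" for e
      using closed_tree_walk_count(2)[OF st wW(2) that] .
    have "k = (\<Sum>e\<in>set (path_edges w). count_list (path_edges w) e)"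
      unfolding len[symmetric] by (rule sum_count_set[symmetric]) auto
    also have "\<dots> = 2 * card (set (path_edges w))" using cnt by simp
    finally have "2 * card (set w) \<le> k + 2"
      using card_vertices_le[of w] hd_walk[OF wW(1)] by simp
    \<comment> \<open>The error 1/b of a traversal is rewritten as a vertex weight by means of 2 v
      \<le> k + 2, so that the same sum over walks bounds it.\<close>
    from wt[OF this] have "1 / real b \<le> s ^ k * (1 / real b) ^ card (set w)"
    proof -
      have sk: "s ^ (k + 2) = real b * s ^ k" unfolding s(2)[symmetric] by (simp add: mult.assoc)
      have "1 \<le> (s ^ k * (1 / real b) ^ card (set w)) * real b"
        using \<open>1 \<le> s ^ (k + 2) * (1 / real b) ^ card (set w)\<close> unfolding sk by (simp only: mult_ac)
      then show ?thesis using b by (simp only: pos_divide_le_eq of_nat_0_less_iff)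
    qed
    moreover have "\<bar>E w - 1\<bar> \<le> F * (1 / s)\<^sup>2"
      using double[OF path_edges_in_edges[OF wW(1)] cnt] len by (simp add: E_def F_def)
    moreover have "(1 / s)\<^sup>2 = 1 / real b" using s by (simp add: power2_eq_square)
    ultimately show ?thesis using F by (metis mult.assoc mult_left_mono order_trans)
  qed
  have fin: "finite C" "finite T" by (simp_all add: C_def T_def)
  have E: "expectation (mom k) = (1 / s) ^ k / real n * (\<Sum>w\<in>C. E w)"
    unfolding band_moment_walks C_def E_def s_def
    by (subst Bochner_Integration.integral_mult_right_zero, subst Bochner_Integration.integral_sum)
      (auto intro: all_moments_integrable all_moments_walk)
  have "(\<Sum>w\<in>C. E w) - real (card T) = (\<Sum>w\<in>C - T. E w) + (\<Sum>w\<in>T. E w - 1)"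
    using sum.subset_diff[OF TC fin(1), of E] by (simp add: sum_subtractf)
  also have "\<bar>\<dots>\<bar> \<le> (\<Sum>w\<in>C - T. F * s ^ Suc k * (1 / real b) ^ card (set w)) + (\<Sum>w\<in>T. F * s ^ k * (1 / real b) ^ card (set w))"
    by (rule order_trans[OF abs_triangle_ineq add_mono]) (rule order_trans[OF sum_abs] sum_mono bad good | assumption)+
  also have "\<dots> = F * s ^ Suc k * (\<Sum>w\<in>C - T. (1 / real b) ^ card (set w)) + F * s ^ k * (\<Sum>w\<in>T. (1 / real b) ^ card (set w))"
    by (simp add: sum_distrib_left)
  also have "\<dots> \<le> F * s ^ Suc k * (fact (Suc k) * real n / real b) + F * s ^ k * (fact (Suc k) * real n / real b)"
    by (intro add_mono mult_left_mono sum_le) (use F s in \<open>auto simp: C_def T_def tree_walks_def\<close>)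
  also have "\<dots> \<le> 2 * (F * s ^ Suc k * (fact (Suc k) * real n / real b))"
  proof -
    have "s ^ k \<le> s ^ Suc k" using s by (intro power_increasing) auto
    then have "F * s ^ k * (fact (Suc k) * real n / real b) \<le> F * s ^ Suc k * (fact (Suc k) * real n / real b)"
      using F by (intro mult_right_mono mult_left_mono) auto
    then show ?thesis unfolding mult_2 by (rule add_left_mono)
  qed
  finally have main: "\<bar>(\<Sum>w\<in>C. E w) - real (card T)\<bar> \<le> 2 * (F * s ^ Suc k * (fact (Suc k) * real n / real b))" .
  have "expectation (mom k) - real (card T) / (real n * s ^ k) = ((\<Sum>w\<in>C. E w) - real (card T)) / (real n * s ^ k)"
    unfolding E using s n0 by (simp add: power_one_over field_simps)
  also have "\<bar>\<dots>\<bar> \<le> 2 * (F * s ^ Suc k * (fact (Suc k) * real n / real b)) / (real n * s ^ k)"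
  proof -
    have D: "0 \<le> real n * s ^ k" using s by simp
    show ?thesis unfolding abs_divide abs_of_nonneg[OF D] by (rule divide_right_mono[OF main D])
  qed
  also have "\<dots> = 2 * (F * fact (Suc k)) / s"
    using s n0 by (simp add: s(2)[symmetric] field_simps)
  finally show ?thesis by (simp add: T_def s_def F_def)
qed

end

section \<open>Polynomials in Gaussian variables and independent copies\<close>

context prob_space
begin

lemma all_moments_cmult: "all_moments f \<Longrightarrow> all_moments (\<lambda>x. c * f x)"
  using all_moments_mult[of "\<lambda>_. c" f] by simp

text \<open>Pairs of a random function of t and its derivative, built as finite sums of q(t) R(x).
  For these the derivative passes through the expectation by linearity alone, and products stay in
  the class.\<close>

inductive smooth_family :: "(real \<Rightarrow> 'a \<Rightarrow> real) \<Rightarrow> (real \<Rightarrow> 'a \<Rightarrow> real) \<Rightarrow> bool" where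
  base: "(\<And>t. (q has_real_derivative q' t) (at t)) \<Longrightarrow> all_moments R \<Longrightarrow>
    smooth_family (\<lambda>t x. q t * R x) (\<lambda>t x. q' t * R x)"
| add: "smooth_family f f' \<Longrightarrow> smooth_family g g' \<Longrightarrow>
    smooth_family (\<lambda>t x. f t x + g t x) (\<lambda>t x. f' t x + g' t x)"

lemma smooth_family_const: "all_moments R \<Longrightarrow> smooth_family (\<lambda>t x. R x) (\<lambda>t x. 0)"
  using smooth_family.base[of "\<lambda>_. 1" "\<lambda>_. 0" R] by simp

lemma smooth_family_mult:
  assumes "smooth_family f f'" "smooth_family g g'"
  shows "smooth_family (\<lambda>t x. f t x * g t x) (\<lambda>t x. f' t x * g t x + f t x * g' t x)"
  using assms(1)
proof induction
  case (base q q' R)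
  from assms(2) show ?case
  proof induction
    case (base p p' S)
    have "((\<lambda>t. q t * p t) has_real_derivative q' t * p t + p' t * q t) (at t)" for t
      using \<open>\<And>t. (q has_real_derivative q' t) (at t)\<close> base(1) by (rule DERIV_mult)
    from smooth_family.base[OF this all_moments_mult[OF \<open>all_moments R\<close> base(2)]]
    show ?case by (simp add: algebra_simps)
  next
    case (add g g' h h')
    from smooth_family.add[OF add(3,4)] show ?case by (simp add: algebra_simps)
  qed
next
  case (add f f' h h')
  from smooth_family.add[OF add(3,4)] show ?case by (simp add: algebra_simps)
qed

lemma smooth_family_cmult:
  "smooth_family f f' \<Longrightarrow> smooth_family (\<lambda>t x. c * f t x) (\<lambda>t x. c * f' t x)"
  using smooth_family_mult[OF smooth_family_const[of "\<lambda>_. c"]] by simp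

lemma smooth_family_sum:
  "(\<And>i. i \<in> I \<Longrightarrow> smooth_family (f i) (f' i)) \<Longrightarrow>
    smooth_family (\<lambda>t x. \<Sum>i\<in>I. f i t x) (\<lambda>t x. \<Sum>i\<in>I. f' i t x)"
proof (induction I rule: infinite_finite_induct)
  case (insert i I)
  then show ?case using smooth_family.add[of "f i" "f' i"] by simp
qed (use smooth_family_const[of "\<lambda>_. 0"] in auto)

lemma smooth_family_all_moments:
  assumes "smooth_family f f'"
  shows "all_moments (f t)" "all_moments (f' t)"
  using assms by induction (auto intro: all_moments_add all_moments_cmult)

lemma smooth_family_derivative:
  assumes "smooth_family f f'"
  shows "((\<lambda>t. expectation (f t)) has_real_derivative expectation (f' t)) (at t)"
  using assms
proof induction
  case (base q q' R)
  have "((\<lambda>t. q t * expectation R) has_real_derivative q' t * expectation R) (at t)"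
    by (rule DERIV_cmult_right) (rule base)
  then show ?case by simp
next
  case (add f f' g g')
  have "expectation (\<lambda>x. f t x + g t x) = expectation (f t) + expectation (g t)"
    "expectation (\<lambda>x. f' t x + g' t x) = expectation (f' t) + expectation (g' t)" for t
    using smooth_family_all_moments[OF add(1), of t] smooth_family_all_moments[OF add(2), of t]
    by (simp_all add: all_moments_integrable)
  then show ?case using DERIV_add[OF add(3,4)] by simp
qed

lemma expectation_power_le:
  assumes "all_moments f"
  shows "(expectation f) ^ (2 * p) \<le> expectation (\<lambda>x. f x ^ (2 * p))"
  by (rule jensens_inequality[where I = UNIV])
    (use all_moments_integrable[OF assms] all_moments_integrable[OF all_moments_power[OF assms]]
      convex_power_even[of "2 * p"] in auto)

end

text \<open>Polynomials in variables indexed by \<open>I\<close>; monomials are products over lists,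
  the form in which the Wick formula evaluates expectations.\<close>

inductive poly_fun :: "'e set \<Rightarrow> (('e \<Rightarrow> real) \<Rightarrow> real) \<Rightarrow> bool" for I where
  mono: "set es \<subseteq> I \<Longrightarrow> poly_fun I (\<lambda>z. c * (\<Prod>e\<leftarrow>es. z e))"
| add: "poly_fun I P \<Longrightarrow> poly_fun I Q \<Longrightarrow> poly_fun I (\<lambda>z. P z + Q z)"

lemma poly_fun_const: "poly_fun I (\<lambda>z. c)"
  using poly_fun.mono[of "[]" I c] by simp

lemma poly_fun_var: "e \<in> I \<Longrightarrow> poly_fun I (\<lambda>z. z e)"
  using poly_fun.mono[of "[e]" I 1] by simp

lemma poly_fun_mult:
  assumes "poly_fun I P" "poly_fun I Q"
  shows "poly_fun I (\<lambda>z. P z * Q z)"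
  using assms(1)
proof induction
  case (mono es c)
  from assms(2) show ?case
  proof induction
    case (mono fs d)
    then show ?case using poly_fun.mono[of "es @ fs" I "c * d"] \<open>set es \<subseteq> I\<close>
      by (simp add: mult_ac)
  next
    case (add P Q)
    from poly_fun.add[OF add(3,4)] show ?case by (simp add: algebra_simps)
  qed
next
  case (add P Q)
  from poly_fun.add[OF add(3,4)] show ?case by (simp add: algebra_simps)
qed

lemma poly_fun_sum: "(\<And>i. i \<in> J \<Longrightarrow> poly_fun I (P i)) \<Longrightarrow> poly_fun I (\<lambda>z. \<Sum>i\<in>J. P i z)"
  by (induction J rule: infinite_finite_induct) (auto intro: poly_fun_const poly_fun.add)

lemma poly_fun_power: "poly_fun I P \<Longrightarrow> poly_fun I (\<lambda>z. P z ^ k)"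
  by (induction k) (auto intro: poly_fun_const poly_fun_mult)

context gaussian_space
begin

lemma space_sum:
  assumes "L \<noteq> {}" "\<And>i. i \<in> I \<Longrightarrow> G i \<in> L"
  shows "(\<lambda>x. \<Sum>i\<in>I. G i x) \<in> L"
proof -
  obtain H where "H \<in> L" using assms(1) by blast
  then have "(\<lambda>x. 0) \<in> L" using space_scale[of H 0] by simp
  then show ?thesis
    using assms(2) by (induction I rule: infinite_finite_induct) (auto intro: space_add)
qed

text \<open>The Wick expansion expresses mixed moments through covariances alone. This is the form
  in which rotation invariance is used later.\<close>

lemma expectation_prod_cong:
  assumes "\<And>e. e \<in> I \<Longrightarrow> Z e \<in> L" "\<And>e. e \<in> I \<Longrightarrow> Z' e \<in> L"
    and "\<And>e f. e \<in> I \<Longrightarrow> f \<in> I \<Longrightarrow> expectation (\<lambda>x. Z e x * Z f x) = expectation (\<lambda>x. Z' e x * Z' f x)"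
    and "set es \<subseteq> I"
  shows "expectation (\<lambda>x. \<Prod>e\<leftarrow>es. Z e x) = expectation (\<lambda>x. \<Prod>e\<leftarrow>es. Z' e x)"
  using assms(4)
proof (induction es rule: length_induct)
  case (1 es)
  show ?case
  proof (cases es)
    case (Cons x xs)
    then have xs: "x \<in> I" "\<And>e. e \<in> set xs \<Longrightarrow> e \<in> I" using 1(2) by auto
    have sub: "set (take j xs @ drop (Suc j) xs) \<subseteq> I" for j
      using xs set_take_subset[of j xs] set_drop_subset[of "Suc j" xs] by auto
    show ?thesis
      unfolding Cons
      apply (subst wick_labels[of Z], use xs assms in simp, use xs assms in simp)
      apply (subst wick_labels[of Z'], use xs assms in simp, use xs assms in simp)
    proof (rule sum.cong[OF refl])
      fix j assume j: "j \<in> {..<length xs}"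
      have "expectation (\<lambda>x. \<Prod>e\<leftarrow>take j xs @ drop (Suc j) xs. Z e x) =
          expectation (\<lambda>x. \<Prod>e\<leftarrow>take j xs @ drop (Suc j) xs. Z' e x)"
        using 1(1)[rule_format, of "take j xs @ drop (Suc j) xs"] sub[of j] j Cons by simp
      moreover have "xs ! j \<in> I" using xs j by simp
      ultimately show "expectation (\<lambda>\<omega>. Z x \<omega> * Z (xs ! j) \<omega>) * expectation (\<lambda>\<omega>. \<Prod>e\<leftarrow>take j xs @ drop (Suc j) xs. Z e \<omega>)
        = expectation (\<lambda>\<omega>. Z' x \<omega> * Z' (xs ! j) \<omega>) * expectation (\<lambda>\<omega>. \<Prod>e\<leftarrow>take j xs @ drop (Suc j) xs. Z' e \<omega>)"
        using assms(3)[OF xs(1)] by simp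
    qed
  qed simp
qed

lemma all_moments_poly_fun:
  assumes "poly_fun I P" and "\<And>e. e \<in> I \<Longrightarrow> Z e \<in> L"
  shows "all_moments (\<lambda>x. P (\<lambda>e. Z e x))"
  using assms(1)
proof induction
  case (mono es c)
  have "all_moments (\<lambda>x. \<Prod>F\<leftarrow>map Z es. F x)"
    by (rule all_moments_prod_list) (use mono assms(2) space_moments in auto)
  then show ?case by (intro all_moments_cmult) (simp add: comp_def)
qed (rule all_moments_add)

lemma expectation_poly_fun_cong:
  assumes "poly_fun I P" and "\<And>e. e \<in> I \<Longrightarrow> Z e \<in> L" "\<And>e. e \<in> I \<Longrightarrow> Z' e \<in> L"
    and "\<And>e f. e \<in> I \<Longrightarrow> f \<in> I \<Longrightarrow> expectation (\<lambda>x. Z e x * Z f x) = expectation (\<lambda>x. Z' e x * Z' f x)"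
  shows "expectation (\<lambda>x. P (\<lambda>e. Z e x)) = expectation (\<lambda>x. P (\<lambda>e. Z' e x))"
  using assms(1)
proof induction
  case (mono es c)
  have "expectation (\<lambda>x. \<Prod>e\<leftarrow>es. Z e x) = expectation (\<lambda>x. \<Prod>e\<leftarrow>es. Z' e x)"
    by (rule expectation_prod_cong[of I]) (use assms(2-4) mono in auto)
  then show ?case by simp
next
  case (add P Q)
  have "integrable M (\<lambda>x. P (\<lambda>e. Z e x))" "integrable M (\<lambda>x. Q (\<lambda>e. Z e x))"
    "integrable M (\<lambda>x. P (\<lambda>e. Z' e x))" "integrable M (\<lambda>x. Q (\<lambda>e. Z' e x))"
    using all_moments_poly_fun[OF add(1), of Z] all_moments_poly_fun[OF add(2), of Z]
      all_moments_poly_fun[OF add(1), of Z'] all_moments_poly_fun[OF add(2), of Z'] assms(2,3)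
    by (auto intro!: all_moments_integrable)
  then show ?case using add(3,4) by simp
qed

text \<open>The product is (2 p - 1)!!, obtained by iterating the moment recursion.\<close>

lemma even_moment:
  assumes "G \<in> L"
  shows "expectation (\<lambda>x. G x ^ (2 * p)) = (\<Prod>i<p. real (2 * i + 1)) * (expectation (\<lambda>x. G x ^ 2)) ^ p"
proof (induction p)
  case (Suc p)
  have "expectation (\<lambda>x. G x ^ (2 * Suc p)) = expectation (\<lambda>x. G x ^ (2 * p + 2))" by simp
  also have "\<dots> = real (2 * p + 1) * expectation (\<lambda>x. G x ^ 2) * expectation (\<lambda>x. G x ^ (2 * p))"
    by (rule space_recursion[OF assms])
  finally show ?case unfolding Suc by simp
qed (simp add: prob_space)

end

text \<open>Abstracted from T i j n = E(G^i H^j (G + H)^n) with v = E(G^2): \<open>step\<close>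
  splits one factor G + H, \<open>base\<close> is integration by parts for G alone, and the
  conclusion is integration by parts for G with all factors present. Where a subtraction is
  truncated at 0, its coefficient vanishes.\<close>

lemma stein_recursion:
  fixes T :: "nat \<Rightarrow> nat \<Rightarrow> nat \<Rightarrow> real"
  assumes step: "\<And>i j n. T i j (Suc n) = T (Suc i) j n + T i (Suc j) n"
    and base: "\<And>i j. T (Suc i) j 0 = real i * v * T (i - 1) j 0"
  shows "T (Suc i) j n = v * (real i * T (i - 1) j n + real n * T i j (n - 1))"
proof (induction n arbitrary: i j)
  case 0
  then show ?case by (simp add: base)
next
  case (Suc n)
  have a: "real n * (T (Suc i) j (n - 1) + T i (Suc j) (n - 1)) = real n * T i j n"
    using step[of i j "n - 1"] by (cases n) simp_all
  have b: "real i * (T i j n + T (i - 1) (Suc j) n) = real i * T (i - 1) j (Suc n)"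
    using step[of "i - 1" j n] by (cases i) simp_all
  have "T (Suc i) j (Suc n) = T (Suc (Suc i)) j n + T (Suc i) (Suc j) n" by (rule step)
  also have "\<dots> = v * ((real i + 1) * T i j n + real n * T (Suc i) j (n - 1)) +
      v * (real i * T (i - 1) (Suc j) n + real n * T i (Suc j) (n - 1))"
    unfolding Suc by (simp add: algebra_simps)
  also have "\<dots> = v * (real i * (T i j n + T (i - 1) (Suc j) n) + T i j n +
      real n * (T (Suc i) j (n - 1) + T i (Suc j) (n - 1)))"
    by (simp add: algebra_simps)
  also have "\<dots> = v * (real i * T (i - 1) j (Suc n) + real (Suc n) * T i j (Suc n - 1))"
    unfolding a b by (simp add: algebra_simps)
  finally show ?case .
qed

definition product_space :: "('w \<Rightarrow> real) set \<Rightarrow> ('w \<times> 'w \<Rightarrow> real) set" where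
  "product_space L = {\<lambda>x. G (fst x) + H (snd x) | G H. G \<in> L \<and> H \<in> L}"

lemma (in prob_space) pair_prob_space_self: "pair_prob_space M M"
  by unfold_locales

lemma (in prob_space) integral_product:
  fixes f g :: "'a \<Rightarrow> real"
  assumes [simp]: "integrable M f" "integrable M g"
  shows "integrable (M \<Otimes>\<^sub>M M) (\<lambda>x. f (fst x) * g (snd x))"
    and "(\<integral>x. f (fst x) * g (snd x) \<partial>(M \<Otimes>\<^sub>M M)) = expectation f * expectation g"
proof -
  interpret P: pair_prob_space M M by (rule pair_prob_space_self)
  have [measurable]: "f \<in> borel_measurable M" "g \<in> borel_measurable M"
    by (rule borel_measurable_integrable[OF assms(1)], rule borel_measurable_integrable[OF assms(2)])
  show int: "integrable (M \<Otimes>\<^sub>M M) (\<lambda>x. f (fst x) * g (snd x))"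
    by (rule P.Fubini_integrable) (auto simp: abs_mult)
  show "(\<integral>x. f (fst x) * g (snd x) \<partial>(M \<Otimes>\<^sub>M M)) = expectation f * expectation g"
    using P.integral_fst'[OF int] by simp
qed

lemma (in prob_space) all_moments_lift:
  assumes "all_moments f"
  shows "prob_space.all_moments (M \<Otimes>\<^sub>M M) (\<lambda>x. f (fst x))"
    and "prob_space.all_moments (M \<Otimes>\<^sub>M M) (\<lambda>x. f (snd x))"
proof -
  interpret P: pair_prob_space M M by (rule pair_prob_space_self)
  note [measurable] = all_moments_measurable[OF assms]
  have i: "integrable M (\<lambda>x. f x ^ k)" for k using assms by (simp add: all_moments_def)
  show "P.all_moments (\<lambda>x. f (fst x))" "P.all_moments (\<lambda>x. f (snd x))"
    using integral_product(1)[OF i, of "\<lambda>_. 1"] integral_product(1)[OF _ i, of "\<lambda>_. 1"]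
    by (auto simp: P.all_moments_def)
qed

text \<open>A sum of independent Gaussian variables satisfies the moment recursion, with the
  variances adding. The argument works with mixed moments, since the recursion is all that the space
  knows about its elements.\<close>

lemma (in gaussian_space) gaussian_product_space:
  "gaussian_space (M \<Otimes>\<^sub>M M) (product_space L)"
proof -
  interpret P: pair_prob_space M M by (rule pair_prob_space_self)
  show ?thesis
  proof
    fix F assume "F \<in> product_space L"
    then obtain G H where F: "F = (\<lambda>x. G (fst x) + H (snd x))" and G: "G \<in> L" and H: "H \<in> L"
      by (auto simp: product_space_def)
    note mG = space_moments[OF G] and mH = space_moments[OF H]
    note lG = all_moments_lift(1)[OF mG] and lH = all_moments_lift(2)[OF mH]
    show aF: "P.all_moments F" unfolding F by (rule P.all_moments_add[OF lG lH])
    show "P.expectation F = 0"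
      unfolding F
      using integral_product(2)[of G "\<lambda>_. 1"] integral_product(2)[of "\<lambda>_. 1" H]
        P.all_moments_integrable[OF lG] P.all_moments_integrable[OF lH]
        all_moments_integrable[OF mG] all_moments_integrable[OF mH] space_mean[OF G] space_mean[OF H]
      by simp
    define T where "T i j n = P.expectation (\<lambda>x. G (fst x) ^ i * H (snd x) ^ j * F x ^ n)" for i j n
    have int: "integrable (M \<Otimes>\<^sub>M M) (\<lambda>x. G (fst x) ^ i * H (snd x) ^ j * F x ^ n)" for i j n
      by (intro P.all_moments_integrable P.all_moments_mult P.all_moments_power lG lH aF)
    have step: "T i j (Suc n) = T (Suc i) j n + T i (Suc j) n" for i j n
    proof -
      have "T i j (Suc n) = P.expectation (\<lambda>x. G (fst x) ^ Suc i * H (snd x) ^ j * F x ^ n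
          + G (fst x) ^ i * H (snd x) ^ Suc j * F x ^ n)"
        unfolding T_def by (rule Bochner_Integration.integral_cong) (auto simp: F algebra_simps)
      also have "\<dots> = T (Suc i) j n + T i (Suc j) n"
        unfolding T_def by (rule Bochner_Integration.integral_add[OF int int])
      finally show ?thesis .
    qed
    have T0: "T i j 0 = expectation (\<lambda>x. G x ^ i) * expectation (\<lambda>x. H x ^ j)" for i j
      unfolding T_def
      using integral_product(2)[of "\<lambda>x. G x ^ i" "\<lambda>x. H x ^ j"] mG mH by (simp add: all_moments_def)
    have pw: "expectation (\<lambda>x. K x ^ Suc i) = real i * expectation (\<lambda>x. K x ^ 2) * expectation (\<lambda>x. K x ^ (i - 1))"
      if "K \<in> L" for K i
      using expectation_mult_power[OF that that, of i] by (simp add: power2_eq_square)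
    define v w where "v = expectation (\<lambda>x. G x ^ 2)" and "w = expectation (\<lambda>x. H x ^ 2)"
    have s1: "T (Suc i) j n = v * (real i * T (i - 1) j n + real n * T i j (n - 1))" for i j n
      by (rule stein_recursion[of T v, OF step]) (unfold T0 pw[OF G] v_def, simp)
    have s2: "T j (Suc i) n = w * (real i * T j (i - 1) n + real n * T j i (n - 1))" for i j n
      
    proof (rule stein_recursion[of "\<lambda>i j n. T j i n" w])
      show "T j (Suc i) 0 = real i * w * T j (i - 1) 0" for i j
        unfolding T0 pw[OF H] w_def by simp
    qed (simp add: step)
    \<comment> \<open>One factor of F^(k + 2) is split into G + H; each part integrates by parts to
      its variance times (k + 1) E(F^k).\<close>
    have e: "T 0 0 (k + 2) = real (k + 1) * (v + w) * T 0 0 k" for k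
      using step[of 0 0 "k + 1"] s1[of 0 0 "k + 1"] s2[of 0 0 "k + 1"] by (simp add: algebra_simps)
    have "T 0 0 0 = 1" by (simp add: T0 prob_space)
    then have "T 0 0 2 = v + w" using e[of 0] by (simp add: numeral_2_eq_2)
    then show "P.expectation (\<lambda>x. F x ^ (k + 2)) = real (k + 1) * P.expectation (\<lambda>x. (F x)\<^sup>2) * P.expectation (\<lambda>x. F x ^ k)" for k
      using e[of k] by (simp add: T_def)
    show "(\<lambda>x. c * F x) \<in> product_space L" for c
      unfolding F product_space_def
      using space_scale[OF G, of c] space_scale[OF H, of c] by (auto simp: distrib_left)
    fix F' assume "F' \<in> product_space L"
    then obtain G' H' where F': "F' = (\<lambda>x. G' (fst x) + H' (snd x))" and G': "G' \<in> L" and H': "H' \<in> L"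
      by (auto simp: product_space_def)
    have "(\<lambda>x. F x + F' x) = (\<lambda>x. (\<lambda>y. G y + G' y) (fst x) + (\<lambda>y. H y + H' y) (snd x))"
      by (simp add: F F' algebra_simps)
    then show "(\<lambda>x. F x + F' x) \<in> product_space L"
      unfolding product_space_def mem_Collect_eq using space_add[OF G G'] space_add[OF H H']
      by (intro exI[of _ "\<lambda>y. G y + G' y"] exI[of _ "\<lambda>y. H y + H' y"]) simp
  qed
qed

section \<open>Derivatives of traces of matrix powers\<close>

text \<open>The derivative of the k-th power at \<open>A\<close> in direction \<open>B\<close>. The
  two need not commute, so the Leibniz rule keeps the order of the factors.\<close>

fun power_derivative :: "nat \<Rightarrow> real mat \<Rightarrow> real mat \<Rightarrow> nat \<Rightarrow> real mat" where
  "power_derivative n A B 0 = 0\<^sub>m n n"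
| "power_derivative n A B (Suc k) = power_derivative n A B k * A + A ^\<^sub>m k * B"

lemma power_derivative_carrier [simp]:
  "A \<in> carrier_mat n n \<Longrightarrow> B \<in> carrier_mat n n \<Longrightarrow> power_derivative n A B k \<in> carrier_mat n n"
  by (induction k) (auto intro!: add_carrier_mat mult_carrier_mat[of _ n n])

lemma pow_mat_add:
  fixes A :: "real mat"
  assumes A: "A \<in> carrier_mat n n"
  shows "A ^\<^sub>m (j + k) = A ^\<^sub>m j * A ^\<^sub>m k"
proof (induction k)
  case 0
  then show ?case using pow_carrier_mat[OF A, of j] A by simp
next
  case (Suc k)
  then show ?case
    using assoc_mult_mat[OF pow_carrier_mat[OF A, of j] pow_carrier_mat[OF A, of k] A] by simp
qed

lemma pow_mat_commute:
  fixes A :: "real mat"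
  assumes A: "A \<in> carrier_mat n n"
  shows "A * A ^\<^sub>m k = A ^\<^sub>m Suc k"
proof -
  have "A ^\<^sub>m 1 = A" using A by simp
  then show ?thesis using pow_mat_add[OF A, of 1 k] by (simp only: plus_1_eq_Suc)
qed

lemma pow_mat_symmetric:
  fixes A :: "real mat"
  assumes A: "A \<in> carrier_mat n n" and sym: "transpose_mat A = A"
  shows "transpose_mat (A ^\<^sub>m k) = A ^\<^sub>m k"
proof (induction k)
  case 0
  then show ?case using A by simp
next
  case (Suc k)
  have "transpose_mat (A ^\<^sub>m Suc k) = A * A ^\<^sub>m k"
    using transpose_mult[OF pow_carrier_mat[OF A, of k] A] Suc sym by simp
  then show ?case using pow_mat_commute[OF A] by simp
qed

lemma mat_trace_add:
  "A \<in> carrier_mat n n \<Longrightarrow> B \<in> carrier_mat n n \<Longrightarrow> mat_trace (A + B) = mat_trace A + mat_trace B"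
  by (simp add: mat_trace_def sum.distrib)

text \<open>Under the trace the k positions of \<open>B\<close> become equal by cyclicity. The extra
  power of \<open>A\<close> is what the induction needs, since each Leibniz step leaves one factor
  \<open>A\<close> to the right of the derivative.\<close>

lemma trace_power_derivative_mult:
  assumes A: "A \<in> carrier_mat n n" and B: "B \<in> carrier_mat n n"
  shows "mat_trace (power_derivative n A B k * A ^\<^sub>m j) = real k * mat_trace (A ^\<^sub>m (k + j - 1) * B)"
proof (induction k arbitrary: j)
  case 0
  have "0\<^sub>m n n * A ^\<^sub>m j = 0\<^sub>m n n"
    by (rule left_mult_zero_mat[OF pow_carrier_mat[OF A]])
  then show ?case by (simp add: mat_trace_def)
next
  case (Suc k)
  let ?D = "power_derivative n A B k"
  note c = pow_carrier_mat[OF A] power_derivative_carrier[OF A B, of k]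
  have d: "?D * A \<in> carrier_mat n n" "A ^\<^sub>m k * B \<in> carrier_mat n n"
    using mult_carrier_mat[OF c(2) A] mult_carrier_mat[OF c(1) B] by auto
  have "power_derivative n A B (Suc k) * A ^\<^sub>m j = ?D * A * A ^\<^sub>m j + A ^\<^sub>m k * B * A ^\<^sub>m j"
    unfolding power_derivative.simps by (rule add_mult_distrib_mat[OF d c(1)])
  also have "mat_trace \<dots> = mat_trace (?D * A * A ^\<^sub>m j) + mat_trace (A ^\<^sub>m k * B * A ^\<^sub>m j)"
    by (rule mat_trace_add[OF mult_carrier_mat[OF d(1) c(1)] mult_carrier_mat[OF d(2) c(1)]])
  also have "?D * A * A ^\<^sub>m j = ?D * A ^\<^sub>m Suc j"
    using assoc_mult_mat[OF c(2) A c(1), of j] pow_mat_commute[OF A, of j] by simp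
  also have "mat_trace (A ^\<^sub>m k * B * A ^\<^sub>m j) = mat_trace (A ^\<^sub>m j * (A ^\<^sub>m k * B))"
    by (rule trace_mult_commute[of _ n n]) (use c B in \<open>auto intro!: mult_carrier_mat[of _ n n]\<close>)
  also have "A ^\<^sub>m j * (A ^\<^sub>m k * B) = A ^\<^sub>m (k + j) * B"
    using assoc_mult_mat[OF c(1) c(1) B, of j k] pow_mat_add[OF A, of j k] by (simp add: add.commute)
  finally show ?case unfolding Suc by (simp add: algebra_simps)
qed

lemma trace_power_derivative:
  assumes A: "A \<in> carrier_mat n n" and B: "B \<in> carrier_mat n n"
  shows "mat_trace (power_derivative n A B k) = real k * mat_trace (A ^\<^sub>m (k - 1) * B)"
proof -
  have "power_derivative n A B k * A ^\<^sub>m 0 = power_derivative n A B k"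
    using right_mult_one_mat[OF power_derivative_carrier[OF A B]] A by simp
  then show ?thesis using trace_power_derivative_mult[OF A B, of k 0] by (simp only: add_0_right)
qed

lemma index_mult_mat_sum:
  fixes A B :: "real mat"
  assumes "A \<in> carrier_mat n n" "B \<in> carrier_mat n n" "i < n" "j < n"
  shows "(A * B) $$ (i, j) = (\<Sum>l<n. A $$ (i, l) * B $$ (l, j))"
  using assms by (simp add: scalar_prod_def lessThan_atLeast0)

lemma trace_mult:
  fixes A B :: "real mat"
  assumes "A \<in> carrier_mat n n" "B \<in> carrier_mat n n"
  shows "mat_trace (A * B) = (\<Sum>i<n. \<Sum>j<n. A $$ (i, j) * B $$ (j, i))"
proof -
  have "dim_row (A * B) = n" using assms by simp
  then show ?thesis unfolding mat_trace_def
    by (simp only:) (intro sum.cong refl index_mult_mat_sum assms, auto)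
qed

lemma (in prob_space) smooth_family_pow_mat:
  assumes c: "\<And>t x. A t x \<in> carrier_mat n n" "\<And>t x. B t x \<in> carrier_mat n n"
    and s: "\<And>i j. i < n \<Longrightarrow> j < n \<Longrightarrow> smooth_family (\<lambda>t x. A t x $$ (i, j)) (\<lambda>t x. B t x $$ (i, j))"
    and "i < n" "j < n"
  shows "smooth_family (\<lambda>t x. (A t x ^\<^sub>m k) $$ (i, j)) (\<lambda>t x. power_derivative n (A t x) (B t x) k $$ (i, j))"
  using \<open>j < n\<close>
proof (induction k arbitrary: j)
  case 0
  have "(A t x ^\<^sub>m 0) $$ (i, j) = (if i = j then 1 else 0)" for t x
    using c(1)[of t x] 0 \<open>i < n\<close> by simp
  then show ?case using smooth_family_const[of "\<lambda>_. if i = j then 1 else 0"] 0 \<open>i < n\<close> by simp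
next
  case (Suc k)
  have "smooth_family (\<lambda>t x. \<Sum>l<n. (A t x ^\<^sub>m k) $$ (i, l) * A t x $$ (l, j))
     (\<lambda>t x. \<Sum>l<n. power_derivative n (A t x) (B t x) k $$ (i, l) * A t x $$ (l, j)
       + (A t x ^\<^sub>m k) $$ (i, l) * B t x $$ (l, j))"
    by (intro smooth_family_sum smooth_family_mult) (use Suc s in auto)
  moreover have "(A t x ^\<^sub>m Suc k) $$ (i, j) = (\<Sum>l<n. (A t x ^\<^sub>m k) $$ (i, l) * A t x $$ (l, j))" for t x
    unfolding pow_mat.simps by (rule index_mult_mat_sum) (use c \<open>i < n\<close> Suc.prems in auto)
  moreover have "power_derivative n (A t x) (B t x) (Suc k) $$ (i, j) =
      (\<Sum>l<n. power_derivative n (A t x) (B t x) k $$ (i, l) * A t x $$ (l, j)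
       + (A t x ^\<^sub>m k) $$ (i, l) * B t x $$ (l, j))" for t x
  proof -
    have "power_derivative n (A t x) (B t x) (Suc k) $$ (i, j) =
        (power_derivative n (A t x) (B t x) k * A t x) $$ (i, j) + (A t x ^\<^sub>m k * B t x) $$ (i, j)"
      using c[of t x] \<open>i < n\<close> Suc.prems by (simp del: index_mult_mat(1))
    then show ?thesis
      using c[of t x] \<open>i < n\<close> Suc.prems
      by (simp add: index_mult_mat_sum[of _ n] sum.distrib del: index_mult_mat(1))
  qed
  ultimately show ?case by simp
qed

lemma poly_fun_pow_mat:
  assumes c: "\<And>z. A z \<in> carrier_mat n n"
    and s: "\<And>i j. i < n \<Longrightarrow> j < n \<Longrightarrow> poly_fun I (\<lambda>z. A z $$ (i, j))"
    and "i < n" "j < n"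
  shows "poly_fun I (\<lambda>z. (A z ^\<^sub>m k) $$ (i, j))"
  using \<open>j < n\<close>
proof (induction k arbitrary: j)
  case 0
  have "(A z ^\<^sub>m 0) $$ (i, j) = (if i = j then 1 else 0)" for z
    using c[of z] 0 \<open>i < n\<close> by simp
  then show ?case using poly_fun_const[of I "if i = j then 1 else 0"] by simp
next
  case (Suc k)
  have "(A z ^\<^sub>m Suc k) $$ (i, j) = (\<Sum>l<n. (A z ^\<^sub>m k) $$ (i, l) * A z $$ (l, j))" for z
    unfolding pow_mat.simps by (rule index_mult_mat_sum) (use c \<open>i < n\<close> Suc.prems in auto)
  moreover have "poly_fun I (\<lambda>z. \<Sum>l<n. (A z ^\<^sub>m k) $$ (i, l) * A z $$ (l, j))"
    by (intro poly_fun_sum poly_fun_mult) (use Suc s in auto)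
  ultimately show ?case by simp
qed

lemma band_index: "i < n \<Longrightarrow> j < n \<Longrightarrow>
    band n b z $$ (i, j) = (if relevant n b i j then 1 / sqrt (real b) * z {i, j} else 0)"
  by (simp add: band_def)

text \<open>The larger of |d| and pi |w| replaces the other. The factor 1/2 on the right allows the
  expected d-term to be absorbed later.\<close>

lemma young_even_power:
  fixes d w :: real
  shows "pi / 2 * (\<bar>d\<bar> ^ (2 * p + 1) * \<bar>w\<bar>) \<le> (d ^ (2 * p + 2) + (pi * w) ^ (2 * p + 2)) / 2"
proof -
  have e: "x ^ (2 * p + 2) = \<bar>x\<bar> ^ (2 * p + 1) * \<bar>x\<bar>" for x :: real
  proof -
    have "x ^ (2 * p + 2) = \<bar>x\<bar> ^ (2 * p + 2)"
      using power_even_abs[of "2 * p + 2" x] by simp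
    then show ?thesis by simp
  qed
  have a: "\<bar>pi * w\<bar> = pi * \<bar>w\<bar>" by (simp add: abs_mult)
  have l: "pi / 2 * (\<bar>d\<bar> ^ (2 * p + 1) * \<bar>w\<bar>) = \<bar>d\<bar> ^ (2 * p + 1) * (pi * \<bar>w\<bar>) / 2" by simp
  have half: "x / 2 \<le> (y + z) / 2" "x / 2 \<le> (z + y) / 2" if "x \<le> y" "0 \<le> z" for x y z :: real
    using that by simp_all
  have nn: "0 \<le> \<bar>x\<bar> ^ (2 * p + 1) * \<bar>x\<bar>" for x :: real by simp
  show ?thesis
  proof (cases "pi * \<bar>w\<bar> \<le> \<bar>d\<bar>")
    case True
    then have "\<bar>d\<bar> ^ (2 * p + 1) * (pi * \<bar>w\<bar>) \<le> \<bar>d\<bar> ^ (2 * p + 1) * \<bar>d\<bar>"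
      by (intro mult_left_mono) auto
    then show ?thesis unfolding e l using nn[of "pi * w"] by (rule half(1))
  next
    case False
    then have "\<bar>d\<bar> ^ (2 * p + 1) * (pi * \<bar>w\<bar>) \<le> \<bar>pi * w\<bar> ^ (2 * p + 1) * \<bar>pi * w\<bar>"
      unfolding a by (intro mult_right_mono power_mono) auto
    then show ?thesis unfolding e l using nn[of d] by (rule half(2))
  qed
qed

text \<open>Jensen's inequality for the uniform distribution on the list; it later moves a power of
  a spectral moment into the exponent of the eigenvalues.\<close>

lemma average_power_le:
  assumes "xs \<noteq> []" "\<And>x. x \<in> set xs \<Longrightarrow> f x \<ge> 0"
  shows "average f xs ^ p \<le> average (\<lambda>x. f x ^ p) xs"
proof -
  let ?n = "real (length xs)"
  have n: "?n > 0" using assms(1) by simp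
  have s: "average g xs = (\<Sum>i<length xs. (1 / ?n) * g (xs ! i))" for g
    by (simp add: average_def sum_list_sum_nth atLeast0LessThan sum_divide_distrib)
  have "(\<Sum>i<length xs. (1 / ?n) *\<^sub>R f (xs ! i)) ^ p \<le> (\<Sum>i<length xs. (1 / ?n) * f (xs ! i) ^ p)"
  proof (rule convex_on_sum[where C = "{0..}" and f = "\<lambda>x. x ^ p"])
    show "convex_on {0..} (\<lambda>x :: real. x ^ p)"
      by (cases "even p") (auto intro: convex_power_odd convex_on_subset[OF convex_power_even])
    show "{..<length xs} \<noteq> {}" using assms(1) by (simp add: lessThan_empty_iff)
    show "(\<Sum>i<length xs. 1 / ?n) = 1" using n by simp
    show "f (xs ! i) \<in> {0..}" if "i \<in> {..<length xs}" for i using assms(2) that by simp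
  qed simp_all
  then show ?thesis unfolding s by simp
qed

lemma edge_in_edges: "i < n \<Longrightarrow> j < n \<Longrightarrow> {i, j} \<in> edges n"
  unfolding edges_def mem_Collect_eq by (rule exI[of _ i], rule exI[of _ j]) simp

context correlated_field
begin

lemma band_moment_average:
  "band_moment n b k z = average (\<lambda>x. x ^ k) (eigenvalue_list (band n b z))"
  unfolding band_moment_def average_def
  using eigenvalue_list_moments[OF band_carrier[of n b z] band_symmetric[of n b z]] by simp

lemma band_moment_power_le: "band_moment n b (2 * m) z ^ p \<le> band_moment n b (2 * m * p) z"
proof -
  have "eigenvalue_list (band n b z) \<noteq> []"
    using eigenvalue_list_moments(1)[OF band_carrier band_symmetric, of n b z] n by auto
  from average_power_le[OF this, of "\<lambda>x. x ^ (2 * m)" p]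
  show ?thesis unfolding band_moment_average by (simp add: power_mult)
qed

lemma L_nonempty: "L \<noteq> {}"
  using Z[OF edge_in_edges[of 0 n 0]] n by fastforce

text \<open>The 2 is there because an edge belongs to up to two index pairs.\<close>
lemma variance_linear_le:
  "expectation (\<lambda>\<omega>. (\<Sum>a\<in>{..<n} \<times> {..<n}. c a * Z {fst a, snd a} \<omega>)\<^sup>2)
    \<le> (2 + (real n)\<^sup>2 * \<delta>) * (\<Sum>a\<in>{..<n} \<times> {..<n}. (c a)\<^sup>2)"
proof -
  let ?I = "{..<n} \<times> {..<n}"
  define z where "z a = {fst a, snd a}" for a :: "nat \<times> nat"
  define C where "C a a' = expectation (\<lambda>\<omega>. Z (z a) \<omega> * Z (z a') \<omega>)" for a a'
  have z: "z a \<in> edges n" if "a \<in> ?I" for a using that by (auto simp: z_def intro!: edge_in_edges)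
  have int: "integrable M (\<lambda>\<omega>. Z (z a) \<omega> * Z (z a') \<omega>)" if "a \<in> ?I" "a' \<in> ?I" for a a'
    using that by (intro all_moments_integrable all_moments_mult space_moments Z z)
  have C: "\<bar>C a a'\<bar> \<le> (if z a' = z a then 1 else 0) + \<delta>" if "a \<in> ?I" "a' \<in> ?I" for a a'
    using var[OF z[OF that(1)]] cov[OF z[OF that(1)] z[OF that(2)]] \<delta> by (auto simp: C_def)
  have sC: "(\<Sum>a'\<in>?I. \<bar>C a a'\<bar>) \<le> 2 + (real n)\<^sup>2 * \<delta>" if a: "a \<in> ?I" for a
  proof -
    have "(\<Sum>a'\<in>?I. \<bar>C a a'\<bar>) \<le> (\<Sum>a'\<in>?I. (if z a' = z a then 1 else 0) + \<delta>)"
      by (rule sum_mono) (rule C[OF a])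
    also have "\<dots> = real (card {a' \<in> ?I. z a' = z a}) + (real n)\<^sup>2 * \<delta>"
      by (simp add: sum.distrib power2_eq_square sum.If_cases Int_def conj_commute)
    also have "card {a' \<in> ?I. z a' = z a} \<le> card {a, (snd a, fst a)}"
      by (rule card_mono) (auto simp: z_def doubleton_eq_iff)
    also have "card {a, (snd a, fst a)} \<le> 2" by (simp add: card_insert_if)
    finally show ?thesis by simp
  qed
  have sym: "C a a' = C a' a" for a a' by (simp add: C_def mult.commute)
  have "expectation (\<lambda>\<omega>. (\<Sum>a\<in>?I. c a * Z {fst a, snd a} \<omega>)\<^sup>2)
      = expectation (\<lambda>\<omega>. \<Sum>a\<in>?I. \<Sum>a'\<in>?I. (c a * c a') * (Z (z a) \<omega> * Z (z a') \<omega>))"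
    by (simp add: power2_eq_square sum_product z_def mult_ac)
  also have "\<dots> = (\<Sum>a\<in>?I. \<Sum>a'\<in>?I. c a * c a' * C a a')"
  proof -
    have int': "integrable M (\<lambda>\<omega>. (c a * c a') * (Z (z a) \<omega> * Z (z a') \<omega>))" if "a \<in> ?I" "a' \<in> ?I" for a a'
      using int[OF that] by (rule integrable_mult_right)
    have "expectation (\<lambda>\<omega>. \<Sum>a\<in>?I. \<Sum>a'\<in>?I. (c a * c a') * (Z (z a) \<omega> * Z (z a') \<omega>))
        = (\<Sum>a\<in>?I. expectation (\<lambda>\<omega>. \<Sum>a'\<in>?I. (c a * c a') * (Z (z a) \<omega> * Z (z a') \<omega>)))"
      by (rule Bochner_Integration.integral_sum) (intro Bochner_Integration.integrable_sum int')
    also have "\<dots> = (\<Sum>a\<in>?I. \<Sum>a'\<in>?I. expectation (\<lambda>\<omega>. (c a * c a') * (Z (z a) \<omega> * Z (z a') \<omega>)))"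
      by (intro sum.cong refl Bochner_Integration.integral_sum int')
    also have "\<dots> = (\<Sum>a\<in>?I. \<Sum>a'\<in>?I. c a * c a' * C a a')"
      unfolding C_def by (intro sum.cong refl integral_mult_right_zero)
    finally show ?thesis .
  qed
  \<comment> \<open>Schur test: splitting the product c a * c a' symmetrically leaves only row sums
    of |C|, which \<open>sC\<close> bounds.\<close>
  also have "\<dots> \<le> (\<Sum>a\<in>?I. \<Sum>a'\<in>?I. ((c a)\<^sup>2 * \<bar>C a a'\<bar> + (c a')\<^sup>2 * \<bar>C a' a\<bar>) / 2)"
  proof (intro sum_mono)
    fix a a'
    have "c a * c a' * C a a' \<le> \<bar>c a * c a'\<bar> * \<bar>C a a'\<bar>" by (metis abs_ge_self abs_mult)
    also have "\<dots> \<le> (((c a)\<^sup>2 + (c a')\<^sup>2) / 2) * \<bar>C a a'\<bar>"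
      using sum_squares_bound[of "\<bar>c a\<bar>" "\<bar>c a'\<bar>"] by (intro mult_right_mono) (auto simp: abs_mult)
    finally show "c a * c a' * C a a' \<le> ((c a)\<^sup>2 * \<bar>C a a'\<bar> + (c a')\<^sup>2 * \<bar>C a' a\<bar>) / 2"
      using sym[of a a'] by (simp add: algebra_simps add_divide_distrib)
  qed
  also have "\<dots> = ((\<Sum>a\<in>?I. \<Sum>a'\<in>?I. (c a)\<^sup>2 * \<bar>C a a'\<bar>) + (\<Sum>a\<in>?I. \<Sum>a'\<in>?I. (c a')\<^sup>2 * \<bar>C a' a\<bar>)) / 2"
    by (simp only: sum_divide_distrib[symmetric] sum.distrib)
  also have "(\<Sum>a\<in>?I. \<Sum>a'\<in>?I. (c a')\<^sup>2 * \<bar>C a' a\<bar>) = (\<Sum>a\<in>?I. \<Sum>a'\<in>?I. (c a)\<^sup>2 * \<bar>C a a'\<bar>)"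
    by (rule sum.swap)
  also have "((\<Sum>a\<in>?I. \<Sum>a'\<in>?I. (c a)\<^sup>2 * \<bar>C a a'\<bar>) + (\<Sum>a\<in>?I. \<Sum>a'\<in>?I. (c a)\<^sup>2 * \<bar>C a a'\<bar>)) / 2
      = (\<Sum>a\<in>?I. (c a)\<^sup>2 * (\<Sum>a'\<in>?I. \<bar>C a a'\<bar>))"
  proof -
    have "(x + x) / 2 = x" for x :: real by simp
    then show ?thesis by (simp only: sum_distrib_left)
  qed
  also have "\<dots> \<le> (\<Sum>a\<in>?I. (c a)\<^sup>2 * (2 + (real n)\<^sup>2 * \<delta>))"
    by (intro sum_mono mult_left_mono sC) auto
  also have "\<dots> = (2 + (real n)\<^sup>2 * \<delta>) * (\<Sum>a\<in>?I. (c a)\<^sup>2)"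
    by (simp add: sum_distrib_left mult.commute)
  finally show ?thesis .
qed

end

section \<open>Concentration of the spectral moments\<close>

lemma poly_fun_band:
  assumes "i < n" "j < n"
  shows "poly_fun (UNIV \<times> edges n) (\<lambda>z. band n b (\<lambda>e. z (c, e)) $$ (i, j))"
proof (cases "relevant n b i j")
  case True
  have "poly_fun (UNIV \<times> edges n) (\<lambda>z. 1 / sqrt (real b) * z (c, {i, j}))"
    by (intro poly_fun_mult poly_fun_const poly_fun_var) (use edge_in_edges[OF assms] in simp)
  then show ?thesis using True by (simp add: band_index[OF assms])
next
  case False
  then show ?thesis using poly_fun_const by (simp add: band_index[OF assms])
qed

context correlated_field
begin

text \<open>A path from the first copy at t = 0 to the second at t = pi/2 along which the
  covariances stay the same; \<open>rot'\<close> is its velocity.\<close>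

definition rot :: "real \<Rightarrow> nat set \<Rightarrow> 'w \<times> 'w \<Rightarrow> real" where
  "rot t e x = cos t * Z e (fst x) + sin t * Z e (snd x)"

definition rot' :: "real \<Rightarrow> nat set \<Rightarrow> 'w \<times> 'w \<Rightarrow> real" where
  "rot' t e x = - sin t * Z e (fst x) + cos t * Z e (snd x)"

text \<open>The derivative of the moment along the rotation. At t = 0 it is the gradient at the
  first copy paired with the second copy, hence linear in the latter.\<close>

definition grad :: "nat \<Rightarrow> real \<Rightarrow> 'w \<times> 'w \<Rightarrow> real" where
  "grad k t x = real k / real n *
    mat_trace (band n b (\<lambda>e. rot t e x) ^\<^sub>m (k - 1) * band n b (\<lambda>e. rot' t e x))"

sublocale P: pair_prob_space M M
  by (rule pair_prob_space_self)

sublocale PG: gaussian_space "M \<Otimes>\<^sub>M M" "product_space L"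
  by (rule gaussian_product_space)

lemma rot_in_space:
  assumes "e \<in> edges n"
  shows "rot t e \<in> product_space L" "rot' t e \<in> product_space L"
proof -
  have "(\<lambda>x. (\<lambda>\<omega>. c * Z e \<omega>) (fst x) + (\<lambda>\<omega>. d * Z e \<omega>) (snd x)) \<in> product_space L" for c d
    unfolding product_space_def mem_Collect_eq
    by (intro exI[of _ "\<lambda>\<omega>. c * Z e \<omega>"] exI[of _ "\<lambda>\<omega>. d * Z e \<omega>"]) (use space_scale[OF Z[OF assms]] in simp)
  from this[of "cos t" "sin t"] this[of "- sin t" "cos t"]
  show "rot t e \<in> product_space L" "rot' t e \<in> product_space L"
    by (simp_all add: rot_def[abs_def] rot'_def[abs_def])
qed

lemma product_covariance:
  assumes e: "e \<in> edges n" and f: "f \<in> edges n"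
  shows "P.expectation (\<lambda>x. (c * Z e (fst x) + d * Z e (snd x)) * (c' * Z f (fst x) + d' * Z f (snd x)))
    = (c * c' + d * d') * expectation (\<lambda>\<omega>. Z e \<omega> * Z f \<omega>)"
proof -
  note m = space_moments[OF Z[OF e]] space_moments[OF Z[OF f]]
  have i: "integrable M (Z e)" "integrable M (Z f)" "integrable M (\<lambda>\<omega>. Z e \<omega> * Z f \<omega>)"
    by (intro all_moments_integrable all_moments_mult m)+
  have o: "integrable M (\<lambda>\<omega>. 1 :: real)" by simp
  note ip = integral_product[OF i(3) o] integral_product[OF o i(3)] integral_product[OF i(1,2)] integral_product[OF i(2,1)]
  have "P.expectation (\<lambda>x. (c * Z e (fst x) + d * Z e (snd x)) * (c' * Z f (fst x) + d' * Z f (snd x)))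
      = P.expectation (\<lambda>x. c * c' * ((Z e (fst x) * Z f (fst x)) * 1) + d * d' * (1 * (Z e (snd x) * Z f (snd x)))
          + c * d' * (Z e (fst x) * Z f (snd x)) + d * c' * (Z f (fst x) * Z e (snd x)))"
    by (rule Bochner_Integration.integral_cong) (auto simp: algebra_simps)
  also have "\<dots> = (c * c' + d * d') * expectation (\<lambda>\<omega>. Z e \<omega> * Z f \<omega>)"
    using ip space_mean[OF Z[OF e]] space_mean[OF Z[OF f]] by (simp add: prob_space algebra_simps)
  finally show ?thesis .
qed

lemma smooth_family_rot:
  assumes "e \<in> edges n"
  shows "P.smooth_family (\<lambda>t x. rot t e x) (\<lambda>t x. rot' t e x)"
proof -
  note m = all_moments_lift[OF space_moments[OF Z[OF assms]]]
  have "P.smooth_family (\<lambda>t x. cos t * Z e (fst x) + sin t * Z e (snd x))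
      (\<lambda>t x. (- sin t) * Z e (fst x) + cos t * Z e (snd x))"
    by (intro P.smooth_family.add P.smooth_family.base m) (auto intro: DERIV_cos DERIV_sin)
  then show ?thesis by (simp add: rot_def rot'_def)
qed

lemma smooth_family_moment:
  "P.smooth_family (\<lambda>t x. band_moment n b k (\<lambda>e. rot t e x)) (grad k)"
proof -
  let ?A = "\<lambda>t x. band n b (\<lambda>e. rot t e x)" and ?B = "\<lambda>t x. band n b (\<lambda>e. rot' t e x)"
  have entry: "P.smooth_family (\<lambda>t x. ?A t x $$ (i, j)) (\<lambda>t x. ?B t x $$ (i, j))" if "i < n" "j < n" for i j
  proof (cases "relevant n b i j")
    case True
    then show ?thesis
      using P.smooth_family_cmult[OF smooth_family_rot[OF edge_in_edges[OF that]], of "1 / sqrt (real b)"]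
      by (simp add: band_index[OF that])
  next
    case False
    then show ?thesis using P.smooth_family_const[of "\<lambda>_. 0"] by (simp add: band_index[OF that])
  qed
  have pw: "P.smooth_family (\<lambda>t x. (?A t x ^\<^sub>m k) $$ (i, i)) (\<lambda>t x. power_derivative n (?A t x) (?B t x) k $$ (i, i))"
    if "i < n" for i
    by (rule P.smooth_family_pow_mat[OF _ _ entry that that]) simp_all
  have "P.smooth_family (\<lambda>t x. 1 / real n * (\<Sum>i<n. (?A t x ^\<^sub>m k) $$ (i, i)))
      (\<lambda>t x. 1 / real n * (\<Sum>i<n. power_derivative n (?A t x) (?B t x) k $$ (i, i)))"
    by (intro P.smooth_family_cmult P.smooth_family_sum pw) auto
  moreover have "1 / real n * (\<Sum>i<n. power_derivative n (?A t x) (?B t x) k $$ (i, i)) = grad k t x" for t x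
  proof -
    have "(\<Sum>i<n. power_derivative n (?A t x) (?B t x) k $$ (i, i)) = mat_trace (power_derivative n (?A t x) (?B t x) k)"
      using carrier_matD(1)[OF power_derivative_carrier[OF band_carrier[of n b "\<lambda>e. rot t e x"]
          band_carrier[of n b "\<lambda>e. rot' t e x"]], of k]
      by (simp only: mat_trace_def)
    also have "\<dots> = real k * mat_trace (?A t x ^\<^sub>m (k - 1) * ?B t x)"
      by (rule trace_power_derivative) simp_all
    finally show ?thesis by (simp add: grad_def)
  qed
  moreover have "1 / real n * (\<Sum>i<n. (?A t x ^\<^sub>m k) $$ (i, i)) = band_moment n b k (\<lambda>e. rot t e x)" for t x
  proof -
    have "dim_row (?A t x) = n" using band_carrier[of n b "\<lambda>e. rot t e x"] by (rule carrier_matD)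
    then show ?thesis by (simp add: band_moment_def mat_trace_def)
  qed
  ultimately show ?thesis by simp
qed

text \<open>The covariance of the pair \<open>(rot t, rot' t)\<close> does not depend on \<open>t\<close>.\<close>
lemma expectation_grad_power:
  "P.expectation (\<lambda>x. grad k t x ^ p) = P.expectation (\<lambda>x. grad k 0 x ^ p)"
proof -
  \<comment> \<open>The Boolean tag joins the field and its velocity into one Gaussian family, of
    which the power of the derivative is a polynomial.\<close>
  define Q where "Q z = (real k / real n * mat_trace (band n b (\<lambda>e. z (True, e)) ^\<^sub>m (k - 1) * band n b (\<lambda>e. z (False, e)))) ^ p"
    for z :: "bool \<times> nat set \<Rightarrow> real"
  define W where "W t c = (if fst c then rot t (snd c) else rot' t (snd c))" for t and c :: "bool \<times> nat set"
  have entry: "poly_fun (UNIV \<times> edges n) (\<lambda>z. (band n b (\<lambda>e. z (True, e)) ^\<^sub>m (k - 1)) $$ (i, j))"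
    if "i < n" "j < n" for i j
    by (rule poly_fun_pow_mat[OF _ poly_fun_band that]) auto
  have "poly_fun (UNIV \<times> edges n) (\<lambda>z. (real k / real n * (\<Sum>i<n. \<Sum>j<n.
      (band n b (\<lambda>e. z (True, e)) ^\<^sub>m (k - 1)) $$ (i, j) * band n b (\<lambda>e. z (False, e)) $$ (j, i))) ^ p)"
    by (intro poly_fun_power poly_fun_mult poly_fun_const poly_fun_sum entry poly_fun_band) auto
  then have Q: "poly_fun (UNIV \<times> edges n) Q"
    unfolding Q_def by (subst trace_mult[of _ n]) auto
  have "P.expectation (\<lambda>x. Q (\<lambda>c. W t c x)) = P.expectation (\<lambda>x. Q (\<lambda>c. W 0 c x))"
  proof (rule PG.expectation_poly_fun_cong[OF Q])
    fix c d :: "bool \<times> nat set" assume c: "c \<in> UNIV \<times> edges n" and d: "d \<in> UNIV \<times> edges n"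
    have W: "W t c \<in> product_space L" if "c \<in> UNIV \<times> edges n" for t c
      using that rot_in_space[of "snd c" t] by (auto simp: W_def)
    show "W t c \<in> product_space L" "W 0 c \<in> product_space L" using W c by auto
    have pc: "P.expectation (\<lambda>x. W t c x * W t d x)
        = (if fst c = fst d then 1 else 0) * expectation (\<lambda>\<omega>. Z (snd c) \<omega> * Z (snd d) \<omega>)" for t
    proof -
      have cd: "snd c \<in> edges n" "snd d \<in> edges n" using c d by auto
      have "cos t * cos t + sin t * sin t = 1" "sin t * sin t + cos t * cos t = 1"
        using sin_cos_squared_add[of t] by (simp_all add: power2_eq_square)
      then show ?thesis
        using product_covariance[OF cd, of "cos t" "sin t" "cos t" "sin t"]
          product_covariance[OF cd, of "cos t" "sin t" "- sin t" "cos t"]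
          product_covariance[OF cd, of "- sin t" "cos t" "cos t" "sin t"]
          product_covariance[OF cd, of "- sin t" "cos t" "- sin t" "cos t"]
        by (cases "fst c"; cases "fst d") (simp_all add: W_def rot_def rot'_def mult.commute)
    qed
    show "P.expectation (\<lambda>x. W t c x * W t d x) = P.expectation (\<lambda>x. W 0 c x * W 0 d x)"
      unfolding pc ..
  qed
  then show ?thesis by (simp add: Q_def W_def grad_def)
qed

text \<open>One factor of the difference is an increment of the moment along the rotation; the other
  factors are frozen in \<open>G\<close>. The mean value theorem, applied to the expectation, yields
  one angle z, and which one is irrelevant because the moments of the derivative do not depend on
  it.\<close>

lemma even_moment_difference_le:
  "P.expectation (\<lambda>x. (mom k (fst x) - mom k (snd x)) ^ (2 * p + 2))
    \<le> pi ^ (2 * p + 2) * P.expectation (\<lambda>x. grad k 0 x ^ (2 * p + 2))"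
proof -
  define D where "D x = mom k (fst x) - mom k (snd x)" for x :: "'w \<times> 'w"
  define G where "G x = D x ^ (2 * p + 1)" for x
  define \<phi> where "\<phi> t = P.expectation (\<lambda>x. G x * band_moment n b k (\<lambda>e. rot t e x))" for t
  note lift = all_moments_lift[OF all_moments_mom]
  have aD: "P.all_moments D" unfolding D_def by (intro P.all_moments_diff lift)
  have aG: "P.all_moments G" unfolding G_def by (intro P.all_moments_power aD)
  have ag: "P.all_moments (grad k t)" for t
    by (rule P.smooth_family_all_moments(2)[OF smooth_family_moment])
  have "(\<phi> has_real_derivative P.expectation (\<lambda>x. G x * grad k t x)) (at t)" for t
    using P.smooth_family_derivative[OF P.smooth_family_mult[OF P.smooth_family_const[OF aG] smooth_family_moment]]
    by (simp add: \<phi>_def[abs_def])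
  then have "\<exists>z>0. z < pi / 2 \<and> \<phi> (pi / 2) - \<phi> 0 = (pi / 2 - 0) * P.expectation (\<lambda>x. G x * grad k z x)"
    by (intro MVT2) auto
  then obtain z where z: "\<phi> (pi / 2) - \<phi> 0 = pi / 2 * P.expectation (\<lambda>x. G x * grad k z x)" by auto
  have "P.expectation (\<lambda>x. D x ^ (2 * p + 2)) = P.expectation (\<lambda>x. G x * mom k (fst x) - G x * mom k (snd x))"
    by (rule Bochner_Integration.integral_cong) (auto simp: G_def D_def algebra_simps)
  also have "\<dots> = \<phi> 0 - \<phi> (pi / 2)"
    unfolding \<phi>_def
    by (subst Bochner_Integration.integral_diff)
      (auto simp: rot_def intro!: P.all_moments_integrable P.all_moments_mult aG lift)
  also have "\<dots> = P.expectation (\<lambda>x. - (pi / 2 * (G x * grad k z x)))"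
    using z by simp
  also have "\<dots> \<le> P.expectation (\<lambda>x. (D x ^ (2 * p + 2) + (pi * grad k z x) ^ (2 * p + 2)) / 2)"
  proof (rule integral_mono)
    show "integrable (M \<Otimes>\<^sub>M M) (\<lambda>x. - (pi / 2 * (G x * grad k z x)))"
      by (intro P.all_moments_integrable P.all_moments_uminus P.all_moments_cmult P.all_moments_mult aG ag)
    show "integrable (M \<Otimes>\<^sub>M M) (\<lambda>x. (D x ^ (2 * p + 2) + (pi * grad k z x) ^ (2 * p + 2)) / 2)"
      by (intro integrable_divide Bochner_Integration.integrable_add P.all_moments_integrable
          P.all_moments_power P.all_moments_cmult aD ag)
    fix x
    have "- (pi / 2 * (G x * grad k z x)) \<le> pi / 2 * (\<bar>D x\<bar> ^ (2 * p + 1) * \<bar>grad k z x\<bar>)"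
      using abs_ge_minus_self[of "pi / 2 * (G x * grad k z x)"] by (simp add: G_def abs_mult power_abs)
    also have "\<dots> \<le> (D x ^ (2 * p + 2) + (pi * grad k z x) ^ (2 * p + 2)) / 2" by (rule young_even_power)
    finally show "- (pi / 2 * (G x * grad k z x)) \<le> (D x ^ (2 * p + 2) + (pi * grad k z x) ^ (2 * p + 2)) / 2" .
  qed
  also have "\<dots> = (P.expectation (\<lambda>x. D x ^ (2 * p + 2)) + pi ^ (2 * p + 2) * P.expectation (\<lambda>x. grad k z x ^ (2 * p + 2))) / 2"
  proof -
    have "integrable (M \<Otimes>\<^sub>M M) (\<lambda>x. D x ^ (2 * p + 2))" "integrable (M \<Otimes>\<^sub>M M) (\<lambda>x. grad k z x ^ (2 * p + 2))"
      by (intro P.all_moments_integrable P.all_moments_power aD ag)+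
    then show ?thesis unfolding power_mult_distrib by (simp del: power_Suc)
  qed
  \<comment> \<open>The expectation of D^(2 p + 2) is finite and occurs with factor 1/2 on the
    right, so it can be absorbed on the left.\<close>
  finally show ?thesis
    unfolding expectation_grad_power[of k z] D_def by simp
qed

text \<open>For a fixed first copy the gradient is a centred Gaussian variable of the second, so its
  even moments are powers of its variance. The variance is controlled by the squared Frobenius norm
  of the power k - 1, which by symmetry is the trace of the power 2 (k - 1), again a spectral
  moment.\<close>

lemma grad_0_moment_le:
  "P.expectation (\<lambda>x. grad k 0 x ^ (2 * q)) \<le> (\<Prod>i<q. real (2 * i + 1)) *
    ((2 + (real n)\<^sup>2 * \<delta>) * (real k)\<^sup>2 / (real b * real n)) ^ q * expectation (mom (2 * (k - 1) * q))"
proof -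
  let ?I = "{..<n} \<times> {..<n}"
  define F where "F = (\<Prod>i<q. real (2 * i + 1))"
  have F: "F \<ge> 0" by (simp add: F_def prod_nonneg)
  have b: "b \<ge> 1" using bandwidth_bounds[OF n bw] by simp
  have n0: "real n > 0" using n by simp
  define A where "A \<omega> = band n b (\<lambda>e. Z e \<omega>)" for \<omega>
  have A: "A \<omega> \<in> carrier_mat n n" for \<omega> by (simp add: A_def)
  \<comment> \<open>The trace pairs entry \<open>a\<close> of the power with the transposed position
    of the second matrix, so relevance is tested there.\<close>
  define c where "c \<omega> a = real k / real n * (A \<omega> ^\<^sub>m (k - 1)) $$ a * (if relevant n b (snd a) (fst a) then 1 / sqrt (real b) else 0)"
    for \<omega> and a :: "nat \<times> nat"
  define N where "N = 2 + (real n)\<^sup>2 * \<delta>"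
  have N: "N \<ge> 0" using \<delta> by (simp add: N_def)
  have g: "grad k 0 (\<omega>, \<omega>') = (\<Sum>a\<in>?I. c \<omega> a * Z {fst a, snd a} \<omega>')" for \<omega> \<omega>'
  proof -
    have "grad k 0 (\<omega>, \<omega>') = real k / real n * (\<Sum>i<n. \<Sum>j<n. (A \<omega> ^\<^sub>m (k - 1)) $$ (i, j) * A \<omega>' $$ (j, i))"
      unfolding grad_def using trace_mult[OF pow_carrier_mat[OF A] A] by (simp add: rot_def rot'_def A_def)
    also have "\<dots> = (\<Sum>i<n. \<Sum>j<n. c \<omega> (i, j) * Z {i, j} \<omega>')"
      unfolding sum_distrib_left by (intro sum.cong refl) (auto simp: c_def A_def band_index insert_commute)
    finally show ?thesis by (simp add: sum.cartesian_product case_prod_unfold)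
  qed
  have csum: "(\<Sum>a\<in>?I. (c \<omega> a)\<^sup>2) \<le> (real k)\<^sup>2 / (real b * real n) * mom (2 * (k - 1)) \<omega>" for \<omega>
  proof -
    let ?B = "A \<omega> ^\<^sub>m (k - 1)"
    have B: "?B \<in> carrier_mat n n" using A by simp
    have symB: "?B $$ (j, i) = ?B $$ (i, j)" if "i < n" "j < n" for i j
      using pow_mat_symmetric[OF A, of \<omega> "k - 1"] band_symmetric[of n b "\<lambda>e. Z e \<omega>"] B that
      by (metis A_def index_transpose_mat(1) carrier_matD)
    have "(\<Sum>a\<in>?I. (c \<omega> a)\<^sup>2) \<le> (\<Sum>a\<in>?I. (real k / real n)\<^sup>2 * (1 / real b) * (?B $$ a)\<^sup>2)"
      by (rule sum_mono) (auto simp: c_def power_mult_distrib power_divide mult_ac)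
    also have "\<dots> = (real k / real n)\<^sup>2 * (1 / real b) * (\<Sum>a\<in>?I. (?B $$ a)\<^sup>2)"
      by (simp add: sum_distrib_left)
    also have "(\<Sum>a\<in>?I. (?B $$ a)\<^sup>2) = (\<Sum>i<n. \<Sum>j<n. ?B $$ (i, j) * ?B $$ (j, i))"
      unfolding sum.cartesian_product
    proof (rule sum.cong)
      fix a assume "a \<in> ?I"
      then obtain i j where a: "a = (i, j)" "i < n" "j < n" by auto
      show "(?B $$ a)\<^sup>2 = (case a of (i, j) \<Rightarrow> ?B $$ (i, j) * ?B $$ (j, i))"
        unfolding a(1) using symB[OF a(2,3)] by (simp add: power2_eq_square)
    qed simp
    also have "\<dots> = mat_trace (A \<omega> ^\<^sub>m (2 * (k - 1)))"
      using trace_mult[OF B B] pow_mat_add[OF A, of \<omega> "k - 1" "k - 1"] by (simp add: mult_2)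
    also have "\<dots> = real n * mom (2 * (k - 1)) \<omega>"
      using n0 by (simp add: band_moment_def A_def)
    finally show ?thesis using n0 by (simp add: power2_eq_square field_simps)
  qed
  have inner: "expectation (\<lambda>\<omega>'. grad k 0 (\<omega>, \<omega>') ^ (2 * q))
      \<le> F * (N * (real k)\<^sup>2 / (real b * real n)) ^ q * mom (2 * (k - 1) * q) \<omega>" for \<omega>
  proof -
    have inL: "(\<lambda>\<omega>'. \<Sum>a\<in>?I. c \<omega> a * Z {fst a, snd a} \<omega>') \<in> L"
      by (intro space_sum L_nonempty space_scale Z) (auto intro: edge_in_edges)
    have v: "expectation (\<lambda>\<omega>'. (\<Sum>a\<in>?I. c \<omega> a * Z {fst a, snd a} \<omega>')\<^sup>2)
        \<le> (N * (real k)\<^sup>2 / (real b * real n)) * mom (2 * (k - 1)) \<omega>"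
    proof -
      have "expectation (\<lambda>\<omega>'. (\<Sum>a\<in>?I. c \<omega> a * Z {fst a, snd a} \<omega>')\<^sup>2) \<le> N * (\<Sum>a\<in>?I. (c \<omega> a)\<^sup>2)"
        unfolding N_def by (rule variance_linear_le)
      also have "\<dots> \<le> N * ((real k)\<^sup>2 / (real b * real n) * mom (2 * (k - 1)) \<omega>)"
        by (rule mult_left_mono[OF csum N])
      finally show ?thesis by simp
    qed
    have "expectation (\<lambda>\<omega>'. grad k 0 (\<omega>, \<omega>') ^ (2 * q))
        = F * expectation (\<lambda>\<omega>'. (\<Sum>a\<in>?I. c \<omega> a * Z {fst a, snd a} \<omega>')\<^sup>2) ^ q"
      unfolding g F_def by (rule even_moment[OF inL])
    also have "\<dots> \<le> F * ((N * (real k)\<^sup>2 / (real b * real n)) * mom (2 * (k - 1)) \<omega>) ^ q"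
      by (intro mult_left_mono power_mono v F) simp
    also have "\<dots> = F * (N * (real k)\<^sup>2 / (real b * real n)) ^ q * mom (2 * (k - 1)) \<omega> ^ q"
      by (simp only: power_mult_distrib mult.assoc)
    \<comment> \<open>Convexity over the eigenvalues turns the power of a random moment into a
      single higher moment, whose expectation can then be taken.\<close>
    also have "\<dots> \<le> F * (N * (real k)\<^sup>2 / (real b * real n)) ^ q * mom (2 * (k - 1) * q) \<omega>"
      by (intro mult_left_mono band_moment_power_le) (use F N in simp)
    finally show ?thesis .
  qed
  have ig: "integrable (M \<Otimes>\<^sub>M M) (\<lambda>x. grad k 0 x ^ (2 * q))"
    by (intro P.all_moments_integrable P.all_moments_power P.smooth_family_all_moments(2)[OF smooth_family_moment])
  have "P.expectation (\<lambda>x. grad k 0 x ^ (2 * q)) = expectation (\<lambda>\<omega>. expectation (\<lambda>\<omega>'. grad k 0 (\<omega>, \<omega>') ^ (2 * q)))"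
    by (rule P.integral_fst'[OF ig, symmetric])
  also have "\<dots> \<le> expectation (\<lambda>\<omega>. F * (N * (real k)\<^sup>2 / (real b * real n)) ^ q * mom (2 * (k - 1) * q) \<omega>)"
    by (intro integral_mono inner P.integrable_fst'[OF ig] integrable_mult_right all_moments_integrable all_moments_mom)
  also have "\<dots> = F * (N * (real k)\<^sup>2 / (real b * real n)) ^ q * expectation (mom (2 * (k - 1) * q))"
    by simp
  finally show ?thesis by (simp add: F_def N_def)
qed

text \<open>Averaging over the second copy turns it into the mean, so Jensen's inequality for fixed
  first copy bounds the central moment by a moment of the difference of the two copies.\<close>

lemma concentration:
  "expectation (\<lambda>\<omega>. (mom k \<omega> - expectation (mom k)) ^ (2 * p + 2)) \<le>
    pi ^ (2 * p + 2) * ((\<Prod>i<p + 1. real (2 * i + 1)) *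
    ((2 + (real n)\<^sup>2 * \<delta>) * (real k)\<^sup>2 / (real b * real n)) ^ (p + 1) * expectation (mom (2 * (k - 1) * (p + 1))))"
proof -
  let ?D = "\<lambda>x. (mom k (fst x) - mom k (snd x)) ^ (2 * p + 2)"
  note am = all_moments_mom[of k]
  have iD: "integrable (M \<Otimes>\<^sub>M M) ?D"
    by (intro P.all_moments_integrable P.all_moments_power P.all_moments_diff all_moments_lift am)
  have in1: "(mom k \<omega> - expectation (mom k)) ^ (2 * p + 2) \<le> expectation (\<lambda>\<omega>'. ?D (\<omega>, \<omega>'))" for \<omega>
  proof -
    have "expectation (\<lambda>\<omega>'. mom k \<omega> - mom k \<omega>') = mom k \<omega> - expectation (mom k)"
      using all_moments_integrable[OF am] by (simp add: prob_space)
    moreover have "expectation (\<lambda>\<omega>'. mom k \<omega> - mom k \<omega>') ^ (2 * (p + 1)) \<le> expectation (\<lambda>\<omega>'. (mom k \<omega> - mom k \<omega>') ^ (2 * (p + 1)))"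
      by (intro expectation_power_le all_moments_diff am all_moments_const)
    ultimately show ?thesis by simp
  qed
  have "expectation (\<lambda>\<omega>. (mom k \<omega> - expectation (mom k)) ^ (2 * p + 2)) \<le> expectation (\<lambda>\<omega>. expectation (\<lambda>\<omega>'. ?D (\<omega>, \<omega>')))"
    by (intro integral_mono in1 P.integrable_fst'[OF iD] all_moments_integrable all_moments_power all_moments_diff am all_moments_const)
  also have "\<dots> = P.expectation ?D" by (rule P.integral_fst'[OF iD])
  also have "\<dots> \<le> pi ^ (2 * p + 2) * P.expectation (\<lambda>x. grad k 0 x ^ (2 * (p + 1)))"
    using even_moment_difference_le[of k p] by simp
  also have "\<dots> \<le> pi ^ (2 * p + 2) * ((\<Prod>i<p + 1. real (2 * i + 1)) *
    ((2 + (real n)\<^sup>2 * \<delta>) * (real k)\<^sup>2 / (real b * real n)) ^ (p + 1) * expectation (mom (2 * (k - 1) * (p + 1))))"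
    by (intro mult_left_mono grad_0_moment_le) simp
  finally show ?thesis .
qed

end

section \<open>The semicircle laws\<close>

text \<open>The matrix has size n (n + 1) / 2 \<ge> n^2 / 4, and the resulting factor 4^\<beta> is
  at most 4 because \<beta> is capped at 1.\<close>

lemma covariance_bound:
  assumes S: "S \<in> CovMat \<alpha>" and "\<alpha> > 0" and n: "n \<ge> 1"
    and kl: "k < triangular n" "l < triangular n" "k \<noteq> l"
  shows "\<bar>S (triangular n) $$ (k, l)\<bar> \<le> 4 * real n powr (- 2 * min \<alpha> 1)"
proof -
  define \<beta> where "\<beta> = min \<alpha> 1"
  have \<beta>: "0 \<le> \<beta>" "\<beta> \<le> 1" "\<beta> \<le> \<alpha>" using assms(2) by (auto simp: \<beta>_def)
  define T where "T = real (triangular n)"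
  have "2 * triangular n = n * (n + 1)" by (simp add: triangular_def)
  then have "2 * T = real n * (real n + 1)"
    unfolding T_def by (metis of_nat_1 of_nat_add of_nat_mult of_nat_numeral)
  moreover have "0 \<le> real n * real n" by simp
  ultimately have T: "(real n)\<^sup>2 / 4 \<le> T" unfolding power2_eq_square distrib_left by linarith
  have T1: "T \<ge> 1" using kl(1) by (simp add: T_def)
  have n0: "real n > 0" using n by simp
  have "\<bar>S (triangular n) $$ (k, l)\<bar> \<le> T powr (- \<alpha>)"
    using S kl by (auto simp: CovMat_def T_def)
  also have "\<dots> \<le> T powr (- \<beta>)" using T1 \<beta> by (intro powr_mono) auto
  also have "\<dots> \<le> ((real n)\<^sup>2 / 4) powr (- \<beta>)" using T n0 \<beta> by (intro powr_mono2') auto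
  also have "\<dots> = real n powr (- 2 * \<beta>) * 4 powr \<beta>"
  proof -
    have "((real n)\<^sup>2 / 4) powr (- \<beta>) = (real n)\<^sup>2 powr (- \<beta>) / 4 powr (- \<beta>)"
      by (rule powr_divide)
    moreover have "(real n)\<^sup>2 powr (- \<beta>) = real n powr (- 2 * \<beta>)"
    proof -
      have "(real n)\<^sup>2 = real n powr 2" using n0 by simp
      then show ?thesis by (simp only: powr_powr) simp
    qed
    ultimately show ?thesis by (simp only: powr_minus[of 4 \<beta>] divide_inverse inverse_inverse_eq)
  qed
  also have "\<dots> \<le> real n powr (- 2 * \<beta>) * 4"
    using powr_mono[of \<beta> 1 4] \<beta> by (intro mult_left_mono) auto
  finally show ?thesis by (simp add: \<beta>_def mult.commute)
qed

text \<open>Each edge is represented by its pair with the smaller index in front, where the index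
  map is injective. Distinct edges thus carry distinct components of the Gaussian vector, and only
  off-diagonal covariances arise between them.\<close>

lemma scheme_correlated_field:
  fixes M :: "'w measure"
  assumes "prob_space M" and scheme: "gaussian_scheme M \<alpha> S a" and n: "n \<ge> 1" and bw: "bandwidth n b"
  shows "\<exists>L Z. correlated_field M L n b Z (4 * real n powr (- 2 * min \<alpha> 1)) \<and>
    (\<forall>\<omega>\<in>space M. periodic_band n b (a n \<omega>) = band n b (\<lambda>e. Z e \<omega>))"
proof -
  have \<alpha>: "\<alpha> > 0" and S: "S \<in> CovMat \<alpha>" using scheme by (auto simp: gaussian_scheme_def)
  obtain Y \<phi> where Y: "gaussian_vector M (triangular n) (S (triangular n)) Y" and \<phi>: "index_map n \<phi>"
    and a: "\<And>\<omega>. \<omega> \<in> space M \<Longrightarrow> a n \<omega> = Matrix.mat n n (\<lambda>(i, j). Y (\<phi> (i, j)) \<omega>)"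
    using scheme n by (auto simp: gaussian_scheme_def)
  define Z where "Z e = Y (\<phi> (Min e, Max e))" for e :: "nat set"
  have mm: "Min {i, j} = min i j" "Max {i, j} = max i j" for i j :: nat by simp_all
  have Zij: "Z {i, j} = Y (\<phi> (i, j))" if "i < n" "j < n" for i j
    using \<phi> that by (cases "i \<le> j") (auto simp: Z_def index_map_def min_def max_def)
  have rng: "\<phi> (Min e, Max e) < triangular n" if "e \<in> edges n" for e
  proof -
    have "(Min e, Max e) \<in> {..<n} \<times> {..<n}"
      using that by (auto simp: edges_def)
    then show ?thesis using \<phi> unfolding index_map_def by blast
  qed
  have inj: "e = f" if e: "e \<in> edges n" and f: "f \<in> edges n" and eq: "\<phi> (Min e, Max e) = \<phi> (Min f, Max f)" for e f
  proof -
    have inj: "inj_on \<phi> {(i, j). i < n \<and> j < n \<and> i \<le> j}"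
      using \<phi> by (auto simp: index_map_def bij_betw_def)
    have g: "(Min g, Max g) \<in> {(i, j). i < n \<and> j < n \<and> i \<le> j}" "{Min g, Max g} = g" if g: "g \<in> edges n" for g
    proof -
      obtain i j where "g = {i, j}" "i < n" "j < n" using g by (auto simp: edges_def)
      then show "(Min g, Max g) \<in> {(i, j). i < n \<and> j < n \<and> i \<le> j}" "{Min g, Max g} = g"
        by (cases "i \<le> j"; auto)+
    qed
    have "(Min e, Max e) = (Min f, Max f)" by (rule inj_onD[OF inj eq g(1)[OF e] g(1)[OF f]])
    then have "{Min e, Max e} = {Min f, Max f}" by simp
    then show ?thesis unfolding g(2)[OF e] g(2)[OF f] .
  qed
  interpret gaussian_space M "linear_span (triangular n) Y"
    by (rule gaussian_vector_space[OF assms(1) Y])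
  have cov: "expectation (\<lambda>\<omega>. Z e \<omega> * Z f \<omega>) = S (triangular n) $$ (\<phi> (Min e, Max e), \<phi> (Min f, Max f))"
    if "e \<in> edges n" "f \<in> edges n" for e f
    using Y rng[OF that(1)] rng[OF that(2)] by (simp add: gaussian_vector_def Z_def)
  have t1: "triangular n \<ge> 1" using rng[OF edge_in_edges[of 0 n 0]] n by simp
  have "correlated_field M (linear_span (triangular n) Y) n b Z (4 * real n powr (- 2 * min \<alpha> 1))"
  proof
    fix e assume e: "e \<in> edges n"
    show "Z e \<in> linear_span (triangular n) Y"
      unfolding Z_def by (rule linear_span_base[OF rng[OF e]])
    show "expectation (\<lambda>\<omega>. Z e \<omega> * Z e \<omega>) = 1"
      unfolding cov[OF e e] using S rng[OF e] t1 by (auto simp: CovMat_def)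
    fix f assume f: "f \<in> edges n" and "e \<noteq> f"
    then show "\<bar>expectation (\<lambda>\<omega>. Z e \<omega> * Z f \<omega>)\<bar> \<le> 4 * real n powr (- 2 * min \<alpha> 1)"
      unfolding cov[OF e f] using inj[OF e f] by (intro covariance_bound[OF S \<alpha> n rng[OF e] rng[OF f]]) auto
  qed (use n bw in auto)
  moreover have "periodic_band n b (a n \<omega>) = band n b (\<lambda>e. Z e \<omega>)" if "\<omega> \<in> space M" for \<omega>
  proof -
    have "real b powr (- 1 / 2) = 1 / sqrt (real b)"
      by (simp add: powr_minus powr_half_sqrt inverse_eq_divide minus_divide_left[symmetric])
    then show ?thesis
      unfolding periodic_band_def band_def a[OF that] by (intro eq_matI) (auto simp: Zij)
  qed
  ultimately show ?thesis by blast
qed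

text \<open>Averages of polynomials are combinations of the given moments. Polynomials that
  approximate \<open>f\<close> on growing intervals converge at every entry of a finite list, so the
  average of \<open>f\<close> is a pointwise limit of measurable functions.\<close>

lemma measurable_average_limit:
  fixes xs :: "'w \<Rightarrow> real list" and f :: "real \<Rightarrow> real"
  assumes mom: "\<And>k. (\<lambda>\<omega>. average (\<lambda>x. x ^ k) (xs \<omega>)) \<in> borel_measurable M"
    and f: "continuous_on UNIV f"
  shows "(\<lambda>\<omega>. average f (xs \<omega>)) \<in> borel_measurable M"
proof -
  have "\<exists>g. real_polynomial_function g \<and> (\<forall>x\<in>{- real j..real j}. \<bar>f x - g x\<bar> < 1 / real (Suc j))" for j
  proof -
    have "continuous_on {- real j..real j} f" using f by (rule continuous_on_subset) simp
    then show ?thesis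
    proof (rule Stone_Weierstrass_real_polynomial_function[OF compact_Icc, of _ _ f "1 / real (Suc j)"])
      fix g assume "real_polynomial_function g" "\<And>x. x \<in> {- real j..real j} \<Longrightarrow> \<bar>f x - g x\<bar> < 1 / real (Suc j)"
      then show ?thesis by blast
    qed simp
  qed
  then obtain g where g: "\<And>j. real_polynomial_function (g j)"
    "\<And>j x. x \<in> {- real j..real j} \<Longrightarrow> \<bar>f x - g j x\<bar> < 1 / real (Suc j)"
    by metis
  show ?thesis
  proof (rule borel_measurable_LIMSEQ_real)
    fix j
    obtain c m where "g j = (\<lambda>x. \<Sum>i\<le>m. c i * x ^ i)"
      using g(1)[of j] unfolding real_polynomial_function_iff_sum by blast
    then show "(\<lambda>\<omega>. average (g j) (xs \<omega>)) \<in> borel_measurable M"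
      using mom by (simp add: average_sum average_cmult)
  next
    fix \<omega>
    show "(\<lambda>j. average (g j) (xs \<omega>)) \<longlonglongrightarrow> average f (xs \<omega>)"
    proof (cases "xs \<omega> = []")
      case True
      then show ?thesis by (simp add: average_def)
    next
      case False
      obtain N :: nat where N: "Max (abs ` set (xs \<omega>)) \<le> real N" using real_arch_simple by blast
      have "norm (average (g j) (xs \<omega>) - average f (xs \<omega>)) \<le> 1 / real (Suc j)" if j: "j \<ge> N" for j
      proof -
        have "\<bar>g j x - f x\<bar> \<le> 1 / real (Suc j)" if x: "x \<in> set (xs \<omega>)" for x
        proof -
          have "\<bar>x\<bar> \<le> Max (abs ` set (xs \<omega>))" using x by (intro Max_ge) auto
          then have "\<bar>x\<bar> \<le> real j" using N j by simp
          then have "x \<in> {- real j..real j}" by (simp add: abs_le_iff)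
          from g(2)[OF this] show ?thesis by (subst abs_minus_commute) (rule less_imp_le)
        qed
        then have "\<bar>average (g j) (xs \<omega>) - average f (xs \<omega>)\<bar> \<le> average (\<lambda>x. 1 / real (Suc j)) (xs \<omega>)"
          by (rule average_diff_le)
        then show ?thesis using average_const[OF False, of "1 / real (Suc j)"] by simp
      qed
      then have "eventually (\<lambda>j. norm (average (g j) (xs \<omega>) - average f (xs \<omega>)) \<le> 1 / real (Suc j)) sequentially"
        by (auto simp: eventually_sequentially)
      from Lim_null_comparison[OF this LIMSEQ_Suc[OF lim_1_over_n]]
      show ?thesis by (simp add: LIM_zero_iff)
    qed
  qed
qed

text \<open>Both laws follow from one tail bound with a free even exponent 2 p + 2: p = 0 gives
  probabilities O(1/b), a large p gives summable ones when \<alpha> > 1/2.\<close>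

lemma semicircle_laws:
  fixes M :: "'w measure" and X :: "nat \<Rightarrow> 'w \<Rightarrow> real mat"
  assumes "prob_space M" and scheme: "gaussian_scheme M \<alpha> S a"
    and bw: "\<And>n. n \<ge> 1 \<Longrightarrow> bandwidth n (b n)" and blim: "filterlim b at_top sequentially"
    and X: "\<And>n \<omega>. n \<ge> 1 \<Longrightarrow> \<omega> \<in> space M \<Longrightarrow> X n \<omega> = periodic_band n (b n) (a n \<omega>)"
    and \<alpha>: "\<alpha> \<ge> 1 / 2"
  shows "semicircle_law_in_probability M X"
    and "\<alpha> > 1 / 2 \<Longrightarrow> semicircle_law_almost_surely M X"
proof -
  interpret prob_space M by fact
  define \<beta> where "\<beta> = min \<alpha> 1"
  have \<beta>: "1 / 2 \<le> \<beta>" "\<beta> \<le> 1" using \<alpha> by (auto simp: \<beta>_def)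
  define \<delta> where "\<delta> n = 4 * real n powr (- 2 * \<beta>)" for n :: nat
  have "\<forall>n. \<exists>L Z. n \<ge> 1 \<longrightarrow> correlated_field M L n (b n) Z (\<delta> n) \<and>
      (\<forall>\<omega>\<in>space M. periodic_band n (b n) (a n \<omega>) = band n (b n) (\<lambda>e. Z e \<omega>))"
    using scheme_correlated_field[OF assms(1) scheme _ bw] unfolding \<delta>_def \<beta>_def by blast
  then obtain L Z where field: "\<And>n. n \<ge> 1 \<Longrightarrow> correlated_field M (L n) n (b n) (Z n) (\<delta> n)"
    and bandZ: "\<And>n \<omega>. n \<ge> 1 \<Longrightarrow> \<omega> \<in> space M \<Longrightarrow> periodic_band n (b n) (a n \<omega>) = band n (b n) (\<lambda>e. Z n e \<omega>)"
    by metis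
  define m where "m n k \<omega> = band_moment n (b n) k (\<lambda>e. Z n e \<omega>)" for n k \<omega>
  have am: "all_moments (m n k)" if "n \<ge> 1" for n k
    unfolding m_def by (rule correlated_field.all_moments_mom[OF field[OF that]])
  have bn: "1 \<le> b n" "b n \<le> n" if "n \<ge> 1" for n using bandwidth_bounds[OF that bw[OF that]] by auto
  have breal: "filterlim (\<lambda>n. real (b n)) at_top sequentially"
    using blim filterlim_compose filterlim_real_sequentially by blast

  have mean: "(\<lambda>n. expectation (m n k)) \<longlonglongrightarrow> path_count k 0" for k
  proof -
    define q where "q n = real (card (tree_walks n (relevant n (b n)) k 0)) / (real n * sqrt (real (b n)) ^ k)" for n
    define C where "C = 2 * (fact k * 4 ^ k * fact (Suc k) :: real)"
    have q: "q \<longlonglongrightarrow> path_count k 0"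
      unfolding q_def[abs_def]
      using tree_walks_limit[OF blim symp_relevant card_relevant[OF bw], where k = k and h = 0] by simp
    have "norm (expectation (m n k) - q n) \<le> C / sqrt (real (b n))" if n: "n \<ge> 1" for n
    proof -
      \<comment> \<open>This uses \<beta> \<ge> 1/2; since b \<le> n, 1/n then becomes 1/b, with
        \<kappa> = 4.\<close>
      have "\<delta> n \<le> 4 * real n powr (- 1)"
        unfolding \<delta>_def using n \<beta> by (intro mult_left_mono powr_mono) auto
      also have "\<dots> \<le> 4 / real (b n)"
        using bn[OF n] n by (simp add: powr_minus divide_inverse)
      finally have d: "\<delta> n \<le> 4 / real (b n)" .
      show ?thesis
        unfolding m_def q_def C_def real_norm_def
        by (rule correlated_field.expectation_mom[OF field[OF n] _ d]) simp
    qed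
    then have "eventually (\<lambda>n. norm (expectation (m n k) - q n) \<le> C / sqrt (real (b n))) sequentially"
      by (auto simp: eventually_sequentially)
    moreover have "(\<lambda>n. C / sqrt (real (b n))) \<longlonglongrightarrow> 0"
      by (intro tendsto_divide_0[OF tendsto_const] filterlim_at_top_imp_at_infinity
          filterlim_compose[OF sqrt_at_top breal])
    ultimately have "(\<lambda>n. expectation (m n k) - q n) \<longlonglongrightarrow> 0"
      by (rule Lim_null_comparison)
    from tendsto_add[OF this q] show ?thesis by simp
  qed

  have conc: "\<exists>K. \<forall>n\<ge>1. expectation (\<lambda>\<omega>. (m n k \<omega> - expectation (m n k)) ^ (2 * p + 2))
      \<le> K * (real n powr (1 - 2 * \<beta>) / real (b n)) ^ (p + 1)" for k p
  proof -
    let ?j = "2 * (k - 1) * (p + 1)"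
    \<comment> \<open>The moment in the gradient bound has a convergent, hence bounded,
      expectation.\<close>
    obtain B where B: "\<And>n. norm (expectation (m n ?j)) \<le> B"
      using convergent_imp_Bseq[OF convergentI[OF mean[of ?j]]] by (auto simp: Bseq_def)
    define D where "D = (\<Prod>i<p + 1. real (2 * i + 1))"
    have D: "D \<ge> 0" by (simp add: D_def prod_nonneg)
    \<comment> \<open>The 6 is 2 + 4: as \<beta> \<le> 1, the constant 2 is at most 2 n^(2 - 2
      \<beta>), and n^2 \<delta> equals 4 n^(2 - 2 \<beta>).\<close>
    define K where "K = pi ^ (2 * p + 2) * (D * (6 * (real k)\<^sup>2) ^ (p + 1) * B)"
    have "expectation (\<lambda>\<omega>. (m n k \<omega> - expectation (m n k)) ^ (2 * p + 2))
      \<le> K * (real n powr (1 - 2 * \<beta>) / real (b n)) ^ (p + 1)" if n: "n \<ge> 1" for n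
    proof -
      let ?r = "real n powr (1 - 2 * \<beta>) / real (b n)"
      let ?v = "(2 + (real n)\<^sup>2 * \<delta> n) * (real k)\<^sup>2 / (real (b n) * real n)"
      have n0: "real n > 0" "real (b n) > 0" using n bn[OF n] by auto
      have "1 \<le> real n powr (2 - 2 * \<beta>)" using n \<beta> by (intro ge_one_powr_ge_zero) auto
      moreover have "(real n)\<^sup>2 * \<delta> n = 4 * real n powr (2 - 2 * \<beta>)"
      proof -
        have "(real n)\<^sup>2 = real n powr 2" using n0 by simp
        then show ?thesis unfolding \<delta>_def by (simp add: powr_add[symmetric] del: powr_numeral)
      qed
      ultimately have "2 + (real n)\<^sup>2 * \<delta> n \<le> 6 * real n powr (2 - 2 * \<beta>)" by simp
      also have "real n powr (2 - 2 * \<beta>) = real n powr (1 - 2 * \<beta>) * real n"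
        using n0 powr_add[of "real n" "1 - 2 * \<beta>" 1] by simp
      finally have "?v \<le> (6 * (real n powr (1 - 2 * \<beta>) * real n)) * (real k)\<^sup>2 / (real (b n) * real n)"
        using n0 by (intro divide_right_mono mult_right_mono) auto
      also have "\<dots> = 6 * (real k)\<^sup>2 * ?r" using n0 by (simp add: field_simps)
      finally have v: "?v \<le> 6 * (real k)\<^sup>2 * ?r" .
      have v0: "?v \<ge> 0" by (simp add: \<delta>_def)
      have "expectation (\<lambda>\<omega>. (m n k \<omega> - expectation (m n k)) ^ (2 * p + 2))
          \<le> pi ^ (2 * p + 2) * (D * ?v ^ (p + 1) * expectation (m n ?j))"
        unfolding m_def D_def by (rule correlated_field.concentration[OF field[OF n]])
      also have "\<dots> \<le> pi ^ (2 * p + 2) * (D * ?v ^ (p + 1) * B)"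
      proof -
        have "0 \<le> D * ?v ^ (p + 1)" using D v0 by (intro mult_nonneg_nonneg zero_le_power)
        then show ?thesis using B[of n] by (intro mult_left_mono) auto
      qed
      also have "\<dots> \<le> pi ^ (2 * p + 2) * (D * (6 * (real k)\<^sup>2 * ?r) ^ (p + 1) * B)"
        using order_trans[OF norm_ge_zero B[of n]] D v v0
        by (intro mult_left_mono mult_right_mono power_mono) auto
      also have "\<dots> = K * ?r ^ (p + 1)"
        unfolding K_def power_mult_distrib by (simp only: mult_ac)
      finally show ?thesis .
    qed
    then show ?thesis by blast
  qed

  have tail: "\<exists>K N. \<forall>n\<ge>N. n \<ge> 1 \<and> prob {\<omega> \<in> space M. \<bar>m n k \<omega> - path_count k 0\<bar> > \<epsilon>}
      \<le> K * (real n powr (1 - 2 * \<beta>) / real (b n)) ^ (p + 1)" if \<epsilon>: "\<epsilon> > 0" for k p \<epsilon>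
  proof -
    obtain K where K: "\<And>n. n \<ge> 1 \<Longrightarrow> expectation (\<lambda>\<omega>. (m n k \<omega> - expectation (m n k)) ^ (2 * p + 2))
      \<le> K * (real n powr (1 - 2 * \<beta>) / real (b n)) ^ (p + 1)" using conc by blast
    have "eventually (\<lambda>n. dist (expectation (m n k)) (path_count k 0) < \<epsilon> / 2) sequentially"
      using mean[of k] \<epsilon> by (intro tendstoD) auto
    \<comment> \<open>Half of the tolerance goes to the bias of the mean, half to the fluctuation,
      to which Markov's inequality for the even power applies.\<close>
    then obtain N where N: "\<And>n. n \<ge> N \<Longrightarrow> \<bar>expectation (m n k) - path_count k 0\<bar> < \<epsilon> / 2"
      by (auto simp: eventually_sequentially dist_real_def)
    have "n \<ge> 1 \<and> prob {\<omega> \<in> space M. \<bar>m n k \<omega> - path_count k 0\<bar> > \<epsilon>}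
      \<le> K / (\<epsilon> / 2) ^ (2 * p + 2) * (real n powr (1 - 2 * \<beta>) / real (b n)) ^ (p + 1)" if n: "n \<ge> max N 1" for n
    proof
      show n1: "n \<ge> 1" using n by simp
      let ?u = "\<lambda>\<omega>. (m n k \<omega> - expectation (m n k)) ^ (2 * p + 2)"
      have au: "all_moments ?u"
        by (intro all_moments_power all_moments_diff am[OF n1] all_moments_const)
      note [measurable] = all_moments_measurable[OF au]
      have ev: "(\<epsilon> / 2) ^ (2 * p + 2) \<le> ?u \<omega>" if "\<bar>m n k \<omega> - path_count k 0\<bar> > \<epsilon>" for \<omega>
      proof -
        have "N \<le> n" using n by simp
        from that N[OF this] have "\<epsilon> / 2 \<le> \<bar>m n k \<omega> - expectation (m n k)\<bar>" by linarith
        then have "(\<epsilon> / 2) ^ (2 * p + 2) \<le> \<bar>m n k \<omega> - expectation (m n k)\<bar> ^ (2 * p + 2)"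
          using \<epsilon> by (intro power_mono) auto
        also have "\<dots> = ?u \<omega>" by (rule power_even_abs) simp
        finally show ?thesis .
      qed
      have "prob {\<omega> \<in> space M. \<bar>m n k \<omega> - path_count k 0\<bar> > \<epsilon>} \<le> prob {\<omega> \<in> space M. (\<epsilon> / 2) ^ (2 * p + 2) \<le> ?u \<omega>}"
      proof (rule finite_measure_mono)
        show "{\<omega> \<in> space M. \<bar>m n k \<omega> - path_count k 0\<bar> > \<epsilon>} \<subseteq> {\<omega> \<in> space M. (\<epsilon> / 2) ^ (2 * p + 2) \<le> ?u \<omega>}"
          using ev by blast
        show "{\<omega> \<in> space M. (\<epsilon> / 2) ^ (2 * p + 2) \<le> ?u \<omega>} \<in> events" by measurable
      qed
      also have "\<dots> \<le> expectation ?u / (\<epsilon> / 2) ^ (2 * p + 2)"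
      proof (rule integral_Markov_inequality_measure[of M ?u "{}"])
        show "AE \<omega> in M. 0 \<le> ?u \<omega>" by (intro AE_I2 zero_le_even_power) simp
        show "integrable M ?u" by (rule all_moments_integrable[OF au])
        show "0 < (\<epsilon> / 2) ^ (2 * p + 2)" using \<epsilon> by (intro zero_less_power) simp
      qed simp
      also have "\<dots> \<le> K * (real n powr (1 - 2 * \<beta>) / real (b n)) ^ (p + 1) / (\<epsilon> / 2) ^ (2 * p + 2)"
        using \<epsilon> by (intro divide_right_mono K[OF n1]) auto
      finally show "prob {\<omega> \<in> space M. \<bar>m n k \<omega> - path_count k 0\<bar> > \<epsilon>}
        \<le> K / (\<epsilon> / 2) ^ (2 * p + 2) * (real n powr (1 - 2 * \<beta>) / real (b n)) ^ (p + 1)"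
        by (simp only: times_divide_eq_left)
    qed
    then show ?thesis by blast
  qed

  have XZ: "X n \<omega> = band n (b n) (\<lambda>e. Z n e \<omega>)" if "n \<ge> 1" "\<omega> \<in> space M" for n \<omega>
    using X[OF that] bandZ[OF that] by simp
  define xs where "xs n \<omega> = eigenvalue_list (band n (b n) (\<lambda>e. Z n e \<omega>))" for n \<omega>
  have xs: "xs n \<omega> \<noteq> []" if "n \<ge> 1" for n \<omega>
    using eigenvalue_list_moments(1)[OF band_carrier band_symmetric, of n "b n" "\<lambda>e. Z n e \<omega>"] that
    by (auto simp: xs_def)
  have mxs: "average (\<lambda>x. x ^ k) (xs n \<omega>) = m n k \<omega>" if "n \<ge> 1" for n k \<omega>
    unfolding m_def xs_def using correlated_field.band_moment_average[OF field[OF that]] by simp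
  have int: "(LINT x|esd (X n \<omega>). f x) = average f (xs n \<omega>)"
    if "n \<ge> 1" "\<omega> \<in> space M" "continuous_on UNIV f" for n \<omega> f
    unfolding XZ[OF that(1,2)] xs_def
    by (rule integral_esd[OF band_carrier band_symmetric that(1)])
      (rule borel_measurable_continuous_onI[OF that(3)])

  show "semicircle_law_in_probability M X"
    unfolding semicircle_law_in_probability_def tendsto_in_probability_def
  proof (intro allI impI conjI)
    fix f :: "real \<Rightarrow> real" and n :: nat
    assume f: "continuous_on UNIV f \<and> bounded (range f)" and n: "n \<ge> 1"
    have "(\<lambda>\<omega>. average f (xs n \<omega>)) \<in> borel_measurable M"
    proof (rule measurable_average_limit)
      show "(\<lambda>\<omega>. average (\<lambda>x. x ^ k) (xs n \<omega>)) \<in> borel_measurable M" for k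
        unfolding mxs[OF n] using all_moments_measurable[OF am[OF n, of k]] by simp
    qed (use f in auto)
    then show "(\<lambda>\<omega>. LINT x|esd (X n \<omega>). f x) \<in> borel_measurable M"
      by (subst measurable_cong[where g = "\<lambda>\<omega>. average f (xs n \<omega>)"]) (use int[OF n] f in auto)
  next
    fix f :: "real \<Rightarrow> real" and \<epsilon> :: real
    assume f: "continuous_on UNIV f \<and> bounded (range f)" and \<epsilon>: "\<epsilon> > 0"
    then obtain N d where d: "d > 0" and weak: "\<And>xs. xs \<noteq> [] \<Longrightarrow>
        (\<And>k. k \<le> N \<Longrightarrow> \<bar>average (\<lambda>x. x ^ k) xs - path_count k 0\<bar> \<le> d) \<Longrightarrow>
        \<bar>average f xs - (LINT x|semicircle. f x)\<bar> \<le> \<epsilon>"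
      using moments_imp_weak[of f \<epsilon>] by metis
    define E where "E n k = {\<omega> \<in> space M. \<bar>m n k \<omega> - path_count k 0\<bar> > d}" for n k
    have E: "E n k \<in> sets M" if "n \<ge> 1" for n k
    proof -
      note [measurable] = all_moments_measurable[OF am[OF that, of k]]
      show ?thesis unfolding E_def by measurable
    qed
    have lim: "(\<lambda>n. prob (E n k)) \<longlonglongrightarrow> 0" for k
    proof -
      \<comment> \<open>The variance bound, p = 0, suffices: n^(1 - 2 \<beta>) is at most 1, which
        leaves |K| / b.\<close>
      obtain K N where K: "\<And>n. n \<ge> N \<Longrightarrow> n \<ge> 1 \<and> prob (E n k) \<le> K * (real n powr (1 - 2 * \<beta>) / real (b n)) ^ (0 + 1)"
        using tail[OF d, of k 0] unfolding E_def by blast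
      have "norm (prob (E n k)) \<le> \<bar>K\<bar> / real (b n)" if n: "n \<ge> N" for n
      proof -
        have n1: "n \<ge> 1" using K[OF n] by simp
        have "real n powr (1 - 2 * \<beta>) \<le> real n powr 0" using n1 \<beta> by (intro powr_mono) auto
        then have "real n powr (1 - 2 * \<beta>) / real (b n) \<le> 1 / real (b n)"
          using n1 by (intro divide_right_mono) auto
        then have "K * (real n powr (1 - 2 * \<beta>) / real (b n)) \<le> \<bar>K\<bar> * (1 / real (b n))"
          by (intro mult_mono) auto
        then show ?thesis using K[OF n] by simp
      qed
      then have "eventually (\<lambda>n. norm (prob (E n k)) \<le> \<bar>K\<bar> / real (b n)) sequentially"
        by (auto simp: eventually_sequentially)
      then show ?thesis
        by (rule Lim_null_comparison)
          (intro tendsto_divide_0[OF tendsto_const] filterlim_at_top_imp_at_infinity breal)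
    qed
    have "eventually (\<lambda>n. norm (prob {\<omega> \<in> space M. \<epsilon> < \<bar>(LINT x|esd (X n \<omega>). f x) - (LINT x|semicircle. f x)\<bar>})
        \<le> (\<Sum>k\<le>N. prob (E n k))) sequentially"
      using eventually_ge_at_top[of 1]
    proof eventually_elim
      case (elim n)
      \<comment> \<open>If the integral of \<open>f\<close> is off by more than \<epsilon>, one of
        the finitely many controlled moments is off by more than d.\<close>
      have "{\<omega> \<in> space M. \<epsilon> < \<bar>(LINT x|esd (X n \<omega>). f x) - (LINT x|semicircle. f x)\<bar>} \<subseteq> (\<Union>k\<le>N. E n k)"
      proof
        fix \<omega> assume \<omega>: "\<omega> \<in> {\<omega> \<in> space M. \<epsilon> < \<bar>(LINT x|esd (X n \<omega>). f x) - (LINT x|semicircle. f x)\<bar>}"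
        then have "\<not> \<bar>average f (xs n \<omega>) - (LINT x|semicircle. f x)\<bar> \<le> \<epsilon>"
          using int[OF elim, of \<omega> f] f by auto
        then obtain k where "k \<le> N" "\<not> \<bar>average (\<lambda>x. x ^ k) (xs n \<omega>) - path_count k 0\<bar> \<le> d"
          using weak[OF xs[OF elim]] by blast
        then show "\<omega> \<in> (\<Union>k\<le>N. E n k)" using \<omega> mxs[OF elim] by (auto simp: E_def not_le)
      qed
      then have "prob {\<omega> \<in> space M. \<epsilon> < \<bar>(LINT x|esd (X n \<omega>). f x) - (LINT x|semicircle. f x)\<bar>} \<le> prob (\<Union>k\<le>N. E n k)"
        by (rule finite_measure_mono) (use E[OF elim] in auto)
      also have "\<dots> \<le> (\<Sum>k\<le>N. prob (E n k))"
        by (rule finite_measure_subadditive_finite) (use E[OF elim] in auto)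
      finally show ?case by simp
    qed
    moreover have "(\<lambda>n. \<Sum>k\<le>N. prob (E n k)) \<longlonglongrightarrow> 0"
      using tendsto_sum[of "{..N}" "\<lambda>k n. prob (E n k)" "\<lambda>_. 0"] lim by simp
    ultimately show "(\<lambda>n. prob {\<omega> \<in> space M. \<epsilon> < \<bar>(LINT x|esd (X n \<omega>). f x) - (LINT x|semicircle. f x)\<bar>}) \<longlonglongrightarrow> 0"
      by (rule Lim_null_comparison)
  qed

  assume "\<alpha> > 1 / 2"
  then have \<beta>': "\<beta> > 1 / 2" by (auto simp: \<beta>_def)
  have ae: "AE \<omega> in M. eventually (\<lambda>n. \<bar>m n k \<omega> - path_count k 0\<bar> \<le> d) sequentially" if d: "d > 0" for k d
  proof -
    \<comment> \<open>Large enough for (2 \<beta> - 1) (p + 1) \<ge> 2, so that the tail bound is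
      dominated by a multiple of n^(-2).\<close>
    obtain p :: nat where p: "2 / (2 * \<beta> - 1) \<le> real p" using real_arch_simple by blast
    have "2 \<le> real p * (2 * \<beta> - 1)" using p \<beta>' by (simp add: pos_divide_le_eq)
    then have p2: "(1 - 2 * \<beta>) * real (p + 1) \<le> - 2" using \<beta>' by (simp add: algebra_simps)
    obtain K N where K: "\<And>n. n \<ge> N \<Longrightarrow> n \<ge> 1 \<and> prob {\<omega> \<in> space M. \<bar>m n k \<omega> - path_count k 0\<bar> > d}
        \<le> K * (real n powr (1 - 2 * \<beta>) / real (b n)) ^ (p + 1)"
      using tail[OF d, of k p] by blast
    define E where "E n = (if n \<ge> N then {\<omega> \<in> space M. \<bar>m n k \<omega> - path_count k 0\<bar> > d} else {})" for n
    have E: "E n \<in> sets M" for n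
    proof (cases "n \<ge> N")
      case True
      then have n: "n \<ge> 1" using K by blast
      note [measurable] = all_moments_measurable[OF am[OF n, of k]]
      show ?thesis using True unfolding E_def by (simp only: if_True) measurable
    qed (simp add: E_def)
    have bound: "norm (prob (E n)) \<le> \<bar>K\<bar> * inverse (real n ^ 2)" if n: "n \<ge> N" for n
    proof -
      have n1: "n \<ge> 1" using K[OF n] by simp
      have "real n powr (1 - 2 * \<beta>) / real (b n) \<le> real n powr (1 - 2 * \<beta>) / 1"
        using bn[OF n1] by (intro divide_left_mono) auto
      then have "(real n powr (1 - 2 * \<beta>) / real (b n)) ^ (p + 1) \<le> (real n powr (1 - 2 * \<beta>)) ^ (p + 1)"
        by (intro power_mono) auto
      also have "\<dots> = real n powr ((1 - 2 * \<beta>) * real (p + 1))"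
        using n1 by (subst powr_realpow[symmetric]) (auto simp: powr_powr)
      also have "\<dots> \<le> real n powr (- 2)" using n1 p2 by (intro powr_mono) auto
      also have "\<dots> = inverse (real n ^ 2)" using n1 by (simp add: powr_minus)
      finally have "K * (real n powr (1 - 2 * \<beta>) / real (b n)) ^ (p + 1) \<le> \<bar>K\<bar> * inverse (real n ^ 2)"
        by (intro mult_mono) auto
      then show ?thesis using K[OF n] n by (simp add: E_def)
    qed
    have sum: "summable (\<lambda>n. \<bar>K\<bar> * inverse (real n ^ 2))"
      by (intro summable_mult inverse_power_summable) simp
    have "summable (\<lambda>n. prob (E n))"
      by (rule summable_comparison_test[OF _ sum]) (use bound in blast)
    from borel_cantelli_AE1[OF E _ this]
    have "AE \<omega> in M. eventually (\<lambda>n. \<omega> \<in> space M - E n) sequentially" by (simp add: less_top[symmetric])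
    then show ?thesis
    proof eventually_elim
      case (elim \<omega>)
      from elim eventually_ge_at_top[of N] show ?case
        by eventually_elim (auto simp: E_def not_less)
    qed
  qed
  \<comment> \<open>Exponents k and tolerances 1 / (j + 1) form a countable family, so one null set
    serves all of them and every \<open>f\<close>.\<close>
  have "AE \<omega> in M. \<forall>k j. eventually (\<lambda>n. \<bar>m n k \<omega> - path_count k 0\<bar> \<le> 1 / real (Suc j)) sequentially"
    unfolding AE_all_countable by (intro allI ae) simp
  then have main: "AE \<omega> in M. \<omega> \<in> space M \<and> (\<forall>k j. eventually (\<lambda>n. \<bar>m n k \<omega> - path_count k 0\<bar> \<le> 1 / real (Suc j)) sequentially)"
    using AE_space by eventually_elim simp
  show "semicircle_law_almost_surely M X"
    unfolding semicircle_law_almost_surely_def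
  proof (intro allI impI)
    fix f :: "real \<Rightarrow> real"
    assume f: "continuous_on UNIV f \<and> bounded (range f)"
    show "AE \<omega> in M. (\<lambda>n. LINT x|esd (X n \<omega>). f x) \<longlonglongrightarrow> (LINT x|semicircle. f x)"
      using main
    proof eventually_elim
      case (elim \<omega>)
      show ?case
      proof (rule tendstoI)
        fix \<epsilon> :: real assume "\<epsilon> > 0"
        then have "\<epsilon> / 2 > 0" by simp
        then obtain N d where d: "d > 0" and weak: "\<And>xs. xs \<noteq> [] \<Longrightarrow>
            (\<And>k. k \<le> N \<Longrightarrow> \<bar>average (\<lambda>x. x ^ k) xs - path_count k 0\<bar> \<le> d) \<Longrightarrow>
            \<bar>average f xs - (LINT x|semicircle. f x)\<bar> \<le> \<epsilon> / 2"
          using moments_imp_weak[of f "\<epsilon> / 2"] f by metis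
        obtain j where j: "1 / real (Suc j) < d" using nat_approx_posE[OF d] by metis
        have "eventually (\<lambda>n. \<forall>k\<in>{..N}. \<bar>m n k \<omega> - path_count k 0\<bar> \<le> 1 / real (Suc j)) sequentially"
          using elim by (intro eventually_ball_finite) auto
        then show "eventually (\<lambda>n. dist (LINT x|esd (X n \<omega>). f x) (LINT x|semicircle. f x) < \<epsilon>) sequentially"
          using eventually_ge_at_top[of 1]
        proof eventually_elim
          case (elim n)
          have "\<bar>average f (xs n \<omega>) - (LINT x|semicircle. f x)\<bar> \<le> \<epsilon> / 2"
            by (rule weak[OF xs[OF elim(2)]]) (use elim mxs[OF elim(2)] j in force)
          then show ?case
            using int[OF elim(2), of \<omega> f] f \<open>\<epsilon> > 0\<close> \<open>\<omega> \<in> space M \<and> _\<close> by (simp add: dist_real_def)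
        qed
      qed
    qed
  qed
qed

theorem theorem3p13:
  fixes M :: "'w measure" and \<alpha> :: real and S :: "nat \<Rightarrow> real mat"
    and a X :: "nat \<Rightarrow> 'w \<Rightarrow> real mat" and b :: "nat \<Rightarrow> nat"
  assumes "prob_space M"
    and "\<alpha> > 0"
    and "S \<in> CovMat \<alpha>"
    and "gaussian_scheme M \<alpha> S a"
    and "\<And>n. n \<ge> 1 \<Longrightarrow> bandwidth n (b n)"
    and "filterlim b at_top sequentially"
    and "\<And>n \<omega>. n \<ge> 1 \<Longrightarrow> \<omega> \<in> space M \<Longrightarrow> X n \<omega> = periodic_band n (b n) (a n \<omega>)"
  shows "(\<alpha> \<ge> 1 / 2 \<longrightarrow> semicircle_law_in_probability M X) \<and>
     (\<alpha> > 1 / 2 \<and> summable (\<lambda>n. 1 / (real (b n))\<^sup>2) \<longrightarrow> semicircle_law_almost_surely M X) \<and>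
     (\<alpha> > 1 / 2 \<longrightarrow> semicircle_law_almost_surely M (\<lambda>n \<omega>. periodic_band n n (a n \<omega>)))"
proof (intro conjI impI)
  assume "\<alpha> \<ge> 1 / 2"
  then show "semicircle_law_in_probability M X"
    using semicircle_laws(1)[where b = b and X = X, OF assms(1,4,5,6,7)] by blast
next
  assume "\<alpha> > 1 / 2 \<and> summable (\<lambda>n. 1 / (real (b n))\<^sup>2)"
  then show "semicircle_law_almost_surely M X"
    using semicircle_laws(2)[where b = b and X = X, OF assms(1,4,5,6,7)] by simp
next
  assume "\<alpha> > 1 / 2"
  then show "semicircle_law_almost_surely M (\<lambda>n \<omega>. periodic_band n n (a n \<omega>))"
    \<comment> \<open>Full matrices are the case b n = n, a bandwidth by the second alternative of
      the definition.\<close>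
    by (intro semicircle_laws(2)[where b = "\<lambda>n. n", OF assms(1,4)])
      (auto simp: bandwidth_def filterlim_ident)
qed

end
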